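(* Let $(\mathcal M,\delta)$ be a metric space whose Borel probability measures under consideration are Radon, equip $\mathcal M\times\mathcal M$ with the Manhattan metric $d[(x,y),(u,v)]=\delta(x,u)+\delta(y,v)$, and consider nondegenerate $\mathcal M$-valued random variables with finite first moments. Then $\Delta(X,Y)=\mathrm{eCor}(X,Y)$ satisfies: (a) $\mathrm{eCor}(X,Y)=0$ if and only if $X$ and $Y$ are independent; (b* ) $\mathrm{eCor}(f(X),f(Y))=\mathrm{eCor}(X,Y)$ for every similarity transformation $f$ of $(\mathcal M,\delta)$; (c* ) $\mathrm{eCor}(X,Y)=1$ if $Y=f(X)$ with probability $1$ for some similarity transformation $f$ of $(\mathcal M,\delta)$; (d) continuity: if $(X_n,Y_n)$, $n\ge1$, and $(X,Y)$ are pairs of nondegenerate random variables, there exist $x_0,y_0\in\mathcal M$ and a constant $K>0$ with $\mathbb E\big(\delta^2(X_n,x_0)+\delta^2(Y_n,y_0)\big)\le K$ for all $n$, and $(X_n,Y_n)$ converges in distribution to $(X,Y)$, then $\mathrm{eCor}(X_n,Y_n)\to\mathrm{eCor}(X,Y)$.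
   Context: A map $f:\mathcal M\to\mathcal M$ is a similarity if there is $c>0$ with $\delta(f(x),f(y))=c\,\delta(x,y)$ for all $x,y$. A random variable is nondegenerate if it is not a.s. constant; finite first moment means $\mathbb E\,\delta(X,x_0)<\infty$ for some $x_0$. For probability measures $\mu,\nu$ with finite first moments on a metric space $(S,\rho)$, $e(\mu,\nu)=\inf_\gamma\int\rho\,d\gamma$ over all couplings $\gamma$ of $\mu,\nu$ (earth mover's / Wasserstein-1 distance). The earth mover's covariance is $\mathrm{eCov}(X,Y)=e\big[(X,Y),(X',Y')\big]$, the distance w.r.t. $d$ between the joint law of $(X,Y)$ and the product of its marginals (law of $(X',Y')$ with $X'\overset d=X$, $Y'\overset d=Y$, $X',Y'$ independent); $\mathrm{eVar}(X)=\mathrm{eCov}(X,X)$; $\mathrm{eCor}(X,Y)=\mathrm{eCov}(X,Y)/\min\{\mathrm{eVar}(X),\mathrm{eVar}(Y)\}$, defined when the denominator is positive. *)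

theory Defs
  imports "HOL-Probability.Probability"
begin

definition manhattan :: "('a::metric_space \<times> 'a) \<Rightarrow> ('a \<times> 'a) \<Rightarrow> real" where
  "manhattan p q = dist (fst p) (fst q) + dist (snd p) (snd q)"

definition radon :: "'a::topological_space measure \<Rightarrow> bool" where
  "radon \<mu> \<longleftrightarrow> sets \<mu> = sets borel \<and>
     (\<forall>A\<in>sets \<mu>. emeasure \<mu> A = (SUP K\<in>{K. compact K \<and> K \<subseteq> A}. emeasure \<mu> K))"

definition couplings :: "'s::topological_space measure \<Rightarrow> 's measure \<Rightarrow> ('s \<times> 's) measure set" where
  "couplings \<mu> \<nu> = {\<gamma>. prob_space \<gamma> \<and> sets \<gamma> = sets borel \<and>
      distr \<gamma> borel fst = \<mu> \<and> distr \<gamma> borel snd = \<nu>}"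

definition emd :: "('s::topological_space \<Rightarrow> 's \<Rightarrow> real) \<Rightarrow> 's measure \<Rightarrow> 's measure \<Rightarrow> real" where
  "emd \<rho> \<mu> \<nu> = enn2real (INF \<gamma>\<in>couplings \<mu> \<nu>. \<integral>\<^sup>+ z. ennreal (\<rho> (fst z) (snd z)) \<partial>\<gamma>)"

definition law :: "'b measure \<Rightarrow> ('b \<Rightarrow> 'a::topological_space) \<Rightarrow> 'a measure" where
  "law M X = distr M borel X"

definition joint_law :: "'b measure \<Rightarrow> ('b \<Rightarrow> 'a::topological_space) \<Rightarrow> ('b \<Rightarrow> 'a) \<Rightarrow> ('a \<times> 'a) measure" where
  "joint_law M X Y = distr M borel (\<lambda>\<omega>. (X \<omega>, Y \<omega>))"

text \<open>Law of (X',Y') with X' ~ X, Y' ~ Y independent: the (unique) Radon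
  probability measure on the Borel sets of M x M that is the product of the marginals.\<close>
definition prod_law :: "'b measure \<Rightarrow> ('b \<Rightarrow> 'a::topological_space) \<Rightarrow> ('b \<Rightarrow> 'a) \<Rightarrow> ('a \<times> 'a) measure" where
  "prod_law M X Y = (THE \<nu>. prob_space \<nu> \<and> radon \<nu> \<and>
      (\<forall>A\<in>sets borel. \<forall>B\<in>sets borel.
         emeasure \<nu> (A \<times> B) = emeasure (law M X) A * emeasure (law M Y) B))"

definition eCov :: "'b measure \<Rightarrow> ('b \<Rightarrow> 'a::metric_space) \<Rightarrow> ('b \<Rightarrow> 'a) \<Rightarrow> real" where
  "eCov M X Y = emd manhattan (joint_law M X Y) (prod_law M X Y)"

definition eVar :: "'b measure \<Rightarrow> ('b \<Rightarrow> 'a::metric_space) \<Rightarrow> real" where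
  "eVar M X = eCov M X X"

definition eCor :: "'b measure \<Rightarrow> ('b \<Rightarrow> 'a::metric_space) \<Rightarrow> ('b \<Rightarrow> 'a) \<Rightarrow> real" where
  "eCor M X Y = eCov M X Y / min (eVar M X) (eVar M Y)"

definition similarity :: "('a::metric_space \<Rightarrow> 'a) \<Rightarrow> bool" where
  "similarity f \<longleftrightarrow> (\<exists>c>0. \<forall>x y. dist (f x) (f y) = c * dist x y)"

definition nondegenerate :: "'b measure \<Rightarrow> ('b \<Rightarrow> 'a) \<Rightarrow> bool" where
  "nondegenerate M X \<longleftrightarrow> \<not> (\<exists>c. AE \<omega> in M. X \<omega> = c)"

definition finite_first_moment :: "'b measure \<Rightarrow> ('b \<Rightarrow> 'a::metric_space) \<Rightarrow> bool" where
  "finite_first_moment M X \<longleftrightarrow> (\<exists>x0. (\<integral>\<^sup>+ \<omega>. ennreal (dist (X \<omega>) x0) \<partial>M) < \<infinity>)"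

definition admissible_pair :: "'b measure \<Rightarrow> ('b \<Rightarrow> 'a::metric_space) \<Rightarrow> ('b \<Rightarrow> 'a) \<Rightarrow> bool" where
  "admissible_pair M X Y \<longleftrightarrow> prob_space M \<and>
     X \<in> borel_measurable M \<and> Y \<in> borel_measurable M \<and>
     (\<lambda>\<omega>. (X \<omega>, Y \<omega>)) \<in> borel_measurable M \<and>
     nondegenerate M X \<and> nondegenerate M Y \<and>
     finite_first_moment M X \<and> finite_first_moment M Y \<and>
     radon (law M X) \<and> radon (law M Y) \<and> radon (joint_law M X Y)"

definition conv_distr :: "(nat \<Rightarrow> 's::metric_space measure) \<Rightarrow> 's measure \<Rightarrow> bool" where
  "conv_distr \<mu>s \<mu> \<longleftrightarrow> (\<forall>f :: 's \<Rightarrow> real. continuous_on UNIV f \<and> bounded (range f) \<longrightarrow>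
      (\<lambda>n. \<integral> z. f z \<partial>(\<mu>s n)) \<longlonglongrightarrow> (\<integral> z. f z \<partial>\<mu>))"

end

theory Submission
  imports Defs
begin

text \<open>
  Radon laws are carried by sigma-compact sets, which makes product measures and couplings
  manageable on a nonseparable space. The triangle inequality for the transport cost follows from
  an approximate gluing of couplings. Since a coupling of $J$ and $J'$ yields, by
  taking two independent copies of it, a coupling of the products of the marginals with the
  same cost, the covariance is 2-Lipschitz in the joint law $J$; continuity thus reduces to the fact
  that weak convergence with bounded second moments implies convergence of the transport cost to 0.

  Resampling a single coordinate shows that the covariance is at most the mean distance of two
  independent copies of $X$, and also of $Y$. When $Y$ is the image of $X$ under a similarity, no
  coupling is cheaper than the smaller of these two, and the case $Y = X$ identifies them as
  the variances.
\<close>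

section \<open>Sigma-compact sets and tight measures\<close>

text \<open>Two obstacles shape the proof. On a nonseparable space the distance on a product need
  not be measurable for the product sigma-algebra, so Fubini cannot be applied to the cost itself.
  Integrals over a product measure are therefore only factored for integrands f(x) g(y), and the
  couplings built by hand have densities of the form sum p_i(x) q_i(y), whose marginals need nothing
  more. The second obstacle is that \<open>emd\<close> sends an infinite cost to 0. All metric
  arguments run with extended costs, and the finite first moments serve to show that the truncation
  never acts. The minimum in the denominator has a geometric origin: a similarity of ratio c
  multiplies the variance by c, so X and f(X) have different variances, and the cheapest way to
  destroy their dependence is to resample the coordinate with the smaller one. In the continuity
  part the second moments price the mass R that cannot be matched locally: for every t > 0 it costs
  at most of order t K + R / t, which is small once R is small compared with a suitable t.\<close>

definition sigma_compact :: "'a::topological_space set \<Rightarrow> bool" where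
  "sigma_compact S \<longleftrightarrow> (\<exists>K::nat \<Rightarrow> 'a set. (\<forall>n. compact (K n)) \<and> S = (\<Union>n. K n))"

lemma sigma_compactI_countable:
  assumes "countable \<K>" "\<And>K. K \<in> \<K> \<Longrightarrow> compact K" "S = \<Union>\<K>"
  shows "sigma_compact S"
proof (cases "\<K> = {}")
  case True
  then show ?thesis using assms unfolding sigma_compact_def by (auto intro!: exI[of _ "\<lambda>_. {}"])
next
  case False
  then show ?thesis
    unfolding sigma_compact_def using assms
    by (intro exI[of _ "from_nat_into \<K>"]) (auto simp: from_nat_into UN_from_nat_into intro: from_nat_into_surj)
qed

lemma sigma_compact_borel:
  fixes S :: "'a::t2_space set"
  assumes "sigma_compact S"
  shows "S \<in> sets borel"
proof -
  obtain K where "\<And>n::nat. compact (K n)" "S = (\<Union>n. K n)"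
    using assms unfolding sigma_compact_def by metis
  then show ?thesis by (simp add: sets.countable_UN compact_imp_closed image_subset_iff)
qed

lemma sigma_compact_image:
  assumes "sigma_compact S" "continuous_on UNIV f"
  shows "sigma_compact (f ` S)"
proof -
  obtain K where K: "\<And>n::nat. compact (K n)" "S = (\<Union>n. K n)"
    using assms unfolding sigma_compact_def by metis
  have "compact (f ` K n)" for n
    by (rule compact_continuous_image[OF continuous_on_subset[OF assms(2)] K(1)]) auto
  moreover have "f ` S = (\<Union>n. f ` K n)" unfolding K(2) by auto
  ultimately show ?thesis unfolding sigma_compact_def by (intro exI[of _ "\<lambda>n. f ` K n"]) simp
qed

lemma sigma_compact_Times:
  assumes "sigma_compact S" "sigma_compact T"
  shows "sigma_compact (S \<times> T)"
proof -
  obtain K L where K: "\<And>n::nat. compact (K n)" "S = (\<Union>n. K n)" and L: "\<And>n::nat. compact (L n)" "T = (\<Union>n. L n)"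
    using assms unfolding sigma_compact_def by metis
  show ?thesis
    by (rule sigma_compactI_countable[of "range (\<lambda>(m, n). K m \<times> L n)"])
       (use K L in \<open>auto intro!: compact_Times\<close>)
qed

text \<open>Each compact piece has a finite net at every scale 1/(m+1), and the union of all nets is
  countable. The net points may lie outside S; only approximation from D is ever used.\<close>

lemma sigma_compact_countable_dense:
  fixes S :: "'a::metric_space set"
  assumes "sigma_compact S"
  obtains D where "countable D" "\<And>x e. x \<in> S \<Longrightarrow> 0 < e \<Longrightarrow> \<exists>d\<in>D. dist x d < e"
proof -
  obtain K where K: "\<And>n::nat. compact (K n)" "S = (\<Union>n. K n)"
    using assms unfolding sigma_compact_def by metis
  have "\<exists>k. finite k \<and> K n \<subseteq> (\<Union>x\<in>k. ball x (1 / Suc m))" for n m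
    using K(1)[of n] unfolding compact_eq_totally_bounded by auto
  then obtain k where k: "\<And>n m. finite (k n m)" "\<And>n m. K n \<subseteq> (\<Union>x\<in>k n m. ball x (1 / Suc m))"
    by metis
  show ?thesis
  proof (rule that[of "\<Union>n m. k n m"])
    show "countable (\<Union>n m. k n m)" using k(1) by (intro countable_UN) (auto intro: countable_finite)
    fix x and e :: real assume "x \<in> S" "0 < e"
    then obtain n m where "x \<in> K n" "1 / Suc m < e"
      using K(2) nat_approx_posE by (metis UN_E)
    then show "\<exists>d\<in>(\<Union>n m. k n m). dist x d < e"
      using k(2)[of n m] by (force simp: dist_commute)
  qed
qed

text \<open>A Radon probability, encoded by one carrier instead of inner regularity on every Borel
  set. The carrier passes to continuous images, products and couplings by plain set operations;
  \<open>tight_prob_iff_radon\<close> links the two forms.\<close>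

definition tight_prob :: "'a::metric_space measure \<Rightarrow> bool" where
  "tight_prob \<mu> \<longleftrightarrow> prob_space \<mu> \<and> sets \<mu> = sets borel \<and>
     (\<exists>S. sigma_compact S \<and> (AE x in \<mu>. x \<in> S))"

lemma tight_probD:
  assumes "tight_prob \<mu>"
  shows "prob_space \<mu>" "sets \<mu> = sets borel" "space \<mu> = UNIV" "emeasure \<mu> UNIV = 1"
    "measurable \<mu> N = measurable borel N" "finite_measure \<mu>" "sigma_finite_measure \<mu>"
proof -
  show *: "prob_space \<mu>" "sets \<mu> = sets borel" using assms unfolding tight_prob_def by auto
  then interpret prob_space \<mu> by simp
  show "space \<mu> = UNIV" using *(2) by (metis sets_eq_imp_space_eq space_borel)
  with emeasure_space_1 show "emeasure \<mu> UNIV = 1" by simp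
  show "measurable \<mu> N = measurable borel N" using *(2) by (intro measurable_cong_sets) auto
  show "finite_measure \<mu>" "sigma_finite_measure \<mu>" by unfold_locales
qed

lemma tight_probE:
  assumes "tight_prob \<mu>"
  obtains S where "sigma_compact S" "AE x in \<mu>. x \<in> S"
  using assms unfolding tight_prob_def by auto

text \<open>Inner regularity is needed for the whole space only: compact sets of mass above 1 -
  1/(n+1) have a union of full mass.\<close>

lemma radon_imp_tight_prob:
  fixes \<mu> :: "'a::metric_space measure"
  assumes "prob_space \<mu>" "radon \<mu>"
  shows "tight_prob \<mu>"
proof -
  interpret prob_space \<mu> by fact
  have [simp, measurable_cong]: "sets \<mu> = sets borel" using assms(2) by (simp add: radon_def)
  have sp: "space \<mu> = UNIV" by (metis \<open>sets \<mu> = sets borel\<close> sets_eq_imp_space_eq space_borel)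
  have "emeasure \<mu> UNIV = (SUP K\<in>{K. compact K \<and> K \<subseteq> UNIV}. emeasure \<mu> K)"
    using assms(2) unfolding radon_def by auto
  then have sup: "(SUP K\<in>{K. compact K \<and> K \<subseteq> UNIV}. emeasure \<mu> K) = 1"
    using emeasure_space_1 sp by simp
  have "\<exists>K. compact K \<and> ennreal (1 - 1 / Suc n) < emeasure \<mu> K" for n
  proof -
    have "ennreal (1 - 1 / Suc n) < 1" by (simp add: ennreal_less_one_iff)
    then have "ennreal (1 - 1 / Suc n) < (SUP K\<in>{K. compact K \<and> K \<subseteq> UNIV}. emeasure \<mu> K)"
      unfolding sup .
    then show ?thesis unfolding less_SUP_iff by auto
  qed
  then obtain K where K: "\<And>n. compact (K n)" "\<And>n. ennreal (1 - 1 / Suc n) < emeasure \<mu> (K n)"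
    by metis
  define S where "S = (\<Union>n. K n)"
  have S: "sigma_compact S" using K(1) unfolding S_def sigma_compact_def by auto
  then have [measurable]: "S \<in> sets \<mu>" using sigma_compact_borel by simp
  have "1 - 1 / real (Suc n) \<le> measure \<mu> S" for n
  proof -
    have "ennreal (1 - 1 / Suc n) \<le> emeasure \<mu> S"
      using K(2)[of n] by (rule order.trans[OF less_imp_le]) (auto intro!: emeasure_mono simp: S_def, use S_def \<open>S \<in> sets \<mu>\<close> in auto)
    then show ?thesis by (simp add: emeasure_eq_measure)
  qed
  moreover have "(\<lambda>n. 1 - 1 / real (Suc n)) \<longlonglongrightarrow> 1 - 0"
    by (intro tendsto_intros LIMSEQ_Suc lim_1_over_n)
  ultimately have "1 - 0 \<le> measure \<mu> S"
    by (intro LIMSEQ_le_const2[of "\<lambda>n. 1 - 1 / real (Suc n)"]) auto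
  then have "prob S = 1"
    using prob_le_1[of S] by simp
  then have "AE x in \<mu>. x \<in> S" by (rule AE_prob_1)
  then show ?thesis unfolding tight_prob_def using S assms by auto
qed

text \<open>The sets that can be squeezed between a closed and an open set with small difference
  form a sigma-algebra containing the closed sets. Squeezing from both sides is what makes the
  property survive complements.\<close>

lemma borel_closed_open_approx:
  fixes \<mu> :: "'a::metric_space measure"
  assumes "finite_measure \<mu>" and sets: "sets \<mu> = sets borel" and A: "A \<in> sets borel" and "0 < e"
  obtains F U where "closed F" "open U" "F \<subseteq> A" "A \<subseteq> U" "measure \<mu> (U - F) < e"
proof -
  interpret finite_measure \<mu> by fact
  note [simp] = sets
  have sp: "space \<mu> = UNIV" using sets by (metis sets_eq_imp_space_eq space_borel)
  have "A \<in> sigma_sets UNIV {S. closed S}"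
    using A by (simp add: borel_eq_closed)
  then have "\<forall>e>0. \<exists>F U. closed F \<and> open U \<and> F \<subseteq> A \<and> A \<subseteq> U \<and> measure \<mu> (U - F) < e"
  proof induction
    case (Basic A)
    then have A: "closed A" by simp
    show ?case
    proof (cases "A = {}")
      case True
      show ?thesis unfolding True by (auto intro!: exI[of _ "{}"])
    next
      case False
      \<comment> \<open>Open neighbourhoods shrinking to the closed set A; a point outside A has
        positive distance to A, so U n - A decreases to the empty set.\<close>
      define U where "U n = {x. infdist x A < 1 / Suc n}" for n
      have U: "open (U n)" "A \<subseteq> U n" for n
        unfolding U_def by (auto intro!: open_Collect_less continuous_intros)
      have "decseq (\<lambda>n. U n - A)"
        unfolding decseq_def U_def by (auto intro: less_le_trans[OF _ divide_left_mono])
      moreover have [simp]: "U n \<in> sets borel" "A \<in> sets borel" for n using U(1) A by auto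
      ultimately have "(\<lambda>n. measure \<mu> (U n - A)) \<longlonglongrightarrow> measure \<mu> (\<Inter>n. U n - A)"
        by (intro finite_Lim_measure_decseq) auto
      moreover have "(\<Inter>n. U n - A) = {}"
      proof (rule ccontr)
        assume "(\<Inter>n. U n - A) \<noteq> {}"
        then obtain x where x: "\<And>n. infdist x A < 1 / Suc n" "x \<notin> A" unfolding U_def by auto
        have "0 < infdist x A" using x(2) A False in_closed_iff_infdist_zero infdist_nonneg[of x A] by force
        then obtain n where "1 / real (Suc n) < infdist x A" by (rule nat_approx_posE)
        with x(1)[of n] show False by simp
      qed
      ultimately have lim: "(\<lambda>n. measure \<mu> (U n - A)) \<longlonglongrightarrow> 0" by (simp only: measure_empty)
      show ?thesis
      proof (intro allI impI)
        fix e :: real assume "0 < e"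
        from order_tendstoD(2)[OF lim this] obtain n where "measure \<mu> (U n - A) < e"
          by (auto simp: eventually_sequentially)
        with A U show "\<exists>F U. closed F \<and> open U \<and> F \<subseteq> A \<and> A \<subseteq> U \<and> measure \<mu> (U - F) < e"
          by (intro exI[of _ A] exI[of _ "U n"]) auto
      qed
    qed
  next
    case Empty
    show ?case by (auto intro!: exI[of _ "{}"])
  next
    case (Compl A)
    show ?case
    proof (intro allI impI)
      fix e :: real assume "0 < e"
      with Compl.IH obtain F U where FU: "closed F" "open U" "F \<subseteq> A" "A \<subseteq> U" "measure \<mu> (U - F) < e"
        by metis
      have "- F - - U = U - F" by auto
      then have "closed (- U) \<and> open (- F) \<and> - U \<subseteq> UNIV - A \<and> UNIV - A \<subseteq> - F \<and> measure \<mu> (- F - - U) < e"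
        using FU by (simp only: closed_Compl open_Compl) auto
      then show "\<exists>F U. closed F \<and> open U \<and> F \<subseteq> UNIV - A \<and> UNIV - A \<subseteq> U \<and> measure \<mu> (U - F) < e"
        by blast
    qed
  next
    case (Union A)
    show ?case
    proof (intro allI impI)
      fix e :: real assume e: "0 < e"
      \<comment> \<open>Half of e is spread geometrically over the countably many approximations.
        The other half is reserved for passing to a finite union of the closed sets, since the
        infinite union need not be closed.\<close>
      have "\<exists>F U. closed F \<and> open U \<and> F \<subseteq> A i \<and> A i \<subseteq> U \<and> measure \<mu> (U - F) < e / 2 * (1 / 2) ^ Suc i" for i
        using Union.IH[of i, rule_format, of "e / 2 * (1 / 2) ^ Suc i"] e by simp
      then obtain F U where FU: "\<And>i. closed (F i)" "\<And>i. open (U i)" "\<And>i. F i \<subseteq> A i" "\<And>i. A i \<subseteq> U i"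
        "\<And>i. measure \<mu> (U i - F i) < e / 2 * (1 / 2) ^ Suc i"
        by metis
      have [simp]: "F i \<in> sets borel" "U i \<in> sets borel" for i using FU by auto
      have s: "(\<lambda>i. e / 2 * (1 / 2) ^ Suc i) sums (e / 2 * 1)"
        by (intro sums_mult power_half_series)
      have sm: "summable (\<lambda>i. measure \<mu> (U i - F i))"
        by (rule summable_comparison_test[OF _ sums_summable[OF s]]) (use FU(5) less_imp_le in auto)
      define V where "V = (\<Union>i. U i)"
      define G where "G = (\<Union>i. F i)"
      define H where "H n = (\<Union>i<n. F i)" for n
      have [simp]: "V \<in> sets borel" "G \<in> sets borel" "H n \<in> sets borel" "(\<Union>i. U i - F i) \<in> sets borel" for n
        unfolding V_def G_def H_def by (intro sets.countable_UN sets.finite_UN; auto)+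
      have "measure \<mu> (V - G) \<le> measure \<mu> (\<Union>i. U i - F i)"
        by (intro finite_measure_mono) (auto simp: V_def G_def)
      also have "\<dots> \<le> (\<Sum>i. measure \<mu> (U i - F i))"
        by (intro finite_measure_subadditive_countably sm) auto
      also have "\<dots> \<le> (\<Sum>i. e / 2 * (1 / 2) ^ Suc i)"
        by (intro suminf_le sm sums_summable[OF s] less_imp_le FU(5))
      also have "\<dots> = e / 2" using sums_unique[OF s] by simp
      finally have 1: "measure \<mu> (V - G) \<le> e / 2" .
      have "decseq (\<lambda>n. G - H n)" by (auto simp: decseq_def H_def)
      then have "(\<lambda>n. measure \<mu> (G - H n)) \<longlonglongrightarrow> measure \<mu> (\<Inter>n. G - H n)"
        by (intro finite_Lim_measure_decseq) auto
      also have "(\<Inter>n. G - H n) = {}" by (auto simp: G_def H_def)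
      finally have "(\<lambda>n. measure \<mu> (G - H n)) \<longlonglongrightarrow> 0" by (simp only: measure_empty)
      from order_tendstoD(2)[OF this, of "e / 2"] e
      obtain n where n: "measure \<mu> (G - H n) < e / 2"
        by (auto simp: eventually_sequentially)
      have "measure \<mu> (V - H n) \<le> measure \<mu> ((V - G) \<union> (G - H n))"
        by (intro finite_measure_mono, blast) (simp add: sets.Un sets.Diff)
      also have "\<dots> \<le> measure \<mu> (V - G) + measure \<mu> (G - H n)"
        by (intro measure_Un_le) auto
      also have "\<dots> < e" using 1 n by simp
      finally have "measure \<mu> (V - H n) < e" .
      moreover have "closed (H n)" "open V"
        unfolding V_def H_def using FU(1,2) by (auto intro!: closed_UN open_UN)
      moreover have "H n \<subseteq> \<Union> (range A)" "\<Union> (range A) \<subseteq> V"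
        unfolding V_def H_def using FU(3,4) by (meson SUP_subset_mono UN_mono UNIV_I subset_UNIV order.refl)+
      ultimately show "\<exists>F U. closed F \<and> open U \<and> F \<subseteq> \<Union> (range A) \<and> \<Union> (range A) \<subseteq> U \<and> measure \<mu> (U - F) < e"
        by (intro exI[of _ "H n"] exI[of _ V]) simp
    qed
  qed
  with \<open>0 < e\<close> show ?thesis using that by metis
qed

text \<open>A closed inner approximation intersected with a large finite union of the carrier's
  compact pieces is compact, and each of the two cuts loses less than e/2.\<close>

lemma tight_prob_imp_radon:
  fixes \<mu> :: "'a::metric_space measure"
  assumes "tight_prob \<mu>"
  shows "radon \<mu>"
proof -
  note [simp] = tight_probD(2,3)[OF assms]
  interpret prob_space \<mu> using assms by (rule tight_probD)
  obtain S where S: "sigma_compact S" "AE x in \<mu>. x \<in> S" using assms by (rule tight_probE)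
  then obtain K where K: "\<And>n::nat. compact (K n)" "S = (\<Union>n. K n)"
    unfolding sigma_compact_def by metis
  have [simp]: "K n \<in> sets borel" for n using K by (auto intro: borel_closed compact_imp_closed)
  have "emeasure \<mu> A = (SUP K\<in>{K. compact K \<and> K \<subseteq> A}. emeasure \<mu> K)" if A: "A \<in> sets borel" for A
  proof (rule antisym)
    show "(SUP K\<in>{K. compact K \<and> K \<subseteq> A}. emeasure \<mu> K) \<le> emeasure \<mu> A"
      using A by (auto intro!: SUP_least emeasure_mono)
    show "emeasure \<mu> A \<le> (SUP K\<in>{K. compact K \<and> K \<subseteq> A}. emeasure \<mu> K)"
    proof (rule ennreal_le_epsilon)
      fix e :: real assume e: "0 < e"
      have "finite_measure \<mu>" by unfold_locales
      from borel_closed_open_approx[OF this _ A, of "e / 2"] e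
      obtain F U where FU: "closed F" "open U" "F \<subseteq> A" "A \<subseteq> U" "measure \<mu> (U - F) < e / 2" by auto
      have [simp]: "F \<in> sets borel" "U \<in> sets borel" using FU by auto
      define H where "H n = (\<Union>i<n. K i)" for n
      have [simp]: "H n \<in> sets borel" for n unfolding H_def by (intro sets.finite_UN) auto
      have "decseq (\<lambda>n. UNIV - H n)" by (auto simp: decseq_def H_def)
      then have "(\<lambda>n. measure \<mu> (UNIV - H n)) \<longlonglongrightarrow> measure \<mu> (\<Inter>n. UNIV - H n)"
        by (intro finite_Lim_measure_decseq) auto
      also have "(\<Inter>n. UNIV - H n) = space \<mu> - S" using K by (auto simp: H_def)
      also have "measure \<mu> \<dots> = 0"
        using S(2) sigma_compact_borel[OF S(1)] prob_Collect_eq_1[of "\<lambda>x. x \<in> S"] by (subst prob_compl) auto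
      finally obtain n where n: "measure \<mu> (UNIV - H n) < e / 2"
        using e order_tendstoD(2)[of "\<lambda>n. measure \<mu> (UNIV - H n)" 0 sequentially "e / 2"]
        by (auto simp: eventually_sequentially)
      define L where "L = F \<inter> H n"
      have L: "compact L" "L \<subseteq> A"
        unfolding L_def H_def using FU K by (auto intro!: closed_Int_compact compact_UN)
      then have [simp]: "L \<in> sets borel" by (auto intro: borel_closed compact_imp_closed)
      have "measure \<mu> A \<le> measure \<mu> (L \<union> ((U - F) \<union> (UNIV - H n)))"
        using FU A by (intro finite_measure_mono, unfold L_def, blast) (simp add: sets.Un sets.Diff sets.Int)
      also have "\<dots> \<le> measure \<mu> L + measure \<mu> ((U - F) \<union> (UNIV - H n))"
        by (intro measure_Un_le) (simp_all add: sets.Un sets.Diff)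
      also have "measure \<mu> ((U - F) \<union> (UNIV - H n)) \<le> measure \<mu> (U - F) + measure \<mu> (UNIV - H n)"
        by (intro measure_Un_le) (simp_all add: sets.Un sets.Diff)
      finally have "measure \<mu> A \<le> measure \<mu> L + e" using n FU(5) by simp
      then have "emeasure \<mu> A \<le> emeasure \<mu> L + ennreal e"
        using e by (simp add: emeasure_eq_measure flip: ennreal_plus)
      also have "emeasure \<mu> L \<le> (SUP K\<in>{K. compact K \<and> K \<subseteq> A}. emeasure \<mu> K)"
        using L by (intro SUP_upper) auto
      finally show "emeasure \<mu> A \<le> (SUP K\<in>{K. compact K \<and> K \<subseteq> A}. emeasure \<mu> K) + ennreal e"
        by (simp add: add_mono)
    qed
  qed
  then show ?thesis unfolding radon_def by auto
qed

lemma tight_prob_iff_radon: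
  fixes \<mu> :: "'a::metric_space measure"
  shows "tight_prob \<mu> \<longleftrightarrow> prob_space \<mu> \<and> radon \<mu>"
  using radon_imp_tight_prob[of \<mu>] tight_prob_imp_radon[of \<mu>] tight_probD(1)[of \<mu>] by (intro iffI conjI) auto

lemma tight_prob_distr:
  assumes "tight_prob \<mu>" "continuous_on UNIV f"
  shows "tight_prob (distr \<mu> borel f)"
proof -
  interpret prob_space \<mu> using assms(1) by (rule tight_probD(1))
  have f[measurable]: "f \<in> measurable \<mu> borel"
    using assms by (simp add: tight_probD borel_measurable_continuous_onI)
  obtain S where S: "sigma_compact S" "AE x in \<mu>. x \<in> S" using assms(1) by (rule tight_probE)
  have "AE y in distr \<mu> borel f. y \<in> f ` S"
    using S(2) sigma_compact_borel[OF sigma_compact_image[OF S(1) assms(2)]]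
    by (subst AE_distr_iff) auto
  then show ?thesis
    unfolding tight_prob_def using prob_space_distr[OF f] sigma_compact_image[OF S(1) assms(2)] by auto
qed

section \<open>Radon products\<close>

lemma measurable_fst_borel [measurable]: "fst \<in> borel_measurable (borel :: ('a::topological_space \<times> 'b::topological_space) measure)"
  and measurable_snd_borel [measurable]: "snd \<in> borel_measurable (borel :: ('a::topological_space \<times> 'b::topological_space) measure)"
  by (intro borel_measurable_continuous_onI continuous_intros)+

text \<open>On a nonseparable space the Borel sets of a product may form a larger family than the product
  sigma-algebra. A Radon measure is carried by a sigma-compact, hence separable, set, and there
  the two families have the same traces.\<close>

lemma measurable_sigma_compact_Times:
  fixes S :: "'a::metric_space set" and T :: "'b::metric_space set"
  assumes "sigma_compact S" "sigma_compact T"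
  shows "(\<lambda>z. if z \<in> S \<times> T then z else c) \<in> measurable (borel \<Otimes>\<^sub>M borel) borel"
proof (rule borel_measurableI)
  obtain D where D: "countable D" "\<And>x e. x \<in> S \<Longrightarrow> 0 < e \<Longrightarrow> \<exists>d\<in>D. dist x d < e"
    using assms(1) by (rule sigma_compact_countable_dense) blast
  obtain E where E: "countable E" "\<And>x e. x \<in> T \<Longrightarrow> 0 < e \<Longrightarrow> \<exists>d\<in>E. dist x d < e"
    using assms(2) by (rule sigma_compact_countable_dense) blast
  have [measurable]: "S \<in> sets borel" "T \<in> sets borel"
    using assms by (auto intro: sigma_compact_borel)
  fix U :: "('a \<times> 'b) set" assume U: "open U"
  \<comment> \<open>Only countably many products of balls with centres in D and E occur, so their
    union stays in the product sigma-algebra, although U itself may be an arbitrary union of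
    rectangles.\<close>
  define I where "I = {(d, e, n::nat). d \<in> D \<and> e \<in> E \<and> ball d (1 / Suc n) \<times> ball e (1 / Suc n) \<subseteq> U}"
  have "countable I"
    by (rule countable_subset[of _ "D \<times> E \<times> UNIV"]) (auto simp: I_def D E)
  have "U \<inter> S \<times> T = (\<Union>(d, e, n)\<in>I. ball d (1 / Suc n) \<times> ball e (1 / Suc n)) \<inter> S \<times> T"
  proof (intro equalityI subsetI)
    fix z assume z: "z \<in> U \<inter> S \<times> T"
    then obtain x y where xy: "z = (x, y)" "x \<in> S" "y \<in> T" by auto
    obtain A B where AB: "open A" "open B" "x \<in> A" "y \<in> B" "A \<times> B \<subseteq> U"
      using open_prod_elim[OF U, of z] z xy by (metis IntD1 mem_Sigma_iff)
    obtain r s where rs: "0 < r" "ball x r \<subseteq> A" "0 < s" "ball y s \<subseteq> B"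
      using AB open_contains_ball by metis
    \<comment> \<open>Twice the radius has to fit: a point of the ball around d is within 1/(n+1) of
      d, and d is within 1/(n+1) of x.\<close>
    obtain n where n: "1 / real (Suc n) < min r s / 2"
      using rs nat_approx_posE[of "min r s / 2"] by auto
    obtain d e where de: "d \<in> D" "dist x d < 1 / Suc n" "e \<in> E" "dist y e < 1 / Suc n"
      using D(2)[OF xy(2), of "1 / Suc n"] E(2)[OF xy(3), of "1 / Suc n"] by auto
    have "ball d (1 / Suc n) \<subseteq> ball x r"
    proof
      fix u assume "u \<in> ball d (1 / Suc n)"
      then show "u \<in> ball x r" using de(2) n dist_triangle[of x u d] by auto
    qed
    moreover have "ball e (1 / Suc n) \<subseteq> ball y s"
    proof
      fix u assume "u \<in> ball e (1 / Suc n)"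
      then show "u \<in> ball y s" using de(4) n dist_triangle[of y u e] by auto
    qed
    ultimately have "(d, e, n) \<in> I" unfolding I_def using de rs AB(5) by blast
    then show "z \<in> (\<Union>(d, e, n)\<in>I. ball d (1 / Suc n) \<times> ball e (1 / Suc n)) \<inter> S \<times> T"
      using xy de by (auto simp: dist_commute intro!: bexI[of _ "(d, e, n)"])
  qed (auto simp: I_def)
  also have "\<dots> \<in> sets (borel \<Otimes>\<^sub>M borel)"
    using \<open>countable I\<close> by (intro sets.Int sets.countable_UN') auto
  finally have *: "U \<inter> S \<times> T \<in> sets (borel \<Otimes>\<^sub>M borel)" .
  have "(\<lambda>z. if z \<in> S \<times> T then z else c) -` U \<inter> space (borel \<Otimes>\<^sub>M borel) =
      (U \<inter> S \<times> T) \<union> (if c \<in> U then space (borel \<Otimes>\<^sub>M borel) - S \<times> T else {})"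
    by (auto simp: space_pair_measure split: if_splits)
  also have "\<dots> \<in> sets (borel \<Otimes>\<^sub>M borel)" using * by auto
  finally show "(\<lambda>z. if z \<in> S \<times> T then z else c) -` U \<inter> space (borel \<Otimes>\<^sub>M borel) \<in> sets (borel \<Otimes>\<^sub>M borel)" .
qed

text \<open>The same definite description as in \<open>prod_law\<close>, but with measures as
  arguments, so that the two agree by unfolding while products of couplings can be formed as
  well.\<close>

definition rprod :: "'a::topological_space measure \<Rightarrow> 'b::topological_space measure \<Rightarrow> ('a \<times> 'b) measure" where
  "rprod \<mu> \<nu> = (THE \<pi>. prob_space \<pi> \<and> radon \<pi> \<and>
      (\<forall>A\<in>sets borel. \<forall>B\<in>sets borel. emeasure \<pi> (A \<times> B) = emeasure \<mu> A * emeasure \<nu> B))"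

text \<open>The projections are continuous, so the product sigma-algebra lies inside the Borel sets.
  The reverse inclusion is the one that may fail without separability.\<close>

lemma measurable_ident_pair_borel [measurable]:
  "(\<lambda>z. z) \<in> measurable (borel :: ('a::topological_space \<times> 'b::topological_space) measure) (borel \<Otimes>\<^sub>M borel)"
proof -
  have "(\<lambda>z. (fst z, snd z)) \<in> measurable (borel :: ('a \<times> 'b) measure) (borel \<Otimes>\<^sub>M borel)"
    by (intro measurable_Pair borel_measurable_continuous_onI continuous_intros)
  then show ?thesis by simp
qed

text \<open>The rectangles (-S) x UNIV and UNIV x (-T) are null, so the values on rectangles already
  force \<pi> onto S x T. There every Borel set is a trace of a product-measurable one, and the
  ordinary product measure decides. The right-hand side of the first claim does not mention \<pi>,
  which makes it a uniqueness statement.\<close>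

lemma rectangles_imp_eq_distr:
  fixes \<mu> :: "'a::metric_space measure" and \<nu> :: "'b::metric_space measure"
  assumes \<mu>: "tight_prob \<mu>" "sigma_compact S" "AE x in \<mu>. x \<in> S"
    and \<nu>: "tight_prob \<nu>" "sigma_compact T" "AE y in \<nu>. y \<in> T"
    and sets [simp, measurable_cong]: "sets \<pi> = sets borel"
    and rect: "\<And>A B. A \<in> sets borel \<Longrightarrow> B \<in> sets borel \<Longrightarrow> emeasure \<pi> (A \<times> B) = emeasure \<mu> A * emeasure \<nu> B"
  shows "\<pi> = distr (\<mu> \<Otimes>\<^sub>M \<nu>) borel (\<lambda>z. if z \<in> S \<times> T then z else c)"
    and "AE z in \<pi>. z \<in> S \<times> T"
    and "\<mu> \<Otimes>\<^sub>M \<nu> = distr \<pi> (borel \<Otimes>\<^sub>M borel) (\<lambda>z. z)"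
proof -
  note [simp, measurable_cong] = tight_probD(2)[OF \<mu>(1)] tight_probD(2)[OF \<nu>(1)]
  note [simp] = tight_probD(3)[OF \<mu>(1)] tight_probD(3)[OF \<nu>(1)]
  have [simp]: "space \<pi> = UNIV" using sets by (metis sets_eq_imp_space_eq space_borel)
  have ST: "S \<in> sets borel" "T \<in> sets borel" using \<mu>(2) \<nu>(2) by (auto intro: sigma_compact_borel)
  have "emeasure \<mu> (- S) = 0" "emeasure \<nu> (- T) = 0"
    using AE_iff_measurable[of "- S" \<mu> "\<lambda>x. x \<in> S"] AE_iff_measurable[of "- T" \<nu> "\<lambda>x. x \<in> T"] \<mu>(3) \<nu>(3) ST
    by (auto simp: Compl_eq)
  then have "emeasure \<pi> ((- S) \<times> UNIV) = 0" "emeasure \<pi> (UNIV \<times> (- T)) = 0"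
    using ST by (simp_all add: rect)
  then have "(- S) \<times> UNIV \<in> null_sets \<pi>" "UNIV \<times> (- T) \<in> null_sets \<pi>"
    using ST by (auto intro!: null_setsI borel_Times)
  then have "((- S) \<times> UNIV) \<union> (UNIV \<times> (- T)) \<in> null_sets \<pi>"
    by (rule null_sets.Un)
  then show AE: "AE z in \<pi>. z \<in> S \<times> T"
    by (rule AE_I') auto
  show *: "\<mu> \<Otimes>\<^sub>M \<nu> = distr \<pi> (borel \<Otimes>\<^sub>M borel) (\<lambda>z. z)"
  proof (rule pair_measure_eqI)
    show "sigma_finite_measure \<mu>" "sigma_finite_measure \<nu>" using \<mu> \<nu> by (auto dest: tight_probD)
    show "sets (\<mu> \<Otimes>\<^sub>M \<nu>) = sets (distr \<pi> (borel \<Otimes>\<^sub>M borel) (\<lambda>z. z))"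
      by (simp cong: sets_pair_measure_cong)
    fix A B assume "A \<in> sets \<mu>" "B \<in> sets \<nu>"
    then show "emeasure \<mu> A * emeasure \<nu> B = emeasure (distr \<pi> (borel \<Otimes>\<^sub>M borel) (\<lambda>z. z)) (A \<times> B)"
      by (subst emeasure_distr) (auto simp: rect)
  qed
  let ?h = "\<lambda>z. if z \<in> S \<times> T then z else c"
  have [measurable]: "?h \<in> measurable (borel \<Otimes>\<^sub>M borel) borel"
    by (intro measurable_sigma_compact_Times \<mu> \<nu>)
  have "distr (\<mu> \<Otimes>\<^sub>M \<nu>) borel ?h = distr \<pi> borel (\<lambda>z. ?h z)"
    unfolding * by (subst distr_distr) (auto simp: comp_def)
  also have "\<dots> = distr \<pi> borel (\<lambda>z. z)"
  proof (rule distr_cong_AE)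
    show "AE z in \<pi>. ?h z = z" using AE by eventually_elim simp
    show "?h \<in> measurable \<pi> borel"
      using measurable_compose[of "\<lambda>z. z" \<pi> "borel \<Otimes>\<^sub>M borel" ?h borel] by simp
  qed auto
  also have "\<dots> = \<pi>" by (rule distr_id2) simp
  finally show "\<pi> = distr (\<mu> \<Otimes>\<^sub>M \<nu>) borel ?h" ..
qed

text \<open>The ordinary product measure is pushed to the Borel sets by the map that is the identity
  on S x T and constant elsewhere. It moves only a null set, so the rectangles keep their values,
  and S x T is a carrier.\<close>

lemma tight_prob_product_exists:
  fixes \<mu> :: "'a::metric_space measure" and \<nu> :: "'b::metric_space measure"
  assumes \<mu>: "tight_prob \<mu>" and \<nu>: "tight_prob \<nu>"
  obtains \<pi> where "tight_prob \<pi>"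
    "\<And>A B. A \<in> sets borel \<Longrightarrow> B \<in> sets borel \<Longrightarrow> emeasure \<pi> (A \<times> B) = emeasure \<mu> A * emeasure \<nu> B"
proof -
  note [simp, measurable_cong] = tight_probD(2)[OF \<mu>(1)] tight_probD(2)[OF \<nu>(1)]
  note [simp] = tight_probD(3)[OF \<mu>(1)] tight_probD(3)[OF \<nu>(1)]
  interpret M: prob_space \<mu> using \<mu> by (rule tight_probD)
  interpret N: prob_space \<nu> using \<nu> by (rule tight_probD)
  interpret pair_prob_space \<mu> \<nu> ..
  obtain S where S: "sigma_compact S" "AE x in \<mu>. x \<in> S" using \<mu> by (rule tight_probE)
  obtain T where T: "sigma_compact T" "AE x in \<nu>. x \<in> T" using \<nu> by (rule tight_probE)
  have ST[measurable]: "S \<in> sets borel" "T \<in> sets borel" using S T by (auto intro: sigma_compact_borel)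
  let ?h = "\<lambda>z. if z \<in> S \<times> T then z else undefined"
  have "AE z in \<mu> \<Otimes>\<^sub>M \<nu>. fst z \<in> S \<and> snd z \<in> T"
  proof (rule AE_pair_measure)
    have "{z \<in> space (\<mu> \<Otimes>\<^sub>M \<nu>). fst z \<in> S \<and> snd z \<in> T} = S \<times> T" by (auto simp: space_pair_measure)
    then show "{z \<in> space (\<mu> \<Otimes>\<^sub>M \<nu>). fst z \<in> S \<and> snd z \<in> T} \<in> sets (\<mu> \<Otimes>\<^sub>M \<nu>)" using ST by simp
    show "AE x in \<mu>. AE y in \<nu>. fst (x, y) \<in> S \<and> snd (x, y) \<in> T"
      using S(2) T(2) by (auto elim!: eventually_mono)
  qed
  then have AE: "AE z in \<mu> \<Otimes>\<^sub>M \<nu>. z \<in> S \<times> T" by eventually_elim (auto simp: mem_Times_iff)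
  have h: "?h \<in> measurable (\<mu> \<Otimes>\<^sub>M \<nu>) borel"
    using measurable_sigma_compact_Times[OF S(1) T(1)] by (simp cong: measurable_cong_sets sets_pair_measure_cong)
  show ?thesis
  proof (rule that)
    have "AE z in distr (\<mu> \<Otimes>\<^sub>M \<nu>) borel ?h. z \<in> S \<times> T"
    proof (subst AE_distr_iff[OF h])
      show "AE z in \<mu> \<Otimes>\<^sub>M \<nu>. ?h z \<in> S \<times> T" using AE by eventually_elim simp
    qed (use borel_Times[OF ST] in simp)
    then show "tight_prob (distr (\<mu> \<Otimes>\<^sub>M \<nu>) borel ?h)"
      unfolding tight_prob_def using prob_space_distr[OF h] sigma_compact_Times[OF S(1) T(1)]
      by (intro conjI exI[of _ "S \<times> T"]) simp_all
    fix A :: "'a set" and B :: "'b set" assume AB: "A \<in> sets borel" "B \<in> sets borel"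
    then have AB': "A \<times> B \<in> sets borel" by (rule borel_Times)
    have "emeasure (distr (\<mu> \<Otimes>\<^sub>M \<nu>) borel ?h) (A \<times> B) = emeasure (\<mu> \<Otimes>\<^sub>M \<nu>) (?h -` (A \<times> B) \<inter> space (\<mu> \<Otimes>\<^sub>M \<nu>))"
      using AB' by (rule emeasure_distr[OF h])
    also have "\<dots> = emeasure (\<mu> \<Otimes>\<^sub>M \<nu>) (A \<times> B)"
    proof (rule emeasure_eq_AE)
      show "AE z in \<mu> \<Otimes>\<^sub>M \<nu>. (z \<in> ?h -` (A \<times> B) \<inter> space (\<mu> \<Otimes>\<^sub>M \<nu>)) = (z \<in> A \<times> B)"
        using AE by eventually_elim (auto simp: space_pair_measure)
      show "?h -` (A \<times> B) \<inter> space (\<mu> \<Otimes>\<^sub>M \<nu>) \<in> sets (\<mu> \<Otimes>\<^sub>M \<nu>)"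
        using AB' by (rule measurable_sets[OF h])
    qed (use AB in auto)
    also have "\<dots> = emeasure \<mu> A * emeasure \<nu> B"
      using AB by (intro N.emeasure_pair_measure_Times) auto
    finally show "emeasure (distr (\<mu> \<Otimes>\<^sub>M \<nu>) borel ?h) (A \<times> B) = emeasure \<mu> A * emeasure \<nu> B" .
  qed
qed

text \<open>Existence and the rectangle formula make the description in \<open>rprod\<close> well
  defined. Later identifications with \<open>rprod\<close> then reduce to values on rectangles, with
  no separate proof of inner regularity.\<close>

lemma rprod_unique:
  fixes \<mu> :: "'a::metric_space measure" and \<nu> :: "'b::metric_space measure"
  assumes \<mu>: "tight_prob \<mu>" and \<nu>: "tight_prob \<nu>" and "sets \<pi> = sets borel"
    and "\<And>A B. A \<in> sets borel \<Longrightarrow> B \<in> sets borel \<Longrightarrow> emeasure \<pi> (A \<times> B) = emeasure \<mu> A * emeasure \<nu> B"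
  shows "rprod \<mu> \<nu> = \<pi>"
proof -
  obtain S where S: "sigma_compact S" "AE x in \<mu>. x \<in> S" using \<mu> by (rule tight_probE)
  obtain T where T: "sigma_compact T" "AE x in \<nu>. x \<in> T" using \<nu> by (rule tight_probE)
  note eq = rectangles_imp_eq_distr(1)[OF \<mu> S \<nu> T, where c = undefined]
  obtain \<rho> where \<rho>: "tight_prob \<rho>"
    "\<And>A B. A \<in> sets borel \<Longrightarrow> B \<in> sets borel \<Longrightarrow> emeasure \<rho> (A \<times> B) = emeasure \<mu> A * emeasure \<nu> B"
    using \<mu> \<nu> by (rule tight_prob_product_exists) blast
  have "\<rho> = \<pi>"
    by (rule trans[OF eq[OF tight_probD(2)[OF \<rho>(1)] \<rho>(2)] eq[OF assms(3,4), symmetric]])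
  moreover have "rprod \<mu> \<nu> = \<rho>"
    unfolding rprod_def
  proof (rule the_equality)
    show "prob_space \<rho> \<and> radon \<rho> \<and> (\<forall>A\<in>sets borel. \<forall>B\<in>sets borel. emeasure \<rho> (A \<times> B) = emeasure \<mu> A * emeasure \<nu> B)"
      using \<rho> by (auto simp: tight_prob_iff_radon)
    fix \<rho>' assume "prob_space \<rho>' \<and> radon \<rho>' \<and> (\<forall>A\<in>sets borel. \<forall>B\<in>sets borel. emeasure \<rho>' (A \<times> B) = emeasure \<mu> A * emeasure \<nu> B)"
    then have "sets \<rho>' = sets borel"
      "\<And>A B. A \<in> sets borel \<Longrightarrow> B \<in> sets borel \<Longrightarrow> emeasure \<rho>' (A \<times> B) = emeasure \<mu> A * emeasure \<nu> B"
      by (auto simp: radon_def)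
    then show "\<rho>' = \<rho>"
      by (intro trans[OF eq eq[OF tight_probD(2)[OF \<rho>(1)] \<rho>(2), symmetric]])
  qed
  ultimately show ?thesis by simp
qed

lemma
  fixes \<mu> :: "'a::metric_space measure" and \<nu> :: "'b::metric_space measure"
  assumes \<mu>: "tight_prob \<mu>" and \<nu>: "tight_prob \<nu>"
  shows tight_prob_rprod: "tight_prob (rprod \<mu> \<nu>)"
    and emeasure_rprod_Times: "\<And>A B. A \<in> sets borel \<Longrightarrow> B \<in> sets borel \<Longrightarrow>
      emeasure (rprod \<mu> \<nu>) (A \<times> B) = emeasure \<mu> A * emeasure \<nu> B"
proof -
  obtain \<rho> where \<rho>: "tight_prob \<rho>"
    "\<And>A B. A \<in> sets borel \<Longrightarrow> B \<in> sets borel \<Longrightarrow> emeasure \<rho> (A \<times> B) = emeasure \<mu> A * emeasure \<nu> B"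
    using \<mu> \<nu> by (rule tight_prob_product_exists) blast
  have "rprod \<mu> \<nu> = \<rho>" by (rule rprod_unique[OF \<mu> \<nu> tight_probD(2)[OF \<rho>(1)] \<rho>(2)])
  with \<rho> show "tight_prob (rprod \<mu> \<nu>)"
    "\<And>A B. A \<in> sets borel \<Longrightarrow> B \<in> sets borel \<Longrightarrow> emeasure (rprod \<mu> \<nu>) (A \<times> B) = emeasure \<mu> A * emeasure \<nu> B"
    by auto
qed

text \<open>These give access to Fubini. A set that is null for \<open>rprod\<close> may fail to be
  product-measurable, so the almost-everywhere statement is pulled back along the map onto S x T
  before sections are taken.\<close>

lemma
  fixes \<mu> :: "'a::metric_space measure" and \<nu> :: "'b::metric_space measure"
  assumes \<mu>: "tight_prob \<mu>" and \<nu>: "tight_prob \<nu>"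
  shows pair_measure_eq_distr_rprod: "\<mu> \<Otimes>\<^sub>M \<nu> = distr (rprod \<mu> \<nu>) (borel \<Otimes>\<^sub>M borel) (\<lambda>z. z)"
    and AE_rprodD: "(AE z in rprod \<mu> \<nu>. P z) \<Longrightarrow> AE x in \<mu>. AE y in \<nu>. P (x, y)"
proof -
  note [simp, measurable_cong] = tight_probD(2)[OF \<mu>(1)] tight_probD(2)[OF \<nu>(1)]
  interpret M: prob_space \<mu> using \<mu> by (rule tight_probD)
  interpret N: prob_space \<nu> using \<nu> by (rule tight_probD)
  interpret pair_prob_space \<mu> \<nu> ..
  obtain S where S: "sigma_compact S" "AE x in \<mu>. x \<in> S" using \<mu> by (rule tight_probE)
  obtain T where T: "sigma_compact T" "AE x in \<nu>. x \<in> T" using \<nu> by (rule tight_probE)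
  note eq = rectangles_imp_eq_distr[OF \<mu> S \<nu> T tight_probD(2)[OF tight_prob_rprod[OF \<mu> \<nu>]] emeasure_rprod_Times[OF \<mu> \<nu>]]
  show "\<mu> \<Otimes>\<^sub>M \<nu> = distr (rprod \<mu> \<nu>) (borel \<Otimes>\<^sub>M borel) (\<lambda>z. z)" by (rule eq(3))
  let ?h = "\<lambda>z. if z \<in> S \<times> T then z else undefined"
  have h: "?h \<in> measurable (\<mu> \<Otimes>\<^sub>M \<nu>) borel"
    using measurable_sigma_compact_Times[OF S(1) T(1)] by (simp cong: measurable_cong_sets sets_pair_measure_cong)
  assume "AE z in rprod \<mu> \<nu>. P z"
  then have "AE z in distr (\<mu> \<Otimes>\<^sub>M \<nu>) borel ?h. P z" by (subst (asm) eq(1)[where c = undefined]) auto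
  then have "AE z in \<mu> \<Otimes>\<^sub>M \<nu>. P (?h z)" by (rule AE_distrD[OF h])
  then have "AE x in \<mu>. AE y in \<nu>. P (?h (x, y))" by (rule AE_pair)
  with S(2) show "AE x in \<mu>. AE y in \<nu>. P (x, y)"
  proof eventually_elim
    case (elim x)
    from elim(2) T(2) show ?case by eventually_elim (use elim in simp)
  qed
qed

text \<open>Integrands of product form are measurable for the product sigma-algebra, where
  \<open>rprod\<close> and the ordinary product measure agree. A general Borel integrand, such as
  the distance, need not be.\<close>

lemma nn_integral_rprod:
  fixes \<mu> :: "'a::metric_space measure" and \<nu> :: "'b::metric_space measure"
  assumes \<mu>: "tight_prob \<mu>" and \<nu>: "tight_prob \<nu>"
    and [measurable]: "f \<in> borel_measurable borel" "g \<in> borel_measurable borel"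
  shows "(\<integral>\<^sup>+z. f (fst z) * g (snd z) \<partial>rprod \<mu> \<nu>) = (\<integral>\<^sup>+x. f x \<partial>\<mu>) * (\<integral>\<^sup>+y. g y \<partial>\<nu>)"
proof -
  note [simp, measurable_cong] = tight_probD(2)[OF \<mu>(1)] tight_probD(2)[OF \<nu>(1)]
  interpret M: prob_space \<mu> using \<mu> by (rule tight_probD)
  interpret N: prob_space \<nu> using \<nu> by (rule tight_probD)
  interpret pair_prob_space \<mu> \<nu> ..
  have id: "(\<lambda>z. z) \<in> measurable (rprod \<mu> \<nu>) (borel \<Otimes>\<^sub>M borel)"
    by (simp add: tight_probD[OF tight_prob_rprod[OF \<mu> \<nu>]] measurable_ident_pair_borel)
  have "(\<lambda>z. f (fst z) * g (snd z)) \<in> borel_measurable (borel \<Otimes>\<^sub>M borel)" by measurable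
  note m = this
  then have "(\<integral>\<^sup>+z. f (fst z) * g (snd z) \<partial>rprod \<mu> \<nu>) = (\<integral>\<^sup>+z. f (fst z) * g (snd z) \<partial>(\<mu> \<Otimes>\<^sub>M \<nu>))"
    unfolding pair_measure_eq_distr_rprod[OF \<mu> \<nu>] by (subst nn_integral_distr[OF id]) auto
  also have "\<dots> = (\<integral>\<^sup>+x. (\<integral>\<^sup>+y. f x * g y \<partial>\<nu>) \<partial>\<mu>)"
    using m by (subst N.nn_integral_fst[symmetric]) (auto cong: measurable_cong_sets sets_pair_measure_cong)
  also have "\<dots> = (\<integral>\<^sup>+x. f x \<partial>\<mu>) * (\<integral>\<^sup>+y. g y \<partial>\<nu>)"
    by (simp add: nn_integral_cmult nn_integral_multc)
  finally show ?thesis .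
qed

lemma
  fixes \<mu> :: "'a::metric_space measure" and \<nu> :: "'b::metric_space measure"
  assumes \<mu>: "tight_prob \<mu>" and \<nu>: "tight_prob \<nu>"
  shows nn_integral_rprod_fst: "f \<in> borel_measurable borel \<Longrightarrow> (\<integral>\<^sup>+z. f (fst z) \<partial>rprod \<mu> \<nu>) = (\<integral>\<^sup>+x. f x \<partial>\<mu>)"
    and nn_integral_rprod_snd: "g \<in> borel_measurable borel \<Longrightarrow> (\<integral>\<^sup>+z. g (snd z) \<partial>rprod \<mu> \<nu>) = (\<integral>\<^sup>+y. g y \<partial>\<nu>)"
  using nn_integral_rprod[OF \<mu> \<nu>, of f "\<lambda>_. 1"] nn_integral_rprod[OF \<mu> \<nu>, of "\<lambda>_. 1" g]
    tight_probD(3,4)[OF \<mu>] tight_probD(3,4)[OF \<nu>] by auto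

section \<open>Couplings\<close>

lemma distr_rprod:
  fixes \<mu> :: "'a::metric_space measure" and \<nu> :: "'b::metric_space measure"
    and f :: "'a \<Rightarrow> 'c::metric_space" and g :: "'b \<Rightarrow> 'd::metric_space"
  assumes \<mu>: "tight_prob \<mu>" and \<nu>: "tight_prob \<nu>" and f: "continuous_on UNIV f" and g: "continuous_on UNIV g"
  shows "distr (rprod \<mu> \<nu>) borel (\<lambda>z. (f (fst z), g (snd z))) = rprod (distr \<mu> borel f) (distr \<nu> borel g)"
proof (rule rprod_unique[OF tight_prob_distr[OF \<mu> f] tight_prob_distr[OF \<nu> g], symmetric])
  fix A :: "'c set" and B :: "'d set" assume AB: "A \<in> sets borel" "B \<in> sets borel"
  have [measurable]: "f \<in> borel_measurable borel" "g \<in> borel_measurable borel"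
    using f g by (auto intro: borel_measurable_continuous_onI)
  have "(\<lambda>z. (f (fst z), g (snd z))) \<in> borel_measurable borel"
    using f g by (auto intro!: borel_measurable_continuous_onI continuous_intros
      continuous_on_compose2[OF f] continuous_on_compose2[OF g])
  then have "emeasure (distr (rprod \<mu> \<nu>) borel (\<lambda>z. (f (fst z), g (snd z)))) (A \<times> B)
      = emeasure (rprod \<mu> \<nu>) ((f -` A) \<times> (g -` B))"
    using AB borel_Times[OF AB] by (subst emeasure_distr)
      (auto simp: tight_probD[OF tight_prob_rprod[OF \<mu> \<nu>]] intro!: arg_cong[where f="emeasure (rprod \<mu> \<nu>)"])
  also have "\<dots> = emeasure \<mu> (f -` A) * emeasure \<nu> (g -` B)"
    using measurable_sets_borel[of f borel A] measurable_sets_borel[of g borel B] AB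
    by (intro emeasure_rprod_Times[OF \<mu> \<nu>]) auto
  also have "\<dots> = emeasure (distr \<mu> borel f) A * emeasure (distr \<nu> borel g) B"
    using AB by (simp add: emeasure_distr tight_probD[OF \<mu>] tight_probD[OF \<nu>])
  finally show "emeasure (distr (rprod \<mu> \<nu>) borel (\<lambda>z. (f (fst z), g (snd z)))) (A \<times> B) =
    emeasure (distr \<mu> borel f) A * emeasure (distr \<nu> borel g) B" .
qed simp

text \<open>Marginals are tested by integrals rather than on sets, because the couplings built later
  are densities or images, for which integrals are what can be computed.\<close>

lemma couplingsI:
  fixes \<gamma> :: "('s::metric_space \<times> 's) measure"
  assumes \<mu>: "tight_prob \<mu>" and \<nu>: "tight_prob \<nu>" and sets: "sets \<gamma> = sets borel"
    and 1: "\<And>f. f \<in> borel_measurable borel \<Longrightarrow> (\<integral>\<^sup>+z. f (fst z) \<partial>\<gamma>) = (\<integral>\<^sup>+x. f x \<partial>\<mu>)"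
    and 2: "\<And>f. f \<in> borel_measurable borel \<Longrightarrow> (\<integral>\<^sup>+z. f (snd z) \<partial>\<gamma>) = (\<integral>\<^sup>+x. f x \<partial>\<nu>)"
  shows "\<gamma> \<in> couplings \<mu> \<nu>"
proof -
  note [simp, measurable_cong] = sets
  have [simp]: "space \<gamma> = UNIV" using sets by (metis sets_eq_imp_space_eq space_borel)
  have "distr \<gamma> borel fst = \<mu>"
  proof (rule measure_eqI)
    fix A assume "A \<in> sets (distr \<gamma> borel fst)"
    then have [measurable]: "A \<in> sets borel" by simp
    have "emeasure (distr \<gamma> borel fst) A = (\<integral>\<^sup>+x. indicator A x \<partial>distr \<gamma> borel fst)" by simp
    also have "\<dots> = (\<integral>\<^sup>+z. indicator A (fst z) \<partial>\<gamma>)" by (intro nn_integral_distr) auto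
    also have "\<dots> = emeasure \<mu> A" by (subst 1) (auto simp: tight_probD[OF \<mu>])
    finally show "emeasure (distr \<gamma> borel fst) A = emeasure \<mu> A" .
  qed (simp add: tight_probD[OF \<mu>])
  moreover have "distr \<gamma> borel snd = \<nu>"
  proof (rule measure_eqI)
    fix A assume "A \<in> sets (distr \<gamma> borel snd)"
    then have [measurable]: "A \<in> sets borel" by simp
    have "emeasure (distr \<gamma> borel snd) A = (\<integral>\<^sup>+x. indicator A x \<partial>distr \<gamma> borel snd)" by simp
    also have "\<dots> = (\<integral>\<^sup>+z. indicator A (snd z) \<partial>\<gamma>)" by (intro nn_integral_distr) auto
    also have "\<dots> = emeasure \<nu> A" by (subst 2) (auto simp: tight_probD[OF \<nu>])
    finally show "emeasure (distr \<gamma> borel snd) A = emeasure \<nu> A" .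
  qed (simp add: tight_probD[OF \<nu>])
  moreover have "prob_space \<gamma>"
    using 1[of "\<lambda>_. 1"] tight_probD(3,4)[OF \<mu>] by (intro prob_spaceI) simp
  ultimately show ?thesis by (simp add: couplings_def)
qed

lemma couplingsD:
  fixes \<gamma> :: "('s::metric_space \<times> 's) measure"
  assumes "\<gamma> \<in> couplings \<mu> \<nu>"
  shows "prob_space \<gamma>" "sets \<gamma> = sets borel" "distr \<gamma> borel fst = \<mu>" "distr \<gamma> borel snd = \<nu>"
    "\<And>f. f \<in> borel_measurable borel \<Longrightarrow> (\<integral>\<^sup>+z. f (fst z) \<partial>\<gamma>) = (\<integral>\<^sup>+x. f x \<partial>\<mu>)"
    "\<And>f. f \<in> borel_measurable borel \<Longrightarrow> (\<integral>\<^sup>+z. f (snd z) \<partial>\<gamma>) = (\<integral>\<^sup>+x. f x \<partial>\<nu>)"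
    "\<And>P. AE x in \<mu>. P x \<Longrightarrow> AE z in \<gamma>. P (fst z)"
    "\<And>P. AE x in \<nu>. P x \<Longrightarrow> AE z in \<gamma>. P (snd z)"
proof -
  show *: "prob_space \<gamma>" "sets \<gamma> = sets borel" "distr \<gamma> borel fst = \<mu>" "distr \<gamma> borel snd = \<nu>"
    using assms by (auto simp: couplings_def)
  have [measurable]: "fst \<in> measurable \<gamma> borel" "snd \<in> measurable \<gamma> borel"
    using *(2) by (simp_all cong: measurable_cong_sets)
  show "(\<integral>\<^sup>+z. f (fst z) \<partial>\<gamma>) = (\<integral>\<^sup>+x. f x \<partial>\<mu>)" "(\<integral>\<^sup>+z. f (snd z) \<partial>\<gamma>) = (\<integral>\<^sup>+x. f x \<partial>\<nu>)"
    if "f \<in> borel_measurable borel" for f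
    unfolding *(3,4)[symmetric] using that by (simp_all add: nn_integral_distr)
  show "AE x in \<mu>. P x \<Longrightarrow> AE z in \<gamma>. P (fst z)" "AE x in \<nu>. P x \<Longrightarrow> AE z in \<gamma>. P (snd z)" for P
    unfolding *(3,4)[symmetric] by (auto dest: AE_distrD[rotated])
qed

text \<open>\<open>couplings\<close> admits arbitrary Borel measures. That each of them is carried
  by the product of two carriers makes every competitor in the infimum available for gluing and for
  Radon products.\<close>

lemma tight_prob_coupling:
  assumes "\<gamma> \<in> couplings \<mu> \<nu>" "tight_prob \<mu>" "tight_prob \<nu>"
  shows "tight_prob \<gamma>"
proof -
  obtain S where S: "sigma_compact S" "AE x in \<mu>. x \<in> S" using assms(2) by (rule tight_probE)
  obtain T where T: "sigma_compact T" "AE x in \<nu>. x \<in> T" using assms(3) by (rule tight_probE)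
  have "AE z in \<gamma>. z \<in> S \<times> T"
    using couplingsD(7)[OF assms(1) S(2)] couplingsD(8)[OF assms(1) T(2)]
    by eventually_elim (simp add: mem_Times_iff)
  then show ?thesis
    unfolding tight_prob_def using couplingsD(1,2)[OF assms(1)] sigma_compact_Times[OF S(1) T(1)]
    by (intro conjI exI[of _ "S \<times> T"]) simp_all
qed

lemma distr_in_couplings:
  fixes \<theta> :: "'t::metric_space measure"
  assumes "tight_prob \<theta>" "continuous_on UNIV f" "continuous_on UNIV g"
  shows "distr \<theta> borel (\<lambda>z. (f z, g z)) \<in> couplings (distr \<theta> borel f) (distr \<theta> borel g)"
proof -
  interpret prob_space \<theta> using assms(1) by (rule tight_probD)
  have [measurable]: "(\<lambda>z. (f z, g z)) \<in> measurable \<theta> borel" "f \<in> measurable \<theta> borel" "g \<in> measurable \<theta> borel"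
    using assms by (auto simp: tight_probD intro!: borel_measurable_continuous_onI continuous_intros)
  show ?thesis
    unfolding couplings_def
    by (auto simp: distr_distr comp_def intro!: prob_space_distr)
qed

text \<open>Integrating out one variable term by term leaves the other variable with total weight 1
  almost everywhere, so the density does not disturb that marginal. This serves both the gluing,
  with countably many terms, and the coupling by a partition of unity, with finitely many.\<close>

lemma
  fixes \<mu> :: "'a::metric_space measure" and \<nu> :: "'b::metric_space measure"
  assumes \<mu>: "tight_prob \<mu>" and \<nu>: "tight_prob \<nu>"
    and pq [measurable]: "\<And>i::nat. p i \<in> borel_measurable borel" "\<And>i. q i \<in> borel_measurable borel"
  shows nn_integral_mixture_fst: "f \<in> borel_measurable borel \<Longrightarrow> (AE x in \<mu>. (\<Sum>i. p i x * (\<integral>\<^sup>+y. q i y \<partial>\<nu>)) = 1) \<Longrightarrow>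
      (\<integral>\<^sup>+z. f (fst z) \<partial>density (rprod \<mu> \<nu>) (\<lambda>z. \<Sum>i. p i (fst z) * q i (snd z))) = (\<integral>\<^sup>+x. f x \<partial>\<mu>)"
    and nn_integral_mixture_snd: "g \<in> borel_measurable borel \<Longrightarrow> (AE y in \<nu>. (\<Sum>i. (\<integral>\<^sup>+x. p i x \<partial>\<mu>) * q i y) = 1) \<Longrightarrow>
      (\<integral>\<^sup>+z. g (snd z) \<partial>density (rprod \<mu> \<nu>) (\<lambda>z. \<Sum>i. p i (fst z) * q i (snd z))) = (\<integral>\<^sup>+y. g y \<partial>\<nu>)"
proof -
  note [measurable_cong] = tight_probD(2)[OF \<mu>] tight_probD(2)[OF \<nu>] tight_probD(2)[OF tight_prob_rprod[OF \<mu> \<nu>]]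
  assume [measurable]: "f \<in> borel_measurable borel" and 1: "AE x in \<mu>. (\<Sum>i. p i x * (\<integral>\<^sup>+y. q i y \<partial>\<nu>)) = 1"
  have "(\<integral>\<^sup>+z. f (fst z) \<partial>density (rprod \<mu> \<nu>) (\<lambda>z. \<Sum>i. p i (fst z) * q i (snd z)))
      = (\<integral>\<^sup>+z. (\<Sum>i. p i (fst z) * q i (snd z)) * f (fst z) \<partial>rprod \<mu> \<nu>)"
    by (subst nn_integral_density) auto
  also have "\<dots> = (\<integral>\<^sup>+z. (\<Sum>i. (f (fst z) * p i (fst z)) * q i (snd z)) \<partial>rprod \<mu> \<nu>)"
    by (simp add: mult_ac flip: ennreal_suminf_multc ennreal_suminf_cmult)
  also have "\<dots> = (\<Sum>i. \<integral>\<^sup>+z. (f (fst z) * p i (fst z)) * q i (snd z) \<partial>rprod \<mu> \<nu>)"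
    by (intro nn_integral_suminf) auto
  also have "\<dots> = (\<Sum>i. (\<integral>\<^sup>+x. f x * p i x \<partial>\<mu>) * (\<integral>\<^sup>+y. q i y \<partial>\<nu>))"
    by (intro suminf_cong nn_integral_rprod[OF \<mu> \<nu>]) auto
  also have "\<dots> = (\<Sum>i. \<integral>\<^sup>+x. f x * (p i x * (\<integral>\<^sup>+y. q i y \<partial>\<nu>)) \<partial>\<mu>)"
    by (intro suminf_cong) (subst nn_integral_multc[symmetric], auto simp: mult.assoc)
  also have "\<dots> = (\<integral>\<^sup>+x. (\<Sum>i. f x * (p i x * (\<integral>\<^sup>+y. q i y \<partial>\<nu>))) \<partial>\<mu>)"
    by (intro nn_integral_suminf[symmetric]) auto
  also have "\<dots> = (\<integral>\<^sup>+x. f x \<partial>\<mu>)"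
    by (intro nn_integral_cong_AE) (use 1 in \<open>eventually_elim, simp add: ennreal_suminf_cmult\<close>)
  finally show "(\<integral>\<^sup>+z. f (fst z) \<partial>density (rprod \<mu> \<nu>) (\<lambda>z. \<Sum>i. p i (fst z) * q i (snd z))) = (\<integral>\<^sup>+x. f x \<partial>\<mu>)" .
next
  note [measurable_cong] = tight_probD(2)[OF \<mu>] tight_probD(2)[OF \<nu>] tight_probD(2)[OF tight_prob_rprod[OF \<mu> \<nu>]]
  assume [measurable]: "g \<in> borel_measurable borel" and 1: "AE y in \<nu>. (\<Sum>i. (\<integral>\<^sup>+x. p i x \<partial>\<mu>) * q i y) = 1"
  have "(\<integral>\<^sup>+z. g (snd z) \<partial>density (rprod \<mu> \<nu>) (\<lambda>z. \<Sum>i. p i (fst z) * q i (snd z)))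
      = (\<integral>\<^sup>+z. (\<Sum>i. p i (fst z) * q i (snd z)) * g (snd z) \<partial>rprod \<mu> \<nu>)"
    by (subst nn_integral_density) auto
  also have "\<dots> = (\<integral>\<^sup>+z. (\<Sum>i. p i (fst z) * (q i (snd z) * g (snd z))) \<partial>rprod \<mu> \<nu>)"
    by (simp add: mult_ac flip: ennreal_suminf_multc ennreal_suminf_cmult)
  also have "\<dots> = (\<Sum>i. \<integral>\<^sup>+z. p i (fst z) * (q i (snd z) * g (snd z)) \<partial>rprod \<mu> \<nu>)"
    by (intro nn_integral_suminf) auto
  also have "\<dots> = (\<Sum>i. (\<integral>\<^sup>+x. p i x \<partial>\<mu>) * (\<integral>\<^sup>+y. q i y * g y \<partial>\<nu>))"
    by (intro suminf_cong nn_integral_rprod[OF \<mu> \<nu>]) auto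
  also have "\<dots> = (\<Sum>i. \<integral>\<^sup>+y. ((\<integral>\<^sup>+x. p i x \<partial>\<mu>) * q i y) * g y \<partial>\<nu>)"
    by (intro suminf_cong) (subst nn_integral_cmult[symmetric], auto simp: mult.assoc)
  also have "\<dots> = (\<integral>\<^sup>+y. (\<Sum>i. ((\<integral>\<^sup>+x. p i x \<partial>\<mu>) * q i y) * g y) \<partial>\<nu>)"
    by (intro nn_integral_suminf[symmetric]) auto
  also have "\<dots> = (\<integral>\<^sup>+y. g y \<partial>\<nu>)"
    by (intro nn_integral_cong_AE) (use 1 in \<open>eventually_elim, simp add: ennreal_suminf_multc\<close>)
  finally show "(\<integral>\<^sup>+z. g (snd z) \<partial>density (rprod \<mu> \<nu>) (\<lambda>z. \<Sum>i. p i (fst z) * q i (snd z))) = (\<integral>\<^sup>+y. g y \<partial>\<nu>)" .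
qed

text \<open>Gluing without disintegration: the middle space is cut into countably many Borel pieces $B_i$ of
  diameter less than $e$, and on each piece the two couplings are made conditionally independent
  given that their middle coordinates both lie in $B_i$. The middle coordinates then agree
  only up to $e$.\<close>

lemma glue_approx:
  fixes \<gamma>1 :: "('a::metric_space \<times> 's::metric_space) measure" and \<gamma>2 :: "('s \<times> 'c::metric_space) measure"
  assumes \<gamma>: "tight_prob \<gamma>1" "tight_prob \<gamma>2" and marg: "distr \<gamma>1 borel snd = distr \<gamma>2 borel fst" and "0 < e"
  obtains \<theta> where "sets \<theta> = sets borel"
    "\<And>f. f \<in> borel_measurable borel \<Longrightarrow> (\<integral>\<^sup>+z. f (fst z) \<partial>\<theta>) = (\<integral>\<^sup>+w. f w \<partial>\<gamma>1)"
    "\<And>f. f \<in> borel_measurable borel \<Longrightarrow> (\<integral>\<^sup>+z. f (snd z) \<partial>\<theta>) = (\<integral>\<^sup>+w. f w \<partial>\<gamma>2)"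
    "AE z in \<theta>. dist (snd (fst z)) (fst (snd z)) < e"
proof -
  note [simp, measurable_cong] = tight_probD(2)[OF \<gamma>(1)] tight_probD(2)[OF \<gamma>(2)] tight_probD(2)[OF tight_prob_rprod[OF \<gamma>]]
  define \<nu> where "\<nu> = distr \<gamma>2 borel fst"
  have \<nu>: "tight_prob \<nu>" unfolding \<nu>_def by (intro tight_prob_distr \<gamma> continuous_intros)
  interpret N: prob_space \<nu> using \<nu> by (rule tight_probD)
  have \<nu>1: "\<nu> = distr \<gamma>1 borel snd" using marg by (simp add: \<nu>_def)
  obtain S where S: "sigma_compact S" "AE x in \<nu>. x \<in> S" using \<nu> by (rule tight_probE)
  obtain D where D: "countable D" "\<And>x e. x \<in> S \<Longrightarrow> 0 < e \<Longrightarrow> \<exists>d\<in>D. dist x d < e"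
    using S(1) by (rule sigma_compact_countable_dense) blast
  have "S \<noteq> {}" using S(2) N.AE_False by auto
  then have "D \<noteq> {}" using D(2)[of _ 1] by auto
  \<comment> \<open>Balls of radius e/2 around the points of D, made disjoint: two points of one
    piece are less than e apart.\<close>
  define B where "B = disjointed (\<lambda>i. ball (from_nat_into D i) (e / 2))"
  have disj: "disjoint_family B" unfolding B_def by (rule disjoint_family_disjointed)
  have B_ball: "B i \<subseteq> ball (from_nat_into D i) (e / 2)" for i unfolding B_def by (rule disjointed_subset)
  have B_UN: "(\<Union>i. B i) = (\<Union>i. ball (from_nat_into D i) (e / 2))" unfolding B_def by (rule UN_disjointed_eq)
  have "range B \<subseteq> sets borel" unfolding B_def by (rule sets.range_disjointed_sets) auto
  then have [measurable, simp]: "B i \<in> sets borel" for i by auto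
  have "S \<subseteq> (\<Union>i. B i)"
  proof
    fix x assume "x \<in> S"
    then obtain d where "d \<in> D" "dist x d < e / 2" using D(2)[of x "e / 2"] \<open>0 < e\<close> by auto
    then show "x \<in> (\<Union>i. B i)"
      unfolding B_UN using D(1) from_nat_into_surj[of D d] by (auto simp: dist_commute)
  qed
  \<comment> \<open>For a null piece the factor \<open>inverse (emeasure \<nu> (B i))\<close> is
    infinite, and 0 times infinity is 0. Such pieces thus contribute nothing to the integrals, and
    almost no middle point lies in them.\<close>
  define c where "c i = (if emeasure \<nu> (B i) = 0 then 0 else 1 :: ennreal)" for i
  have c: "emeasure \<nu> (B i) * inverse (emeasure \<nu> (B i)) = c i" for i
    unfolding c_def by (simp add: ennreal_divide_self less_top[symmetric] divide_ennreal_def[symmetric])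
  have "AE y in \<nu>. y \<notin> B i" if "emeasure \<nu> (B i) = 0" for i
    using that by (intro AE_not_in) (auto simp: null_sets_def tight_probD[OF \<nu>])
  then have "AE y in \<nu>. \<forall>i. emeasure \<nu> (B i) = 0 \<longrightarrow> y \<notin> B i"
    unfolding AE_all_countable by auto
  with S(2) have one: "AE y in \<nu>. (\<Sum>i. indicator (B i) y * c i) = 1"
  proof eventually_elim
    case (elim y)
    then obtain i where i: "y \<in> B i" using \<open>S \<subseteq> (\<Union>i. B i)\<close> by auto
    then have *: "indicator (B j) y * c j = (if j = i then 1 else 0)" for j
      using elim disj unfolding disjoint_family_on_def c_def by (auto split: split_indicator)
    show ?case unfolding * by (rule sums_unique[symmetric]) (rule sums_single)
  qed
  \<comment> \<open>The i-th term restricts the product of the two couplings to pairs whose middle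
    points both lie in B i. Dividing once by the mass of B i leaves total weight equal to that mass;
    the divisor is placed in q.\<close>
  define p where "p i w = (indicator (B i) (snd w) :: ennreal)" for i and w :: "'a \<times> 's"
  define q where "q i w = (indicator (B i) (fst w) * inverse (emeasure \<nu> (B i)) :: ennreal)" for i and w :: "'s \<times> 'c"
  have pq[measurable]: "p i \<in> borel_measurable borel" "q i \<in> borel_measurable borel" for i
    unfolding p_def q_def by measurable
  have "(\<integral>\<^sup>+w. q i w \<partial>\<gamma>2) = (\<integral>\<^sup>+y. indicator (B i) y * inverse (emeasure \<nu> (B i)) \<partial>\<nu>)" for i
    unfolding q_def \<nu>_def by (subst nn_integral_distr) auto
  then have q_int: "(\<integral>\<^sup>+w. q i w \<partial>\<gamma>2) = c i" for i
    by (simp add: nn_integral_multc tight_probD[OF \<nu>] c)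
  have "(\<integral>\<^sup>+w. p i w \<partial>\<gamma>1) = (\<integral>\<^sup>+y. indicator (B i) y \<partial>\<nu>)" for i
    unfolding p_def \<nu>1 by (subst nn_integral_distr) auto
  then have p_int: "(\<integral>\<^sup>+w. p i w \<partial>\<gamma>1) = emeasure \<nu> (B i)" for i
    by (simp add: tight_probD[OF \<nu>])
  have 1: "AE w in \<gamma>1. (\<Sum>i. p i w * (\<integral>\<^sup>+w'. q i w' \<partial>\<gamma>2)) = 1"
    unfolding q_int p_def using one unfolding \<nu>1 by (rule AE_distrD[rotated]) simp
  have 2: "AE w in \<gamma>2. (\<Sum>i. (\<integral>\<^sup>+w'. p i w' \<partial>\<gamma>1) * q i w) = 1"
  proof -
    have "AE w in \<gamma>2. (\<Sum>i. indicator (B i) (fst w) * c i) = 1"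
      using one unfolding \<nu>_def by (rule AE_distrD[rotated]) simp
    then show ?thesis unfolding p_int q_def by (simp add: c[symmetric] mult_ac)
  qed
  define g where "g = (\<lambda>z. \<Sum>i. p i (fst z) * q i (snd z))"
  have [measurable]: "g \<in> borel_measurable borel" unfolding g_def by measurable
  show ?thesis
  proof (rule that[of "density (rprod \<gamma>1 \<gamma>2) g"])
    show "AE z in density (rprod \<gamma>1 \<gamma>2) g. dist (snd (fst z)) (fst (snd z)) < e"
    proof (subst AE_density, simp, intro AE_I2 impI)
      fix z assume "0 < g z"
      then have "\<exists>i. p i (fst z) * q i (snd z) \<noteq> 0"
        unfolding g_def by (metis (no_types, lifting) less_irrefl suminf_zero suminf_cong)
      then obtain i where "snd (fst z) \<in> B i" "fst (snd z) \<in> B i"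
        by (auto simp: p_def q_def split: split_indicator_asm)
      then have "dist (from_nat_into D i) (snd (fst z)) < e / 2" "dist (from_nat_into D i) (fst (snd z)) < e / 2"
        using subsetD[OF B_ball] unfolding mem_ball by blast+
      then show "dist (snd (fst z)) (fst (snd z)) < e"
        using dist_triangle_half_r by blast
    qed
  qed (use nn_integral_mixture_fst[OF \<gamma> pq _ 1] nn_integral_mixture_snd[OF \<gamma> pq _ 2] in \<open>simp_all add: g_def\<close>)
qed

section \<open>Transport cost\<close>

text \<open>Kept in the extended nonnegative numbers: once an infinite cost is replaced by 0, as in
  \<open>emd\<close>, the triangle inequality can fail.\<close>

definition wdist :: "('a::metric_space \<times> 'a) measure \<Rightarrow> ('a \<times> 'a) measure \<Rightarrow> ennreal" where
  "wdist \<mu> \<nu> = (INF \<gamma>\<in>couplings \<mu> \<nu>. \<integral>\<^sup>+z. ennreal (manhattan (fst z) (snd z)) \<partial>\<gamma>)"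

lemma emd_manhattan_eq: "emd manhattan \<mu> \<nu> = enn2real (wdist \<mu> \<nu>)"
  by (simp add: emd_def wdist_def)

text \<open>The product type carries the Euclidean combination of the two distances, which governs
  topology, balls and moments. Comparing it with the Manhattan metric, up to a factor 2 in
  \<open>manhattan_le_2_dist\<close>, translates estimates between the two.\<close>

lemma manhattan_nonneg [simp]: "0 \<le> manhattan p q"
  and manhattan_commute: "manhattan p q = manhattan q p"
  and dist_le_manhattan: "dist p q \<le> manhattan p q"
  by (auto simp: manhattan_def dist_commute dist_prod_def sqrt_sum_squares_le_sum
)

lemma manhattan_triangle: "manhattan p r \<le> manhattan p q + manhattan q r"
  using dist_triangle[of "fst p" "fst r" "fst q"] dist_triangle[of "snd p" "snd r" "snd q"]
  by (simp add: manhattan_def)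

lemma manhattan_le_2_dist: "manhattan p q \<le> 2 * dist p q"
  using dist_fst_le[of p q] dist_snd_le[of p q] by (simp add: manhattan_def)

lemma continuous_on_manhattan [continuous_intros]:
  "continuous_on S f \<Longrightarrow> continuous_on S g \<Longrightarrow> continuous_on S (\<lambda>x. manhattan (f x) (g x))"
  unfolding manhattan_def by (intro continuous_intros)

lemma borel_measurable_continuous_real:
  fixes f :: "'a::topological_space \<Rightarrow> real"
  shows "continuous_on UNIV f \<Longrightarrow> (\<lambda>x. ennreal (f x)) \<in> borel_measurable borel"
  by (intro measurable_compose[OF borel_measurable_continuous_onI measurable_ennreal])

lemma nn_integral_distr_borel:
  "T \<in> measurable M borel \<Longrightarrow> f \<in> borel_measurable borel \<Longrightarrow>
    (\<integral>\<^sup>+x. f x \<partial>distr M borel T) = (\<integral>\<^sup>+x. f (T x) \<partial>M)"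
  by (rule nn_integral_distr) simp_all

lemma borel_measurable_manhattan [measurable]:
  "(\<lambda>z. ennreal (manhattan (fst z) (snd z))) \<in> borel_measurable borel"
  by (intro borel_measurable_continuous_real continuous_intros)

lemma wdist_le: "\<gamma> \<in> couplings \<mu> \<nu> \<Longrightarrow> wdist \<mu> \<nu> \<le> (\<integral>\<^sup>+z. ennreal (manhattan (fst z) (snd z)) \<partial>\<gamma>)"
  unfolding wdist_def by (rule INF_lower)

text \<open>Two maps on one probability space couple their image laws. The explicit bounds by
  resampling a coordinate or by copying a coupling are instances.\<close>

lemma wdist_distr_le:
  fixes \<theta> :: "'t::metric_space measure" and f g :: "'t \<Rightarrow> 'a::metric_space \<times> 'a"
  assumes "tight_prob \<theta>" "continuous_on UNIV f" "continuous_on UNIV g"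
  shows "wdist (distr \<theta> borel f) (distr \<theta> borel g) \<le> (\<integral>\<^sup>+z. ennreal (manhattan (f z) (g z)) \<partial>\<theta>)"
proof -
  have "(\<lambda>z. (f z, g z)) \<in> measurable \<theta> borel"
    using assms by (auto simp: tight_probD intro!: borel_measurable_continuous_onI continuous_intros)
  then have "(\<integral>\<^sup>+z. ennreal (manhattan (fst z) (snd z)) \<partial>distr \<theta> borel (\<lambda>z. (f z, g z)))
      = (\<integral>\<^sup>+z. ennreal (manhattan (f z) (g z)) \<partial>\<theta>)"
    by (subst nn_integral_distr_borel[OF _ borel_measurable_manhattan]) auto
  then show ?thesis using wdist_le[OF distr_in_couplings[OF assms]] by simp
qed

lemma wdist_refl:
  assumes "tight_prob \<mu>"
  shows "wdist \<mu> \<mu> = 0"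
proof -
  have "distr \<mu> borel (\<lambda>z. z) = \<mu>" using assms by (intro distr_id2) (simp add: tight_probD)
  then show ?thesis
    using wdist_distr_le[OF assms continuous_on_id continuous_on_id] by (simp add: manhattan_def)
qed

lemma wdist_commute:
  assumes "tight_prob \<mu>" "tight_prob \<nu>"
  shows "wdist \<mu> \<nu> = wdist \<nu> \<mu>"
proof -
  have le: "wdist \<nu> \<mu> \<le> wdist \<mu> \<nu>" if "tight_prob \<mu>" "tight_prob \<nu>" for \<mu> \<nu> :: "('a \<times> 'a) measure"
    unfolding wdist_def[of \<mu> \<nu>]
  proof (rule INF_greatest)
    fix \<gamma> assume \<gamma>: "\<gamma> \<in> couplings \<mu> \<nu>"
    have "wdist (distr \<gamma> borel snd) (distr \<gamma> borel fst) \<le> (\<integral>\<^sup>+z. ennreal (manhattan (snd z) (fst z)) \<partial>\<gamma>)"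
      by (intro wdist_distr_le tight_prob_coupling[OF \<gamma>] that continuous_intros)
    then show "wdist \<nu> \<mu> \<le> (\<integral>\<^sup>+z. ennreal (manhattan (fst z) (snd z)) \<partial>\<gamma>)"
      by (simp add: couplingsD[OF \<gamma>] manhattan_commute)
  qed
  show ?thesis using le[OF assms] le[OF assms(2,1)] by (rule antisym[rotated])
qed

lemma wdist_triangle:
  assumes \<mu>: "tight_prob \<mu>" and \<nu>: "tight_prob \<nu>" and \<kappa>: "tight_prob \<kappa>"
  shows "wdist \<mu> \<kappa> \<le> wdist \<mu> \<nu> + wdist \<nu> \<kappa>"
proof (rule ennreal_le_epsilon)
  \<comment> \<open>Finiteness is what provides couplings strictly below the infimum plus e/4. Each
    of the two wastes at most e/4, and a middle gap below e/4 costs at most e/2 in the Manhattan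
    metric, which adds up to e.\<close>
  fix e :: real assume fin: "wdist \<mu> \<nu> + wdist \<nu> \<kappa> < top" and e: "0 < e"
  then have "wdist \<mu> \<nu> < wdist \<mu> \<nu> + ennreal (e / 4)" "wdist \<nu> \<kappa> < wdist \<nu> \<kappa> + ennreal (e / 4)"
    by (auto simp: ennreal_add_left_cancel_less[where b = 0, simplified])
  then obtain \<gamma>1 \<gamma>2 where \<gamma>: "\<gamma>1 \<in> couplings \<mu> \<nu>" "\<gamma>2 \<in> couplings \<nu> \<kappa>"
    and cost: "(\<integral>\<^sup>+z. ennreal (manhattan (fst z) (snd z)) \<partial>\<gamma>1) < wdist \<mu> \<nu> + ennreal (e / 4)"
      "(\<integral>\<^sup>+z. ennreal (manhattan (fst z) (snd z)) \<partial>\<gamma>2) < wdist \<nu> \<kappa> + ennreal (e / 4)"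
    unfolding wdist_def[of \<mu> \<nu>] wdist_def[of \<nu> \<kappa>] INF_less_iff by blast
  have t: "tight_prob \<gamma>1" "tight_prob \<gamma>2" using \<gamma> \<mu> \<nu> \<kappa> by (auto intro: tight_prob_coupling)
  obtain \<theta> where \<theta>: "sets \<theta> = sets borel"
    "\<And>f. f \<in> borel_measurable borel \<Longrightarrow> (\<integral>\<^sup>+z. f (fst z) \<partial>\<theta>) = (\<integral>\<^sup>+w. f w \<partial>\<gamma>1)"
    "\<And>f. f \<in> borel_measurable borel \<Longrightarrow> (\<integral>\<^sup>+z. f (snd z) \<partial>\<theta>) = (\<integral>\<^sup>+w. f w \<partial>\<gamma>2)"
    "AE z in \<theta>. dist (snd (fst z)) (fst (snd z)) < e / 4"
    using glue_approx[OF t, of "e / 4"] e by (auto simp: couplingsD[OF \<gamma>(1)] couplingsD[OF \<gamma>(2)])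
  note [measurable_cong, simp] = \<theta>(1)
  have emb[measurable]: "(\<lambda>z. (fst (fst z), snd (snd z))) \<in> measurable \<theta> borel"
    by (simp cong: measurable_cong_sets) (intro borel_measurable_continuous_onI continuous_intros)
  define \<pi> where "\<pi> = distr \<theta> borel (\<lambda>z. (fst (fst z), snd (snd z)))"
  have "\<pi> \<in> couplings \<mu> \<kappa>"
  proof (rule couplingsI[OF \<mu> \<kappa>])
    fix f :: "'a \<times> 'a \<Rightarrow> ennreal" assume [measurable]: "f \<in> borel_measurable borel"
    show "(\<integral>\<^sup>+z. f (fst z) \<partial>\<pi>) = (\<integral>\<^sup>+x. f x \<partial>\<mu>)"
      unfolding \<pi>_def using \<theta>(2)[of "\<lambda>w. f (fst w)"] by (subst nn_integral_distr) (auto simp: couplingsD(5)[OF \<gamma>(1)])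
    show "(\<integral>\<^sup>+z. f (snd z) \<partial>\<pi>) = (\<integral>\<^sup>+x. f x \<partial>\<kappa>)"
      unfolding \<pi>_def using \<theta>(3)[of "\<lambda>w. f (snd w)"] by (subst nn_integral_distr) (auto simp: couplingsD(6)[OF \<gamma>(2)])
  qed (simp add: \<pi>_def)
  then have "wdist \<mu> \<kappa> \<le> (\<integral>\<^sup>+z. ennreal (manhattan (fst z) (snd z)) \<partial>\<pi>)" by (rule wdist_le)
  also have "\<dots> = (\<integral>\<^sup>+z. ennreal (manhattan (fst (fst z)) (snd (snd z))) \<partial>\<theta>)"
    unfolding \<pi>_def by (subst nn_integral_distr_borel[OF emb borel_measurable_manhattan]) auto
  also have "\<dots> \<le> (\<integral>\<^sup>+z. (ennreal (manhattan (fst (fst z)) (snd (fst z))) + ennreal (manhattan (fst (snd z)) (snd (snd z)))) + ennreal (e / 2) \<partial>\<theta>)"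
  proof (rule nn_integral_mono_AE, use \<theta>(4) in eventually_elim)
    case (elim z)
    have "manhattan (fst (fst z)) (snd (snd z)) \<le> manhattan (fst (fst z)) (snd (fst z))
        + (manhattan (snd (fst z)) (fst (snd z)) + manhattan (fst (snd z)) (snd (snd z)))"
      using manhattan_triangle[of "fst (fst z)" "snd (snd z)" "snd (fst z)"]
        manhattan_triangle[of "snd (fst z)" "snd (snd z)" "fst (snd z)"] by simp
    also have "manhattan (snd (fst z)) (fst (snd z)) \<le> e / 2"
      using elim manhattan_le_2_dist[of "snd (fst z)" "fst (snd z)"] by simp
    finally show ?case using e by (simp flip: ennreal_plus add: algebra_simps)
  qed
  also have "\<dots> = (\<integral>\<^sup>+z. ennreal (manhattan (fst z) (snd z)) \<partial>\<gamma>1) + (\<integral>\<^sup>+z. ennreal (manhattan (fst z) (snd z)) \<partial>\<gamma>2) + ennreal (e / 2)"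
  proof -
    have m: "(\<lambda>z. ennreal (manhattan (fst (fst z)) (snd (fst z)))) \<in> borel_measurable \<theta>"
      "(\<lambda>z. ennreal (manhattan (fst (snd z)) (snd (snd z)))) \<in> borel_measurable \<theta>"
      unfolding measurable_cong_sets[OF \<theta>(1) refl] by (intro borel_measurable_continuous_real continuous_intros)+
    have "emeasure \<theta> (space \<theta>) = 1"
      using \<theta>(2)[of "\<lambda>_. 1"] tight_probD(3,4)[OF t(1)] by simp
    then show ?thesis
      using m \<theta>(2)[OF borel_measurable_manhattan] \<theta>(3)[OF borel_measurable_manhattan]
      by (simp add: nn_integral_add)
  qed
  also have "\<dots> \<le> (wdist \<mu> \<nu> + ennreal (e / 4)) + (wdist \<nu> \<kappa> + ennreal (e / 4)) + ennreal (e / 2)"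
    using cost by (intro add_mono) auto
  also have "\<dots> = wdist \<mu> \<nu> + wdist \<nu> \<kappa> + (ennreal (e / 4) + ennreal (e / 4) + ennreal (e / 2))"
    by (simp only: add_ac)
  also have "ennreal (e / 4) + ennreal (e / 4) + ennreal (e / 2) = ennreal e"
    using e by (simp flip: ennreal_plus)
  finally show "wdist \<mu> \<kappa> \<le> wdist \<mu> \<nu> + wdist \<nu> \<kappa> + ennreal e" .
qed

section \<open>Products of marginals and the Lipschitz bound for the covariance\<close>

lemma
  fixes \<mu> :: "'a::metric_space measure" and \<nu> :: "'b::metric_space measure"
  assumes \<mu>: "tight_prob \<mu>" and \<nu>: "tight_prob \<nu>"
  shows distr_rprod_fst: "distr (rprod \<mu> \<nu>) borel fst = \<mu>"
    and distr_rprod_snd: "distr (rprod \<mu> \<nu>) borel snd = \<nu>"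
proof -
  note t = tight_prob_rprod[OF \<mu> \<nu>]
  show "distr (rprod \<mu> \<nu>) borel fst = \<mu>"
  proof (rule measure_eqI)
    fix A assume "A \<in> sets (distr (rprod \<mu> \<nu>) borel fst)"
    then have A: "A \<in> sets borel" by simp
    then have "emeasure (distr (rprod \<mu> \<nu>) borel fst) A = emeasure (rprod \<mu> \<nu>) (A \<times> UNIV)"
      by (subst emeasure_distr) (auto simp: tight_probD[OF t] intro!: arg_cong[where f="emeasure (rprod \<mu> \<nu>)"])
    then show "emeasure (distr (rprod \<mu> \<nu>) borel fst) A = emeasure \<mu> A"
      using A emeasure_rprod_Times[OF \<mu> \<nu> A, of UNIV] by (simp add: tight_probD[OF \<nu>])
  qed (simp add: tight_probD[OF \<mu>])
  show "distr (rprod \<mu> \<nu>) borel snd = \<nu>"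
  proof (rule measure_eqI)
    fix A assume "A \<in> sets (distr (rprod \<mu> \<nu>) borel snd)"
    then have A: "A \<in> sets borel" by simp
    then have "emeasure (distr (rprod \<mu> \<nu>) borel snd) A = emeasure (rprod \<mu> \<nu>) (UNIV \<times> A)"
      by (subst emeasure_distr) (auto simp: tight_probD[OF t] intro!: arg_cong[where f="emeasure (rprod \<mu> \<nu>)"])
    then show "emeasure (distr (rprod \<mu> \<nu>) borel snd) A = emeasure \<nu> A"
      using A emeasure_rprod_Times[OF \<mu> \<nu> _ A, of UNIV] by (simp add: tight_probD[OF \<mu>])
  qed (simp add: tight_probD[OF \<nu>])
qed

definition indep_law :: "('a::metric_space \<times> 'a) measure \<Rightarrow> ('a \<times> 'a) measure" where
  "indep_law J = rprod (distr J borel fst) (distr J borel snd)"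

lemma tight_prob_marginals:
  assumes "tight_prob J"
  shows "tight_prob (distr J borel fst)" "tight_prob (distr J borel snd)"
  using assms by (auto intro!: tight_prob_distr continuous_intros)

lemma tight_prob_indep_law: "tight_prob J \<Longrightarrow> tight_prob (indep_law J)"
  unfolding indep_law_def by (intro tight_prob_rprod tight_prob_marginals)

lemma distr_distr_continuous:
  fixes \<mu> :: "'a::metric_space measure" and f :: "'a \<Rightarrow> 'b::metric_space" and g :: "'b \<Rightarrow> 'c::metric_space"
  assumes "tight_prob \<mu>" "continuous_on UNIV f" "continuous_on UNIV g"
  shows "distr (distr \<mu> borel f) borel g = distr \<mu> borel (\<lambda>x. g (f x))"
  using assms by (subst distr_distr) (auto simp: comp_def tight_probD borel_measurable_continuous_onI)

lemma nn_integral_distr_continuous: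
  fixes \<mu> :: "'a::metric_space measure" and f :: "'a \<Rightarrow> 'b::metric_space" and g :: "'b \<Rightarrow> real"
  assumes "tight_prob \<mu>" "continuous_on UNIV f" "continuous_on UNIV g"
  shows "(\<integral>\<^sup>+x. ennreal (g x) \<partial>distr \<mu> borel f) = (\<integral>\<^sup>+x. ennreal (g (f x)) \<partial>\<mu>)"
  using assms
  by (intro nn_integral_distr_borel borel_measurable_continuous_real)
    (simp_all add: tight_probD borel_measurable_continuous_onI)

text \<open>The first coordinate is read off one copy and the second off an independent copy, so the
  marginals of the image law are kept and the dependence between them is destroyed.\<close>

lemma distr_rprod_indep_law:
  assumes \<theta>: "tight_prob \<theta>" and f: "continuous_on UNIV f"
  shows "distr (rprod \<theta> \<theta>) borel (\<lambda>z. (fst (f (fst z)), snd (f (snd z)))) = indep_law (distr \<theta> borel f)"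
proof -
  have c: "continuous_on UNIV (\<lambda>x. fst (f x))" "continuous_on UNIV (\<lambda>x. snd (f x))"
    using f by (auto intro: continuous_intros)
  show ?thesis
    unfolding indep_law_def distr_rprod[OF \<theta> \<theta> c]
    by (subst (1 2) distr_distr_continuous) (auto intro!: \<theta> f continuous_intros)
qed

text \<open>The cost stays the same because the Manhattan metric is additive: the first-coordinate
  term sees only the first copy of the coupling, the second-coordinate term only the second copy,
  and the two expectations recombine to the original cost.\<close>

lemma wdist_indep_law_le:
  assumes J: "tight_prob J" "tight_prob J'"
  shows "wdist (indep_law J) (indep_law J') \<le> wdist J J'"
  unfolding wdist_def[of J J']
proof (rule INF_greatest)
  fix \<gamma> assume \<gamma>: "\<gamma> \<in> couplings J J'"
  have t: "tight_prob \<gamma>" using \<gamma> J by (rule tight_prob_coupling)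
  let ?f = "\<lambda>z :: (('a \<times> 'a) \<times> ('a \<times> 'a)) \<times> (('a \<times> 'a) \<times> ('a \<times> 'a)). (fst (fst (fst z)), snd (fst (snd z)))"
  let ?g = "\<lambda>z :: (('a \<times> 'a) \<times> ('a \<times> 'a)) \<times> (('a \<times> 'a) \<times> ('a \<times> 'a)). (fst (snd (fst z)), snd (snd (snd z)))"
  have f: "distr (rprod \<gamma> \<gamma>) borel ?f = indep_law J"
    using distr_rprod_indep_law[OF t, of fst] by (simp add: couplingsD[OF \<gamma>] continuous_on_fst continuous_on_id)
  have g: "distr (rprod \<gamma> \<gamma>) borel ?g = indep_law J'"
    using distr_rprod_indep_law[OF t, of snd] by (simp add: couplingsD[OF \<gamma>] continuous_on_snd continuous_on_id)
  have m: "(\<lambda>w :: ('a \<times> 'a) \<times> ('a \<times> 'a). ennreal (dist (fst (fst w)) (fst (snd w)))) \<in> borel_measurable borel"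
    "(\<lambda>w :: ('a \<times> 'a) \<times> ('a \<times> 'a). ennreal (dist (snd (fst w)) (snd (snd w)))) \<in> borel_measurable borel"
    by (intro borel_measurable_continuous_real continuous_intros)+
  note [measurable_cong] = tight_probD(2)[OF tight_prob_rprod[OF t t]] tight_probD(2)[OF t]
  have "wdist (indep_law J) (indep_law J') \<le> (\<integral>\<^sup>+z. ennreal (manhattan (?f z) (?g z)) \<partial>rprod \<gamma> \<gamma>)"
    unfolding f[symmetric] g[symmetric] by (intro wdist_distr_le tight_prob_rprod t continuous_intros)
  also have "\<dots> = (\<integral>\<^sup>+z. ennreal (dist (fst (fst (fst z))) (fst (snd (fst z)))) + ennreal (dist (snd (fst (snd z))) (snd (snd (snd z)))) \<partial>rprod \<gamma> \<gamma>)"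
    by (simp add: manhattan_def)
  also have "\<dots> = (\<integral>\<^sup>+z. ennreal (dist (fst (fst (fst z))) (fst (snd (fst z)))) \<partial>rprod \<gamma> \<gamma>)
      + (\<integral>\<^sup>+z. ennreal (dist (snd (fst (snd z))) (snd (snd (snd z)))) \<partial>rprod \<gamma> \<gamma>)"
    by (intro nn_integral_add; unfold tight_probD(5)[OF tight_prob_rprod[OF t t]];
      intro borel_measurable_continuous_real continuous_intros)
  also have "\<dots> = (\<integral>\<^sup>+w. ennreal (dist (fst (fst w)) (fst (snd w))) \<partial>\<gamma>) + (\<integral>\<^sup>+w. ennreal (dist (snd (fst w)) (snd (snd w))) \<partial>\<gamma>)"
    using nn_integral_rprod_fst[OF t t m(1)] nn_integral_rprod_snd[OF t t m(2)] by simp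
  also have "\<dots> = (\<integral>\<^sup>+w. ennreal (manhattan (fst w) (snd w)) \<partial>\<gamma>)"
    using m by (subst nn_integral_add[symmetric]) (auto simp: tight_probD[OF t] manhattan_def)
  finally show "wdist (indep_law J) (indep_law J') \<le> (\<integral>\<^sup>+w. ennreal (manhattan (fst w) (snd w)) \<partial>\<gamma>)" .
qed

text \<open>The earth mover's covariance as a function of the joint law, before the truncation to a real
  number that maps an infinite cost to 0.\<close>

definition dcov :: "('a::metric_space \<times> 'a) measure \<Rightarrow> ennreal" where
  "dcov J = wdist J (indep_law J)"

text \<open>The path from J to \<open>indep_law J\<close> runs through \<open>J'\<close> and
  \<open>indep_law J'\<close>; each of the two outer legs costs at most \<open>wdist J J'\<close>,
  whence the factor 2. The one-sided form avoids subtracting infinite values.\<close>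

lemma dcov_le_add_wdist:
  assumes J: "tight_prob J" and J': "tight_prob J'"
  shows "dcov J \<le> dcov J' + 2 * wdist J J'"
proof -
  note t = tight_prob_indep_law[OF J] tight_prob_indep_law[OF J']
  have "dcov J \<le> wdist J J' + (wdist J' (indep_law J') + wdist (indep_law J') (indep_law J))"
    unfolding dcov_def
    by (intro order.trans[OF wdist_triangle[OF J J' t(1)]] add_left_mono wdist_triangle J' t)
  also have "wdist (indep_law J') (indep_law J) \<le> wdist J J'"
    unfolding wdist_commute[OF t(2,1)] by (rule wdist_indep_law_le[OF J J'])
  finally show ?thesis unfolding dcov_def by (simp add: mult_2 add_ac)
qed

lemma dcov_le_snd:
  assumes J: "tight_prob J"
  shows "dcov J \<le> (\<integral>\<^sup>+z. ennreal (dist (fst z) (snd z)) \<partial>rprod (distr J borel snd) (distr J borel snd))"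
proof -
  let ?g = "\<lambda>z :: ('a \<times> 'a) \<times> ('a \<times> 'a). (fst (fst z), snd (snd z))"
  note t = tight_prob_rprod[OF J J]
  have g: "distr (rprod J J) borel ?g = indep_law J"
    unfolding indep_law_def by (subst distr_rprod[OF J J]) (auto intro: continuous_intros)
  have "dcov J \<le> (\<integral>\<^sup>+z. ennreal (manhattan (fst z) (?g z)) \<partial>rprod J J)"
    unfolding dcov_def g[symmetric] by (subst (1) distr_rprod_fst[OF J J, symmetric]) (intro wdist_distr_le t continuous_intros)
  also have "\<dots> = (\<integral>\<^sup>+z. ennreal (dist (snd (fst z)) (snd (snd z))) \<partial>rprod J J)"
    by (simp add: manhattan_def)
  also have "\<dots> = (\<integral>\<^sup>+z. ennreal (dist (fst z) (snd z)) \<partial>distr (rprod J J) borel (\<lambda>z. (snd (fst z), snd (snd z))))"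
    by (subst nn_integral_distr_continuous) (auto intro!: t continuous_intros)
  also have "distr (rprod J J) borel (\<lambda>z. (snd (fst z), snd (snd z))) = rprod (distr J borel snd) (distr J borel snd)"
    by (subst distr_rprod[OF J J]) (auto intro: continuous_intros)
  finally show ?thesis .
qed

section \<open>Weak convergence\<close>

text \<open>A share $1 - \<eta>$ of the common mass of each piece $\<phi> i$ of the partition of unity is coupled
  inside the piece, at cost at most $D$. The remaining mass $R$ of both measures is coupled
  independently; its cost is controlled by the second moments. The factor $1 - \<eta>$ keeps $R$
  positive, so that the remainders can be normalised by $R$.\<close>

lemma partition_coupling:
  fixes \<mu> \<nu> :: "'s::metric_space measure" and \<phi> :: "nat \<Rightarrow> 's \<Rightarrow> real"
  assumes \<mu>: "tight_prob \<mu>" and \<nu>: "tight_prob \<nu>"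
    and \<phi>: "\<And>i. \<phi> i \<in> borel_measurable borel" "\<And>i x. 0 \<le> \<phi> i x" "\<And>x. (\<Sum>i<k. \<phi> i x) \<le> 1"
    and diam: "\<And>i x y. i < k \<Longrightarrow> \<phi> i x \<noteq> 0 \<Longrightarrow> \<phi> i y \<noteq> 0 \<Longrightarrow> dist x y \<le> D"
    and "0 \<le> D" "0 < t" "0 \<le> K" "0 < \<eta>" "\<eta> < 1"
    and K: "(\<integral>\<^sup>+x. ennreal ((dist x x0)\<^sup>2) \<partial>\<mu>) \<le> ennreal K" "(\<integral>\<^sup>+x. ennreal ((dist x x0)\<^sup>2) \<partial>\<nu>) \<le> ennreal K"
    and R: "R = 1 - (\<Sum>i<k. (1 - \<eta>) * min (\<integral>x. \<phi> i x \<partial>\<mu>) (\<integral>x. \<phi> i x \<partial>\<nu>))"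
  obtains \<gamma> where "\<gamma> \<in> couplings \<mu> \<nu>"
    "(\<integral>\<^sup>+z. ennreal (dist (fst z) (snd z)) \<partial>\<gamma>) \<le> ennreal (D + 2 * t * K + R / (2 * t))"
proof -
  note [measurable_cong] = tight_probD(2)[OF \<mu>] tight_probD(2)[OF \<nu>] tight_probD(2)[OF tight_prob_rprod[OF \<mu> \<nu>]]
  note [measurable] = \<phi>(1)
  interpret M: prob_space \<mu> using \<mu> by (rule tight_probD)
  interpret N: prob_space \<nu> using \<nu> by (rule tight_probD)
  have \<phi>1: "\<phi> i x \<le> 1" if "i < k" for i x
    using order.trans[OF member_le_sum[where f = "\<lambda>i. \<phi> i x" and A = "{..<k}" and i = i] \<phi>(3)[of x]] \<phi>(2) that
    by simp
  have int: "integrable \<mu> (\<phi> i)" "integrable \<nu> (\<phi> i)" if "i < k" for i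
    using \<phi>(2) \<phi>1[OF that]
    by (auto intro!: M.integrable_const_bound[of _ 1] N.integrable_const_bound[of _ 1])
  define a where "a i = (\<integral>x. \<phi> i x \<partial>\<mu>)" for i
  define b where "b i = (\<integral>x. \<phi> i x \<partial>\<nu>)" for i
  \<comment> \<open>The mass that piece i moves inside itself; it must be available on both sides,
    hence the minimum.\<close>
  define m where "m i = (1 - \<eta>) * min (a i) (b i)" for i
  have ab: "0 \<le> a i" "0 \<le> b i" for i
    unfolding a_def b_def using \<phi>(2) by (auto intro!: integral_nonneg)
  have m: "0 \<le> m i" "m i \<le> a i" "m i \<le> b i" for i
  proof -
    have "m i \<le> 1 * min (a i) (b i)"
      unfolding m_def using ab \<open>0 < \<eta>\<close> by (intro mult_right_mono) auto
    then show "m i \<le> a i" "m i \<le> b i" by auto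
    show "0 \<le> m i" unfolding m_def using ab \<open>\<eta> < 1\<close> by auto
  qed
  have R': "R = 1 - (\<Sum>i<k. m i)" unfolding R m_def a_def b_def ..
  \<comment> \<open>The share of piece i used up on the side of \<mu>. If a i = 0 then m i = 0 as
    well, so division by zero yielding 0 keeps the identity \<alpha> i * a i = m i.\<close>
  define \<alpha> where "\<alpha> i = m i / a i" for i
  define \<beta> where "\<beta> i = m i / b i" for i
  have \<alpha>: "0 \<le> \<alpha> i" "\<alpha> i \<le> 1" "\<alpha> i * a i = m i" for i
    unfolding \<alpha>_def using m[of i] ab[of i] by (auto simp: divide_le_eq_1)
  have \<beta>: "0 \<le> \<beta> i" "\<beta> i \<le> 1" "\<beta> i * b i = m i" for i
    unfolding \<beta>_def using m[of i] ab[of i] by (auto simp: divide_le_eq_1)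
  \<comment> \<open>Scales the product of \<phi> i with itself to total mass m i; integrating out
    either variable then leaves the share \<alpha> i or \<beta> i.\<close>
  define c where "c i = m i / (a i * b i)" for i
  have c: "0 \<le> c i" "c i * b i = \<alpha> i" "c i * a i = \<beta> i" for i
    unfolding c_def \<alpha>_def \<beta>_def using m[of i] ab[of i] by auto
  \<comment> \<open>Densities of what is left of \<mu> and \<nu>; both have integral R, so their
    product divided by R couples the remainders.\<close>
  define r where "r x = 1 - (\<Sum>i<k. \<alpha> i * \<phi> i x)" for x
  define s where "s x = 1 - (\<Sum>i<k. \<beta> i * \<phi> i x)" for x
  have [measurable]: "r \<in> borel_measurable borel" "s \<in> borel_measurable borel"
    unfolding r_def s_def by measurable
  have "(\<Sum>i<k. \<alpha> i * \<phi> i x) \<le> (\<Sum>i<k. \<phi> i x)" "(\<Sum>i<k. \<beta> i * \<phi> i x) \<le> (\<Sum>i<k. \<phi> i x)" for x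
    using \<alpha> \<beta> \<phi>(2) by (auto intro!: sum_mono mult_left_le_one_le)
  moreover have "0 \<le> (\<Sum>i<k. \<alpha> i * \<phi> i x)" "0 \<le> (\<Sum>i<k. \<beta> i * \<phi> i x)" for x
    using \<alpha> \<beta> \<phi>(2) by (auto intro!: sum_nonneg)
  ultimately have rs: "0 \<le> r x" "r x \<le> 1" "0 \<le> s x" "s x \<le> 1" for x
    unfolding r_def s_def using \<phi>(3)[of x] by (auto intro: order.trans)
  have int_r: "integrable \<mu> r" and int_s: "integrable \<nu> s"
    using rs by (auto intro!: M.integrable_const_bound[of _ 1] N.integrable_const_bound[of _ 1])
  have "(\<integral>x. r x \<partial>\<mu>) = (\<integral>x. 1 \<partial>\<mu>) - (\<integral>x. (\<Sum>i<k. \<alpha> i * \<phi> i x) \<partial>\<mu>)"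
    unfolding r_def using int by (intro Bochner_Integration.integral_diff) auto
  also have "(\<integral>x. (\<Sum>i<k. \<alpha> i * \<phi> i x) \<partial>\<mu>) = (\<Sum>i<k. \<alpha> i * a i)"
    unfolding a_def using int by (subst Bochner_Integration.integral_sum) auto
  finally have "(\<integral>x. r x \<partial>\<mu>) = R" by (simp add: R' M.prob_space \<alpha>)
  then have r_int: "(\<integral>\<^sup>+x. ennreal (r x) \<partial>\<mu>) = ennreal R"
    using nn_integral_eq_integral[OF int_r] rs by simp
  have "(\<integral>x. s x \<partial>\<nu>) = (\<integral>x. 1 \<partial>\<nu>) - (\<integral>x. (\<Sum>i<k. \<beta> i * \<phi> i x) \<partial>\<nu>)"
    unfolding s_def using int by (intro Bochner_Integration.integral_diff) auto
  also have "(\<integral>x. (\<Sum>i<k. \<beta> i * \<phi> i x) \<partial>\<nu>) = (\<Sum>i<k. \<beta> i * b i)"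
    unfolding b_def using int by (subst Bochner_Integration.integral_sum) auto
  finally have "(\<integral>x. s x \<partial>\<nu>) = R" by (simp add: R' N.prob_space \<beta>)
  then have s_int: "(\<integral>\<^sup>+x. ennreal (s x) \<partial>\<nu>) = ennreal R"
    using nn_integral_eq_integral[OF int_s] rs by simp
  have "(\<Sum>i<k. a i) = (\<integral>x. (\<Sum>i<k. \<phi> i x) \<partial>\<mu>)"
    unfolding a_def using int by (subst Bochner_Integration.integral_sum) auto
  also have "\<dots> \<le> (\<integral>x. 1 \<partial>\<mu>)"
    using \<phi>(3) int by (intro integral_mono) auto
  finally have "(\<Sum>i<k. a i) \<le> 1" by (simp add: M.prob_space)
  have "(\<Sum>i<k. m i) \<le> (1 - \<eta>) * (\<Sum>i<k. a i)"
    unfolding m_def sum_distrib_left using \<open>\<eta> < 1\<close> by (intro sum_mono mult_left_mono) auto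
  also have "\<dots> \<le> (1 - \<eta>) * 1" using \<open>\<eta> < 1\<close> \<open>(\<Sum>i<k. a i) \<le> 1\<close> by (intro mult_left_mono) auto
  finally have R0: "0 < R" using \<open>0 < \<eta>\<close> by (simp add: R')
  \<comment> \<open>Index k holds the independent coupling of the remainders, with the normalisation
    1/R on the side of p. Zeros beyond k turn the finite mixture into the series that the marginal
    formulas expect.\<close>
  define p where "p i x = (if i < k then ennreal (c i * \<phi> i x) else if i = k then ennreal (r x / R) else 0)" for i x
  define q where "q i x = (if i < k then ennreal (\<phi> i x) else if i = k then ennreal (s x) else 0)" for i x
  have pq[measurable]: "p i \<in> borel_measurable borel" "q i \<in> borel_measurable borel" for i
    unfolding p_def q_def by (auto intro!: measurable_compose[OF _ measurable_ennreal] borel_measurable_times borel_measurable_divide)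
  have p_int: "(\<integral>\<^sup>+x. p i x \<partial>\<mu>) = (if i < k then ennreal (\<beta> i) else if i = k then 1 else 0)" for i
  proof -
    have "(\<integral>\<^sup>+x. ennreal (c i * \<phi> i x) \<partial>\<mu>) = ennreal (\<beta> i)" if "i < k"
      using nn_integral_eq_integral[OF integrable_mult_right[OF int(1)[OF that]], of "c i"] c \<phi>(2) by (simp add: a_def)
    moreover have "(\<integral>\<^sup>+x. ennreal (r x / R) \<partial>\<mu>) = 1"
      using nn_integral_eq_integral[OF integrable_divide[OF int_r], of R] rs R0 \<open>(\<integral>x. r x \<partial>\<mu>) = R\<close> by simp
    ultimately show ?thesis unfolding p_def by auto
  qed
  have q_int: "(\<integral>\<^sup>+x. q i x \<partial>\<nu>) = (if i < k then ennreal (b i) else if i = k then ennreal R else 0)" for i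
    unfolding q_def using nn_integral_eq_integral[OF int(2), of i] \<phi>(2) s_int by (auto simp: b_def)
  have fin: "(\<Sum>i. F i) = (\<Sum>i<k. F i) + F k" if "\<And>i. i > k \<Longrightarrow> F i = 0" for F :: "nat \<Rightarrow> ennreal"
    using suminf_finite[of "{..<Suc k}" F] that by (simp add: not_less)
  have 1: "(\<Sum>i. p i x * (\<integral>\<^sup>+y. q i y \<partial>\<nu>)) = 1" for x
  proof -
    have "(\<Sum>i. p i x * (\<integral>\<^sup>+y. q i y \<partial>\<nu>)) = (\<Sum>i<k. ennreal (c i * \<phi> i x) * ennreal (b i)) + ennreal (r x / R) * ennreal R"
      by (subst fin) (auto simp: p_def q_int)
    also have "\<dots> = (\<Sum>i<k. ennreal (\<alpha> i * \<phi> i x)) + ennreal (r x)"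
      using c ab \<phi>(2) R0 rs by (auto simp: ennreal_mult[symmetric] mult_ac c(2)[symmetric] intro!: sum.cong)
    also have "\<dots> = ennreal ((\<Sum>i<k. \<alpha> i * \<phi> i x) + r x)"
      using \<alpha> \<phi>(2) rs by (simp add: sum_nonneg)
    finally show ?thesis by (simp add: r_def)
  qed
  have 2: "(\<Sum>i. (\<integral>\<^sup>+x. p i x \<partial>\<mu>) * q i y) = 1" for y
  proof -
    have "(\<Sum>i. (\<integral>\<^sup>+x. p i x \<partial>\<mu>) * q i y) = (\<Sum>i<k. ennreal (\<beta> i) * ennreal (\<phi> i y)) + ennreal (s y)"
      by (subst fin) (auto simp: q_def p_int)
    also have "\<dots> = (\<Sum>i<k. ennreal (\<beta> i * \<phi> i y)) + ennreal (s y)"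
      using \<beta> \<phi>(2) by (auto simp: ennreal_mult[symmetric] intro!: sum.cong)
    also have "\<dots> = ennreal ((\<Sum>i<k. \<beta> i * \<phi> i y) + s y)"
      using \<beta> \<phi>(2) rs by (simp add: sum_nonneg)
    finally show ?thesis by (simp add: s_def)
  qed
  define g where "g = (\<lambda>z. \<Sum>i. p i (fst z) * q i (snd z))"
  have [measurable]: "g \<in> borel_measurable borel" unfolding g_def by measurable
  define \<gamma> where "\<gamma> = density (rprod \<mu> \<nu>) g"
  have marg: "\<And>f. f \<in> borel_measurable borel \<Longrightarrow> (\<integral>\<^sup>+z. f (fst z) \<partial>\<gamma>) = (\<integral>\<^sup>+x. f x \<partial>\<mu>)"
    "\<And>f. f \<in> borel_measurable borel \<Longrightarrow> (\<integral>\<^sup>+z. f (snd z) \<partial>\<gamma>) = (\<integral>\<^sup>+x. f x \<partial>\<nu>)"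
    unfolding \<gamma>_def g_def
    by (erule nn_integral_mixture_fst[OF \<mu> \<nu> pq _ AE_I2[OF 1]], erule nn_integral_mixture_snd[OF \<mu> \<nu> pq _ AE_I2[OF 2]])
  have \<gamma>: "\<gamma> \<in> couplings \<mu> \<nu>"
    by (rule couplingsI[OF \<mu> \<nu> _ marg]) (simp_all add: \<gamma>_def tight_probD[OF tight_prob_rprod[OF \<mu> \<nu>]])
  let ?d = "\<lambda>x. ennreal (dist x x0)"
  have [measurable]: "(\<lambda>x. dist x x0) \<in> borel_measurable borel" "(\<lambda>z. dist (fst z) (snd z)) \<in> borel_measurable (borel :: ('s \<times> 's) measure)"
    by (intro borel_measurable_continuous_onI continuous_intros)+
  \<comment> \<open>Young's inequality with parameter t. Since u takes values in [0, 1], its square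
    is at most u, so the second term integrates to R / (4 t) and is small with the leftover
    mass.\<close>
  have young: "ennreal (dist x x0) * ennreal u \<le> ennreal t * ennreal ((dist x x0)\<^sup>2) + ennreal (1 / (4 * t)) * ennreal u"
    if "0 \<le> u" "u \<le> 1" for x u
  proof -
    have "0 \<le> (2 * t * dist x x0 - u)\<^sup>2" by simp
    then have "4 * t * (dist x x0 * u) \<le> 4 * t * (t * (dist x x0)\<^sup>2) + u\<^sup>2"
      by (simp add: power2_eq_square algebra_simps)
    also have "u\<^sup>2 \<le> u" using that by (simp add: power2_eq_square mult_left_le)
    finally have "dist x x0 * u \<le> t * (dist x x0)\<^sup>2 + 1 / (4 * t) * u"
      using \<open>0 < t\<close> by (simp add: field_simps)
    then show ?thesis using that \<open>0 < t\<close> by (simp flip: ennreal_mult ennreal_plus)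
  qed
  have tail: "(\<integral>\<^sup>+x. ?d x * ennreal (u x) \<partial>M) \<le> ennreal (t * K + R / (4 * t))"
    if "(\<integral>\<^sup>+x. ennreal ((dist x x0)\<^sup>2) \<partial>M) \<le> ennreal K" "(\<integral>\<^sup>+x. ennreal (u x) \<partial>M) = ennreal R"
      "\<And>x. 0 \<le> u x" "\<And>x. u x \<le> 1" and [measurable]: "u \<in> borel_measurable borel" and [measurable_cong]: "sets M = sets borel" for u M
  proof -
    have "(\<integral>\<^sup>+x. ?d x * ennreal (u x) \<partial>M) \<le> (\<integral>\<^sup>+x. ennreal t * ennreal ((dist x x0)\<^sup>2) + ennreal (1 / (4 * t)) * ennreal (u x) \<partial>M)"
      by (intro nn_integral_mono young that)
    also have "\<dots> = ennreal t * (\<integral>\<^sup>+x. ennreal ((dist x x0)\<^sup>2) \<partial>M) + ennreal (1 / (4 * t)) * ennreal R"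
    proof -
      have m: "(\<lambda>x. ennreal ((dist x x0)\<^sup>2)) \<in> borel_measurable M" "(\<lambda>x. ennreal (u x)) \<in> borel_measurable M"
        by measurable
      show ?thesis
        by (subst nn_integral_add; (intro borel_measurable_times_ennreal borel_measurable_const m)?)
          (simp add: nn_integral_cmult[OF m(1)] nn_integral_cmult[OF m(2)] that(2))
    qed
    also have "\<dots> \<le> ennreal t * ennreal K + ennreal (1 / (4 * t)) * ennreal R"
      by (intro add_right_mono mult_left_mono that) simp
    also have "\<dots> = ennreal (t * K + R / (4 * t))"
      using \<open>0 < t\<close> R0 \<open>0 \<le> K\<close> by (simp flip: ennreal_mult ennreal_plus)
    finally show ?thesis .
  qed
  \<comment> \<open>Inside a piece the distance is at most D. For the remainder the triangle
    inequality through x0 splits the distance into functions of one variable, which leaves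
    integrands of product form.\<close>
  have pointwise: "g z * ennreal (dist (fst z) (snd z)) \<le>
      ennreal D * g z + ((?d (fst z) * p k (fst z)) * q k (snd z) + p k (fst z) * (?d (snd z) * q k (snd z)))" for z
  proof -
    define G where "G = (\<Sum>i<k. p i (fst z) * q i (snd z))"
    have g: "g z = G + p k (fst z) * q k (snd z)"
      unfolding g_def G_def by (subst fin) (auto simp: p_def)
    have "G * ennreal (dist (fst z) (snd z)) \<le> G * ennreal D"
    proof (cases "G = 0")
      case False
      then obtain i where "i < k" "p i (fst z) * q i (snd z) \<noteq> 0" unfolding G_def by (auto simp: sum_eq_0_iff)
      then have "\<phi> i (fst z) \<noteq> 0" "\<phi> i (snd z) \<noteq> 0" by (auto simp: p_def q_def)
      then show ?thesis using diam \<open>i < k\<close> by (intro mult_left_mono ennreal_leI) auto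
    qed simp
    moreover have "ennreal (dist (fst z) (snd z)) \<le> ?d (fst z) + ?d (snd z)"
      by (simp add: dist_triangle2 flip: ennreal_plus)
    then have "p k (fst z) * q k (snd z) * ennreal (dist (fst z) (snd z)) \<le> p k (fst z) * q k (snd z) * (?d (fst z) + ?d (snd z))"
      by (intro mult_left_mono) auto
    ultimately have "g z * ennreal (dist (fst z) (snd z)) \<le> G * ennreal D + p k (fst z) * q k (snd z) * (?d (fst z) + ?d (snd z))"
      unfolding g distrib_right by (rule add_mono)
    also have "\<dots> \<le> ennreal D * g z + p k (fst z) * q k (snd z) * (?d (fst z) + ?d (snd z))"
      unfolding g distrib_left mult.commute[of G] by (intro add_right_mono add_increasing2) simp_all
    finally show ?thesis by (simp add: algebra_simps)
  qed
  have "(\<integral>\<^sup>+z. ennreal (dist (fst z) (snd z)) \<partial>\<gamma>) = (\<integral>\<^sup>+z. g z * ennreal (dist (fst z) (snd z)) \<partial>rprod \<mu> \<nu>)"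
    unfolding \<gamma>_def by (subst nn_integral_density) auto
  also have "\<dots> \<le> (\<integral>\<^sup>+z. ennreal D * g z + ((?d (fst z) * p k (fst z)) * q k (snd z) + p k (fst z) * (?d (snd z) * q k (snd z))) \<partial>rprod \<mu> \<nu>)"
    by (intro nn_integral_mono pointwise)
  also have "\<dots> = ennreal D * (\<integral>\<^sup>+z. g z \<partial>rprod \<mu> \<nu>) + ((\<integral>\<^sup>+z. (?d (fst z) * p k (fst z)) * q k (snd z) \<partial>rprod \<mu> \<nu>)
       + (\<integral>\<^sup>+z. p k (fst z) * (?d (snd z) * q k (snd z)) \<partial>rprod \<mu> \<nu>))"
    by (simp add: nn_integral_add nn_integral_cmult)
  also have "(\<integral>\<^sup>+z. g z \<partial>rprod \<mu> \<nu>) = (\<integral>\<^sup>+z. 1 \<partial>\<gamma>)"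
    unfolding \<gamma>_def by (subst nn_integral_density) auto
  also have "\<dots> = 1" using couplingsD(1)[OF \<gamma>] by (simp add: prob_space.emeasure_space_1)
  also have "(\<integral>\<^sup>+z. (?d (fst z) * p k (fst z)) * q k (snd z) \<partial>rprod \<mu> \<nu>) = (\<integral>\<^sup>+x. ?d x * p k x \<partial>\<mu>) * ennreal R"
    by (subst nn_integral_rprod[OF \<mu> \<nu>]) (auto simp: q_int)
  also have "\<dots> = (\<integral>\<^sup>+x. ?d x * p k x * ennreal R \<partial>\<mu>)" by (intro nn_integral_multc[symmetric]) auto
  also have "\<dots> = (\<integral>\<^sup>+x. ?d x * ennreal (r x) \<partial>\<mu>)"
    using R0 rs by (intro nn_integral_cong) (simp add: p_def mult.assoc flip: ennreal_mult)
  also have "(\<integral>\<^sup>+z. p k (fst z) * (?d (snd z) * q k (snd z)) \<partial>rprod \<mu> \<nu>) = (\<integral>\<^sup>+y. ?d y * ennreal (s y) \<partial>\<nu>)"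
    by (subst nn_integral_rprod[OF \<mu> \<nu>]) (auto simp: p_int q_def)
  finally have "(\<integral>\<^sup>+z. ennreal (dist (fst z) (snd z)) \<partial>\<gamma>)
      \<le> ennreal D + ((\<integral>\<^sup>+x. ?d x * ennreal (r x) \<partial>\<mu>) + (\<integral>\<^sup>+y. ?d y * ennreal (s y) \<partial>\<nu>))" by simp
  also have "\<dots> \<le> ennreal D + (ennreal (t * K + R / (4 * t)) + ennreal (t * K + R / (4 * t)))"
    using rs by (intro add_left_mono add_mono tail K r_int s_int tight_probD(2) \<mu> \<nu>) auto
  also have "\<dots> = ennreal (D + 2 * t * K + R / (2 * t))"
    using \<open>0 \<le> D\<close> \<open>0 < t\<close> \<open>0 \<le> K\<close> R0 by (simp flip: ennreal_plus add: field_simps)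
  finally show ?thesis by (intro that[OF \<gamma>])
qed

text \<open>Bumps of radius 2 \<eta> around a finite \<eta>-net of a compact set of mass above 1 -
  \<eta>, normalised to a partial partition of unity. Finitely many continuous pieces are exactly
  what weak convergence can control.\<close>

lemma small_partition_exists:
  fixes \<mu> :: "'s::metric_space measure"
  assumes \<mu>: "tight_prob \<mu>" and "0 < \<eta>"
  obtains k and \<phi> :: "nat \<Rightarrow> 's \<Rightarrow> real" where "\<And>i. continuous_on UNIV (\<phi> i)" "\<And>i x. 0 \<le> \<phi> i x" "\<And>x. (\<Sum>i<k. \<phi> i x) \<le> 1"
    "\<And>i x y. i < k \<Longrightarrow> \<phi> i x \<noteq> 0 \<Longrightarrow> \<phi> i y \<noteq> 0 \<Longrightarrow> dist x y \<le> 4 * \<eta>"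
    "1 - \<eta> < (\<Sum>i<k. \<integral>x. \<phi> i x \<partial>\<mu>)"
proof -
  interpret prob_space \<mu> using \<mu> by (rule tight_probD)
  note [simp, measurable_cong] = tight_probD(2)[OF \<mu>]
  have "ennreal (1 - \<eta>) < 1" using \<open>0 < \<eta>\<close> by (simp add: ennreal_less_one_iff)
  also have "1 = emeasure \<mu> UNIV" using tight_probD(4)[OF \<mu>] by simp
  also have "\<dots> = (SUP K\<in>{K. compact K \<and> K \<subseteq> UNIV}. emeasure \<mu> K)"
    using tight_prob_imp_radon[OF \<mu>] unfolding radon_def by auto
  finally obtain K where K: "compact K" "ennreal (1 - \<eta>) < emeasure \<mu> K" unfolding less_SUP_iff by auto
  have [measurable]: "K \<in> sets borel" using K(1) by (auto intro: borel_closed compact_imp_closed)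
  have \<mu>K: "1 - \<eta> < measure \<mu> K"
    using K(2) by (cases "0 \<le> 1 - \<eta>") (auto simp: emeasure_eq_measure ennreal_less_iff intro: less_le_trans[OF _ measure_nonneg])
  obtain F where F: "finite F" "K \<subseteq> (\<Union>x\<in>F. ball x \<eta>)"
    using K(1) \<open>0 < \<eta>\<close> unfolding compact_eq_totally_bounded by auto
  obtain h where h: "bij_betw h {0..<card F} F" using ex_bij_betw_nat_finite[OF F(1)] by auto
  define k where "k = card F"
  define \<psi> where "\<psi> i x = max 0 (2 * \<eta> - dist x (h i))" for i x
  define \<Psi> where "\<Psi> x = (\<Sum>i<k. \<psi> i x)" for x
  \<comment> \<open>Bounding the denominator below by \<eta> keeps the quotient continuous and the
    sum at most 1. On K some bump is at least \<eta>, so there the sum equals 1.\<close>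
  define \<phi> where "\<phi> i x = \<psi> i x / max \<eta> (\<Psi> x)" for i x
  have pos: "0 < max \<eta> (\<Psi> x)" for x using \<open>0 < \<eta>\<close> by auto
  have sum: "(\<Sum>i<k. \<phi> i x) = \<Psi> x / max \<eta> (\<Psi> x)" for x
    unfolding \<phi>_def \<Psi>_def by (simp add: sum_divide_distrib)
  have cont: "continuous_on UNIV (\<phi> i)" for i
    unfolding \<phi>_def \<Psi>_def \<psi>_def using pos[unfolded \<Psi>_def \<psi>_def]
    by (intro continuous_intros ballI) (metis less_irrefl)
  then have [measurable]: "\<phi> i \<in> borel_measurable borel" for i by (rule borel_measurable_continuous_onI)
  have nonneg: "0 \<le> \<phi> i x" for i x unfolding \<phi>_def \<psi>_def using pos[of x] by auto
  have le1: "(\<Sum>i<k. \<phi> i x) \<le> 1" for x unfolding sum using pos[of x] by (simp add: divide_le_eq_1)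
  have one: "1 \<le> (\<Sum>i<k. \<phi> i x)" if "x \<in> K" for x
  proof -
    from subsetD[OF F(2) that] obtain y where y: "y \<in> F" "dist y x < \<eta>" unfolding UN_iff mem_ball by blast
    then obtain i where i: "i < k" "h i = y" using h unfolding k_def bij_betw_def by (metis atLeastLessThan_iff imageE)
    have "\<eta> \<le> \<psi> i x" using y i by (simp add: \<psi>_def dist_commute)
    also have "\<dots> \<le> \<Psi> x" unfolding \<Psi>_def using i by (intro member_le_sum) (auto simp: \<psi>_def)
    finally show ?thesis unfolding sum using \<open>0 < \<eta>\<close> by simp
  qed
  have int: "integrable \<mu> (\<phi> i)" if "i < k" for i
    using nonneg order.trans[OF member_le_sum[where f = "\<lambda>i. \<phi> i x" and A = "{..<k}" and i = i for x] le1] that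
    by (intro integrable_const_bound[of _ 1]) auto
  have "measure \<mu> K = (\<integral>x. indicator K x \<partial>\<mu>)" by simp
  also have "\<dots> \<le> (\<integral>x. (\<Sum>i<k. \<phi> i x) \<partial>\<mu>)"
    using one nonneg int by (intro integral_mono) (auto simp: emeasure_eq_measure sum_nonneg split: split_indicator)
  also have "\<dots> = (\<Sum>i<k. \<integral>x. \<phi> i x \<partial>\<mu>)"
    using int by (intro Bochner_Integration.integral_sum) auto
  finally have "1 - \<eta> < (\<Sum>i<k. \<integral>x. \<phi> i x \<partial>\<mu>)" using \<mu>K by simp
  moreover have "dist x y \<le> 4 * \<eta>" if "\<phi> i x \<noteq> 0" "\<phi> i y \<noteq> 0" for i x y
  proof -
    have "dist x (h i) < 2 * \<eta>" "dist y (h i) < 2 * \<eta>"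
      using that by (auto simp: \<phi>_def \<psi>_def max_def split: if_splits)
    then show ?thesis using dist_triangle2[of x y "h i"] by simp
  qed
  ultimately show ?thesis using that[of \<phi> k] cont nonneg le1 by blast
qed

text \<open>The squared distance is unbounded and hence no test function. Its truncations at N pass
  to the limit, and monotone convergence in N removes the truncation.\<close>

lemma conv_distr_second_moment_le:
  fixes \<mu> :: "'s::metric_space measure"
  assumes \<mu>s: "\<And>n. tight_prob (\<mu>s n)" and \<mu>: "tight_prob \<mu>" and conv: "conv_distr \<mu>s \<mu>"
    and K: "\<And>n. (\<integral>\<^sup>+x. ennreal ((dist x x0)\<^sup>2) \<partial>\<mu>s n) \<le> ennreal K" and "0 \<le> K"
  shows "(\<integral>\<^sup>+x. ennreal ((dist x x0)\<^sup>2) \<partial>\<mu>) \<le> ennreal K"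
proof -
  define f where "f N x = min ((dist x x0)\<^sup>2) (real N)" for N x
  have cont: "continuous_on UNIV (f N)" for N unfolding f_def by (intro continuous_intros)
  then have [measurable]: "f N \<in> borel_measurable borel" for N by (rule borel_measurable_continuous_onI)
  have f: "0 \<le> f N x" "f N x \<le> real N" "f N x \<le> (dist x x0)\<^sup>2" for N x by (auto simp: f_def)
  have eq: "(\<integral>\<^sup>+x. ennreal (f N x) \<partial>M) = ennreal (\<integral>x. f N x \<partial>M)" if M: "tight_prob M" for M N
  proof -
    interpret prob_space M using M by (rule tight_probD)
    have "integrable M (f N)"
      using f by (intro integrable_const_bound[of _ "real N"]) (auto simp: tight_probD[OF M])
    then show ?thesis using f by (intro nn_integral_eq_integral) auto
  qed
  have le: "(\<integral>x. f N x \<partial>\<mu>) \<le> K" for N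
  proof (rule LIMSEQ_le_const2)
    have "bounded (range (f N))" using f by (auto simp: bounded_iff intro!: exI[of _ "real N"])
    then show "(\<lambda>n. \<integral>x. f N x \<partial>\<mu>s n) \<longlonglongrightarrow> (\<integral>x. f N x \<partial>\<mu>)"
      using conv cont unfolding conv_distr_def by blast
    have "ennreal (\<integral>x. f N x \<partial>\<mu>s n) \<le> ennreal K" for n
      unfolding eq[OF \<mu>s, symmetric] using f by (intro order.trans[OF nn_integral_mono K] ennreal_leI) auto
    then show "\<exists>M. \<forall>n\<ge>M. (\<integral>x. f N x \<partial>\<mu>s n) \<le> K" using \<open>0 \<le> K\<close> by (auto simp: ennreal_le_iff)
  qed
  have "(SUP N. ennreal (f N x)) = ennreal ((dist x x0)\<^sup>2)" for x
  proof (rule antisym)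
    obtain N where "(dist x x0)\<^sup>2 \<le> real N" using real_arch_simple by blast
    then have "f N x = (dist x x0)\<^sup>2" by (simp add: f_def)
    then show "ennreal ((dist x x0)\<^sup>2) \<le> (SUP N. ennreal (f N x))" by (intro SUP_upper2[of N]) auto
  qed (use f in \<open>auto intro!: SUP_least ennreal_leI\<close>)
  then have "(\<integral>\<^sup>+x. ennreal ((dist x x0)\<^sup>2) \<partial>\<mu>) = (\<integral>\<^sup>+x. (SUP N. ennreal (f N x)) \<partial>\<mu>)" by simp
  also have "\<dots> = (SUP N. \<integral>\<^sup>+x. ennreal (f N x) \<partial>\<mu>)"
    by (intro nn_integral_monotone_convergence_SUP)
      (auto simp: incseq_def le_fun_def tight_probD[OF \<mu>] intro!: ennreal_leI, auto simp: f_def)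
  also have "\<dots> \<le> ennreal K"
    unfolding eq[OF \<mu>] by (intro SUP_least ennreal_leI le)
  finally show ?thesis .
qed

text \<open>Weak convergence applied to finitely many pieces makes the masses on both sides nearly
  equal, so that the unmatched mass is eventually below 2 \<eta>.\<close>

lemma conv_distr_eventually_coupling:
  fixes \<mu> :: "'s::metric_space measure"
  assumes \<mu>s: "\<And>n. tight_prob (\<mu>s n)" and \<mu>: "tight_prob \<mu>" and conv: "conv_distr \<mu>s \<mu>"
    and K: "\<And>n. (\<integral>\<^sup>+x. ennreal ((dist x x0)\<^sup>2) \<partial>\<mu>s n) \<le> ennreal K" and "0 \<le> K" and "0 < e"
  shows "\<forall>\<^sub>F n in sequentially. \<exists>\<gamma>\<in>couplings (\<mu>s n) \<mu>. (\<integral>\<^sup>+z. ennreal (dist (fst z) (snd z)) \<partial>\<gamma>) \<le> ennreal e"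
proof -
  \<comment> \<open>With \<eta> = t^2 the three costs are at most 4 t for the pieces, 2 t K for the
    moments and t for R / (2 t), since R < 2 t^2. Their sum is t (2 K + 5). The cap 1/2 ensures
    \<eta> < 1 and t^2 \<le> t.\<close>
  define t where "t = min (1 / 2) (e / (2 * K + 5))"
  have t: "0 < t" "t \<le> 1 / 2" "t * (2 * K + 5) \<le> e"
  proof -
    show "0 < t" using \<open>0 < e\<close> \<open>0 \<le> K\<close> unfolding t_def by auto
    show "t \<le> 1 / 2" unfolding t_def by (rule min.cobounded1)
    have "t \<le> e / (2 * K + 5)" unfolding t_def by simp
    then show "t * (2 * K + 5) \<le> e" using \<open>0 \<le> K\<close> by (simp add: pos_le_divide_eq)
  qed
  define \<eta> where "\<eta> = t\<^sup>2"
  have "t * t \<le> 1 / 2 * (1 / 2)" using t by (intro mult_mono) auto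
  then have \<eta>: "0 < \<eta>" "\<eta> < 1" using t unfolding \<eta>_def by (auto simp: power2_eq_square)
  obtain \<phi> :: "nat \<Rightarrow> 's \<Rightarrow> real" and k where \<phi>: "\<And>i. continuous_on UNIV (\<phi> i)" "\<And>i x. 0 \<le> \<phi> i x" "\<And>x. (\<Sum>i<k. \<phi> i x) \<le> 1"
    "\<And>i x y. i < k \<Longrightarrow> \<phi> i x \<noteq> 0 \<Longrightarrow> \<phi> i y \<noteq> 0 \<Longrightarrow> dist x y \<le> 4 * \<eta>"
    "1 - \<eta> < (\<Sum>i<k. \<integral>x. \<phi> i x \<partial>\<mu>)"
    by (rule small_partition_exists[OF \<mu> \<eta>(1)], rule that, assumption+)
  define R where "R n = 1 - (\<Sum>i<k. (1 - \<eta>) * min (\<integral>x. \<phi> i x \<partial>\<mu>s n) (\<integral>x. \<phi> i x \<partial>\<mu>))" for n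
  have "(\<lambda>n. \<integral>x. \<phi> i x \<partial>\<mu>s n) \<longlonglongrightarrow> (\<integral>x. \<phi> i x \<partial>\<mu>)" if "i < k" for i
  proof -
    have "\<phi> i x \<le> 1" for x
      using order.trans[OF member_le_sum[where f = "\<lambda>i. \<phi> i x" and A = "{..<k}" and i = i] \<phi>(3)[of x]] \<phi>(2) that
      by simp
    then have "bounded (range (\<phi> i))" using \<phi>(2) by (auto simp: bounded_iff intro!: exI[of _ 1])
    then show ?thesis using conv \<phi>(1) unfolding conv_distr_def by blast
  qed
  then have "R \<longlonglongrightarrow> 1 - (\<Sum>i<k. (1 - \<eta>) * min (\<integral>x. \<phi> i x \<partial>\<mu>) (\<integral>x. \<phi> i x \<partial>\<mu>))"
    unfolding R_def by (intro tendsto_intros) auto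
  \<comment> \<open>In the limit both masses of a piece agree and the minimum disappears; the pieces
    carry more than 1 - \<eta>, and (1 - \<eta>)^2 is at least 1 - 2 \<eta>.\<close>
  moreover have "1 - (\<Sum>i<k. (1 - \<eta>) * min (\<integral>x. \<phi> i x \<partial>\<mu>) (\<integral>x. \<phi> i x \<partial>\<mu>)) < 2 * \<eta>"
  proof -
    have "(1 - \<eta>) * (1 - \<eta>) < (1 - \<eta>) * (\<Sum>i<k. \<integral>x. \<phi> i x \<partial>\<mu>)"
      using \<phi>(5) \<eta> by (intro mult_strict_left_mono) auto
    moreover have "1 - 2 * \<eta> \<le> (1 - \<eta>) * (1 - \<eta>)" by (simp add: algebra_simps)
    ultimately show ?thesis by (simp add: sum_distrib_left)
  qed
  ultimately have "\<forall>\<^sub>F n in sequentially. R n < 2 * \<eta>" by (rule order_tendstoD)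
  then show ?thesis
  proof eventually_elim
    case (elim n)
    note K' = K[of n] conv_distr_second_moment_le[OF \<mu>s \<mu> conv K \<open>0 \<le> K\<close>]
    have "0 \<le> 4 * \<eta>" using \<eta> by simp
    obtain \<gamma> where \<gamma>: "\<gamma> \<in> couplings (\<mu>s n) \<mu>"
      "(\<integral>\<^sup>+z. ennreal (dist (fst z) (snd z)) \<partial>\<gamma>) \<le> ennreal (4 * \<eta> + 2 * t * K + R n / (2 * t))"
      by (rule partition_coupling[OF \<mu>s[of n] \<mu> borel_measurable_continuous_onI[OF \<phi>(1)] \<phi>(2,3,4) \<open>0 \<le> 4 * \<eta>\<close>
          t(1) \<open>0 \<le> K\<close> \<eta> K' R_def])
    have "R n / (2 * t) \<le> t" using elim t(1) unfolding \<eta>_def by (simp add: field_simps power2_eq_square)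
    moreover have "4 * \<eta> \<le> 4 * t" using t unfolding \<eta>_def by (simp add: power2_eq_square mult_left_le)
    ultimately have "4 * \<eta> + 2 * t * K + R n / (2 * t) \<le> t * (2 * K + 5)" by (simp add: algebra_simps)
    also have "\<dots> \<le> e" by (rule t)
    finally show ?case using \<gamma> by (intro bexI[of _ \<gamma>] order.trans[OF \<gamma>(2)] ennreal_leI)
  qed
qed

lemma conv_distr_wdist_tendsto_0:
  fixes \<mu> :: "('a::metric_space \<times> 'a) measure"
  assumes \<mu>s: "\<And>n. tight_prob (\<mu>s n)" and \<mu>: "tight_prob \<mu>" and conv: "conv_distr \<mu>s \<mu>"
    and K: "\<And>n. (\<integral>\<^sup>+x. ennreal ((dist x x0)\<^sup>2) \<partial>\<mu>s n) \<le> ennreal K" and "0 \<le> K" and "0 < e"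
  shows "\<forall>\<^sub>F n in sequentially. wdist (\<mu>s n) \<mu> \<le> ennreal e"
proof -
  have "0 < e / 2" using \<open>0 < e\<close> by simp
  from conv_distr_eventually_coupling[OF \<mu>s \<mu> conv K \<open>0 \<le> K\<close> this] show ?thesis
  proof eventually_elim
    case (elim n)
    then obtain \<gamma> where \<gamma>: "\<gamma> \<in> couplings (\<mu>s n) \<mu>"
      "(\<integral>\<^sup>+z. ennreal (dist (fst z) (snd z)) \<partial>\<gamma>) \<le> ennreal (e / 2)" by blast
    have m: "(\<lambda>z. ennreal (dist (fst z) (snd z))) \<in> borel_measurable \<gamma>"
      unfolding tight_probD(5)[OF tight_prob_coupling[OF \<gamma>(1) \<mu>s \<mu>]]
      by (intro borel_measurable_continuous_real continuous_intros)
    have "wdist (\<mu>s n) \<mu> \<le> (\<integral>\<^sup>+z. ennreal (manhattan (fst z) (snd z)) \<partial>\<gamma>)" by (rule wdist_le[OF \<gamma>(1)])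
    also have "\<dots> \<le> (\<integral>\<^sup>+z. ennreal 2 * ennreal (dist (fst z) (snd z)) \<partial>\<gamma>)"
      using manhattan_le_2_dist by (intro nn_integral_mono) (simp flip: ennreal_mult del: ennreal_numeral)
    also have "\<dots> = ennreal 2 * (\<integral>\<^sup>+z. ennreal (dist (fst z) (snd z)) \<partial>\<gamma>)"
      using m by (rule nn_integral_cmult)
    also have "\<dots> \<le> ennreal 2 * ennreal (e / 2)" by (intro mult_left_mono \<gamma>) simp
    also have "\<dots> = ennreal e" using \<open>0 < e\<close> by (subst ennreal_mult[symmetric]) auto
    finally show ?case .
  qed
qed

section \<open>Covariance as a functional of the joint law\<close>

lemma dcov_le_fst:
  assumes J: "tight_prob J"
  shows "dcov J \<le> (\<integral>\<^sup>+z. ennreal (dist (fst z) (snd z)) \<partial>rprod (distr J borel fst) (distr J borel fst))"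
proof -
  let ?g = "\<lambda>z :: ('a \<times> 'a) \<times> ('a \<times> 'a). (fst (fst z), snd (snd z))"
  note t = tight_prob_rprod[OF J J]
  have g: "distr (rprod J J) borel ?g = indep_law J"
    unfolding indep_law_def by (subst distr_rprod[OF J J]) (auto intro: continuous_intros)
  have "dcov J \<le> (\<integral>\<^sup>+z. ennreal (manhattan (snd z) (?g z)) \<partial>rprod J J)"
    unfolding dcov_def g[symmetric]
    by (subst (1) distr_rprod_snd[OF J J, symmetric]) (intro wdist_distr_le t continuous_intros)
  also have "\<dots> = (\<integral>\<^sup>+z. ennreal (dist (fst (fst z)) (fst (snd z))) \<partial>rprod J J)"
    by (simp add: manhattan_def dist_commute)
  also have "\<dots> = (\<integral>\<^sup>+z. ennreal (dist (fst z) (snd z)) \<partial>distr (rprod J J) borel (\<lambda>z. (fst (fst z), fst (snd z))))"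
    by (subst nn_integral_distr_continuous) (auto intro!: t continuous_intros)
  also have "distr (rprod J J) borel (\<lambda>z. (fst (fst z), fst (snd z))) = rprod (distr J borel fst) (distr J borel fst)"
    by (subst distr_rprod[OF J J]) (auto intro: continuous_intros)
  finally show ?thesis .
qed

text \<open>The Gini mean difference. By \<open>dcov_diagonal\<close> it is the earth mover's
  variance before truncation.\<close>

definition gini :: "'a::metric_space measure \<Rightarrow> ennreal" where
  "gini \<mu> = (\<integral>\<^sup>+z. ennreal (dist (fst z) (snd z)) \<partial>rprod \<mu> \<mu>)"

text \<open>Transport from $(u, f u)$ to $(x, y)$ costs at least $\min \{1, 1/c\}$ times the distance of
  $f x$ and $y$, since $f x$ can be compared with $f u$; this matches the cost of resampling
  one coordinate only.\<close>

lemma dcov_graph: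
  fixes J :: "('a::metric_space \<times> 'a) measure"
  assumes J: "tight_prob J" and c: "0 < c" "\<And>x y. dist (f x) (f y) = c * dist x y"
    and f: "continuous_on UNIV f" and graph: "AE z in J. snd z = f (fst z)"
  shows "dcov J = min (gini (distr J borel fst)) (gini (distr J borel snd))"
proof -
  define \<mu> where "\<mu> = distr J borel fst"
  define \<nu> where "\<nu> = distr J borel snd"
  have \<mu>: "tight_prob \<mu>" and \<nu>: "tight_prob \<nu>" unfolding \<mu>_def \<nu>_def by (rule tight_prob_marginals[OF J])+
  have "\<nu> = distr J borel (\<lambda>z. f (fst z))"
    unfolding \<nu>_def using graph f
    by (intro distr_cong_AE) (auto simp: tight_probD[OF J] intro!: borel_measurable_continuous_onI
      continuous_intros continuous_on_compose2[OF f])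
  then have \<nu>_eq: "\<nu> = distr \<mu> borel f"
    unfolding \<mu>_def by (subst distr_distr_continuous[OF J _ f]) (auto intro: continuous_intros)
  have "gini \<nu> = (\<integral>\<^sup>+z. ennreal (dist (fst z) (snd z)) \<partial>distr (rprod \<mu> \<mu>) borel (\<lambda>z. (f (fst z), f (snd z))))"
    unfolding gini_def distr_rprod[OF \<mu> \<mu> f f] \<nu>_eq ..
  also have "\<dots> = (\<integral>\<^sup>+z. ennreal c * ennreal (dist (fst z) (snd z)) \<partial>rprod \<mu> \<mu>)"
    using c by (subst nn_integral_distr_continuous)
      (auto simp: ennreal_mult intro!: tight_prob_rprod \<mu> continuous_intros continuous_on_compose2[OF f])
  also have "\<dots> = ennreal c * gini \<mu>"
    unfolding gini_def by (rule nn_integral_cmult)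
      (unfold tight_probD(5)[OF tight_prob_rprod[OF \<mu> \<mu>]], intro borel_measurable_continuous_real continuous_intros)
  finally have gini_\<nu>: "gini \<nu> = ennreal c * gini \<mu>" .
  \<comment> \<open>As gini \<nu> is c times gini \<mu>, this factor turns gini \<nu> into the
    smaller of the two, so one estimate covers contractions and expansions.\<close>
  have "ennreal (min 1 (1 / c)) * gini \<nu> \<le> dcov J"
    unfolding dcov_def wdist_def
  proof (rule INF_greatest)
    fix \<gamma> assume \<gamma>: "\<gamma> \<in> couplings J (indep_law J)"
    have cont: "continuous_on UNIV (\<lambda>z. dist (f (fst z)) (snd z))"
      by (intro continuous_intros continuous_on_compose2[OF f]) auto
    have "distr (rprod \<mu> \<nu>) borel (\<lambda>z. (f (fst z), snd z)) = rprod \<nu> (distr \<nu> borel (\<lambda>y. y))"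
      using distr_rprod[OF \<mu> \<nu> f continuous_on_id] by (simp add: \<nu>_eq)
    also have "distr \<nu> borel (\<lambda>y. y) = \<nu>" by (rule distr_id2) (simp add: tight_probD[OF \<nu>])
    finally have "gini \<nu> = (\<integral>\<^sup>+z. ennreal (dist (fst z) (snd z)) \<partial>distr (rprod \<mu> \<nu>) borel (\<lambda>z. (f (fst z), snd z)))"
      unfolding gini_def by simp
    also have "\<dots> = (\<integral>\<^sup>+z. ennreal (dist (f (fst z)) (snd z)) \<partial>indep_law J)"
      unfolding indep_law_def \<mu>_def[symmetric] \<nu>_def[symmetric]
      by (subst nn_integral_distr_continuous)
        (auto intro!: tight_prob_rprod \<mu> \<nu> continuous_intros continuous_on_compose2[OF f])
    also have "\<dots> = (\<integral>\<^sup>+z. ennreal (dist (f (fst (snd z))) (snd (snd z))) \<partial>\<gamma>)"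
      using couplingsD(6)[OF \<gamma> borel_measurable_continuous_real[OF cont]] by simp
    finally have "ennreal (min 1 (1 / c)) * gini \<nu> = ennreal (min 1 (1 / c)) * (\<integral>\<^sup>+z. ennreal (dist (f (fst (snd z))) (snd (snd z))) \<partial>\<gamma>)"
      by simp
    also have "\<dots> = (\<integral>\<^sup>+z. ennreal (min 1 (1 / c)) * ennreal (dist (f (fst (snd z))) (snd (snd z))) \<partial>\<gamma>)"
      by (rule nn_integral_cmult[symmetric])
        (unfold tight_probD(5)[OF tight_prob_coupling[OF \<gamma> J tight_prob_indep_law[OF J]]],
          intro borel_measurable_continuous_real continuous_on_compose2[OF cont] continuous_intros, auto)
    also have "\<dots> \<le> (\<integral>\<^sup>+z. ennreal (manhattan (fst z) (snd z)) \<partial>\<gamma>)"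
    proof (rule nn_integral_mono_AE, use couplingsD(7)[OF \<gamma> graph] in eventually_elim)
      case (elim z)
      let ?u = "fst (fst z)" and ?x = "fst (snd z)" and ?y = "snd (snd z)"
      \<comment> \<open>The start (u, f u) lies on the graph. Moving u to x is felt with factor c
        after applying f, and the weight \<open>min 1 (1 / c)\<close> brings both terms down to the
        Manhattan cost.\<close>
      have "dist (f ?x) ?y \<le> c * dist ?u ?x + dist (f ?u) ?y"
        using dist_triangle[of "f ?x" ?y "f ?u"] c(2)[of ?x ?u] by (simp add: dist_commute)
      then have "min 1 (1 / c) * dist (f ?x) ?y \<le> min 1 (1 / c) * c * dist ?u ?x + min 1 (1 / c) * dist (f ?u) ?y"
        using c(1) mult_left_mono[of "dist (f ?x) ?y" "c * dist ?u ?x + dist (f ?u) ?y" "min 1 (1 / c)"]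
        by (simp add: algebra_simps)
      also have "min 1 (1 / c) * c * dist ?u ?x \<le> 1 * dist ?u ?x"
        using c(1) by (intro mult_right_mono) (auto simp: min_def)
      also have "min 1 (1 / c) * dist (f ?u) ?y \<le> 1 * dist (f ?u) ?y"
        by (intro mult_right_mono) auto
      finally have "min 1 (1 / c) * dist (f ?x) ?y \<le> manhattan (fst z) (snd z)"
        using elim by (simp add: manhattan_def)
      then show ?case using c(1) by (simp flip: ennreal_mult)
    qed
    finally show "ennreal (min 1 (1 / c)) * gini \<nu> \<le> (\<integral>\<^sup>+z. ennreal (manhattan (fst z) (snd z)) \<partial>\<gamma>)" .
  qed
  moreover have "min (gini \<mu>) (gini \<nu>) \<le> ennreal (min 1 (1 / c)) * gini \<nu>"
  proof (cases "c \<le> 1")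
    case True
    then have "min 1 (1 / c) = 1" using c(1) by (auto simp: min_def field_simps)
    then show ?thesis by simp
  next
    case False
    then have "min 1 (1 / c) = 1 / c" by (auto simp: min_def field_simps)
    moreover have "ennreal (1 / c) * (ennreal c * gini \<mu>) = gini \<mu>"
      using c(1) by (simp flip: mult.assoc ennreal_mult)
    ultimately show ?thesis unfolding gini_\<nu> by simp
  qed
  ultimately have "min (gini \<mu>) (gini \<nu>) \<le> dcov J" by (rule order.trans[rotated])
  moreover have "dcov J \<le> min (gini \<mu>) (gini \<nu>)"
    using dcov_le_fst[OF J] dcov_le_snd[OF J] by (simp add: gini_def \<mu>_def \<nu>_def)
  ultimately show ?thesis unfolding \<mu>_def \<nu>_def by (rule antisym[rotated])
qed

text \<open>The diagonal is the graph of the identity, a similarity with ratio 1, and both marginals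
  are \<mu>.\<close>

lemma dcov_diagonal:
  assumes \<mu>: "tight_prob \<mu>"
  shows "dcov (distr \<mu> borel (\<lambda>x. (x, x))) = gini \<mu>"
proof -
  have cont: "continuous_on UNIV (\<lambda>x :: 'a. (x, x))" by (intro continuous_intros)
  have m: "(\<lambda>x. (x, x)) \<in> measurable \<mu> borel" using cont by (simp add: tight_probD[OF \<mu>] borel_measurable_continuous_onI)
  have id: "distr \<mu> borel (\<lambda>x. x) = \<mu>" by (rule distr_id2) (simp add: tight_probD[OF \<mu>])
  have marg: "distr (distr \<mu> borel (\<lambda>x. (x, x))) borel fst = \<mu>" "distr (distr \<mu> borel (\<lambda>x. (x, x))) borel snd = \<mu>"
    using id by (auto simp: distr_distr_continuous[OF \<mu> cont] continuous_on_fst continuous_on_snd)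
  have closed: "{z :: 'a \<times> 'a. snd z = fst z} \<in> sets borel"
    by (intro borel_closed closed_Collect_eq continuous_intros)
  have "AE z in distr \<mu> borel (\<lambda>x. (x, x)). snd z = fst z"
    using closed by (subst AE_distr_iff[OF m]) auto
  with dcov_graph[OF tight_prob_distr[OF \<mu> cont], of 1 "\<lambda>x. x"] show ?thesis
    by (simp add: marg)
qed

section \<open>Finiteness and vanishing of mean distance and transport cost\<close>

lemma gini_finite:
  fixes \<mu> :: "'a::metric_space measure"
  assumes \<mu>: "tight_prob \<mu>" and fin: "(\<integral>\<^sup>+x. ennreal (dist x x0) \<partial>\<mu>) < \<infinity>"
  shows "gini \<mu> < \<infinity>"
proof -
  have m: "(\<lambda>x. ennreal (dist x x0)) \<in> borel_measurable borel"
    by (intro borel_measurable_continuous_real continuous_intros)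
  have "gini \<mu> \<le> (\<integral>\<^sup>+z. ennreal (dist (fst z) x0) + ennreal (dist (snd z) x0) \<partial>rprod \<mu> \<mu>)"
    unfolding gini_def by (intro nn_integral_mono) (simp add: dist_triangle2 flip: ennreal_plus)
  also have "\<dots> = (\<integral>\<^sup>+z. ennreal (dist (fst z) x0) \<partial>rprod \<mu> \<mu>) + (\<integral>\<^sup>+z. ennreal (dist (snd z) x0) \<partial>rprod \<mu> \<mu>)"
    by (intro nn_integral_add; unfold tight_probD(5)[OF tight_prob_rprod[OF \<mu> \<mu>]];
      intro borel_measurable_continuous_real continuous_intros)
  also have "\<dots> = (\<integral>\<^sup>+x. ennreal (dist x x0) \<partial>\<mu>) + (\<integral>\<^sup>+x. ennreal (dist x x0) \<partial>\<mu>)"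
    using nn_integral_rprod_fst[OF \<mu> \<mu> m] nn_integral_rprod_snd[OF \<mu> \<mu> m] by simp
  also have "\<dots> < \<infinity>" using fin by simp
  finally show ?thesis .
qed

text \<open>Two independent copies agree almost surely. Fixing the first copy at a typical value,
  which exists in a probability space, makes the second one constant.\<close>

lemma gini_eq_0_imp_constant:
  assumes \<mu>: "tight_prob \<mu>" and "gini \<mu> = 0"
  shows "\<exists>c. AE x in \<mu>. x = c"
proof -
  interpret prob_space \<mu> using \<mu> by (rule tight_probD)
  have "(\<lambda>z. ennreal (dist (fst z) (snd z))) \<in> borel_measurable (rprod \<mu> \<mu>)"
    unfolding tight_probD(5)[OF tight_prob_rprod[OF \<mu> \<mu>]]
    by (intro borel_measurable_continuous_real continuous_intros)
  then have "AE z in rprod \<mu> \<mu>. fst z = snd z"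
    using assms(2) unfolding gini_def by (subst (asm) nn_integral_0_iff_AE) auto
  from AE_rprodD[OF \<mu> \<mu> this] have "AE x in \<mu>. AE y in \<mu>. y = x"
    by (auto simp: eq_commute)
  then have "\<exists>x. AE y in \<mu>. y = x"
    using AE_False eventually_ex[of _ "ae_filter \<mu>"] by (metis (mono_tags, lifting) eventually_mono)
  then show ?thesis .
qed

text \<open>A Lipschitz function lying between the indicators of F and of its neighbourhood U n
  changes its integral by at most the Lipschitz constant times the transport cost. Letting n grow
  shrinks U n to F; no optimal coupling has to exist.\<close>

lemma wdist_eq_0_imp_le_closed:
  assumes \<mu>: "tight_prob \<mu>" and \<nu>: "tight_prob \<nu>" and "wdist \<mu> \<nu> = 0" and F: "closed F" "F \<noteq> {}"
  shows "measure \<mu> F \<le> measure \<nu> F"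
proof -
  interpret M: prob_space \<mu> using \<mu> by (rule tight_probD)
  interpret N: prob_space \<nu> using \<nu> by (rule tight_probD)
  note [simp] = tight_probD(2)[OF \<mu>] tight_probD(2)[OF \<nu>]
  define U where "U n = {x. infdist x F \<le> 1 / Suc n}" for n
  have "closed (U n)" for n unfolding U_def by (intro closed_Collect_le continuous_intros)
  then have [simp]: "U n \<in> sets borel" for n by simp
  have FU: "measure \<mu> F \<le> measure \<nu> (U n)" for n
  proof -
    define h where "h x = max 0 (1 - Suc n * infdist x F)" for x
    have "continuous_on UNIV h" unfolding h_def by (intro continuous_intros)
    then have m: "(\<lambda>x. ennreal (h x)) \<in> borel_measurable borel" by (rule borel_measurable_continuous_real)
    have lip: "h x \<le> h y + Suc n * manhattan x y" for x y
    proof -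
      have "infdist y F \<le> infdist x F + manhattan x y"
        using infdist_triangle[of y F x] dist_le_manhattan[of x y] by (simp add: dist_commute)
      then have "Suc n * infdist y F \<le> Suc n * infdist x F + Suc n * manhattan x y"
        unfolding distrib_left[symmetric] by (intro mult_left_mono) auto
      moreover have "0 \<le> Suc n * manhattan x y" by simp
      ultimately show ?thesis unfolding h_def by (simp only: max_def split: if_splits) linarith
    qed
    have h0: "0 \<le> h x" for x by (simp add: h_def)
    have lip': "ennreal (h x) \<le> ennreal (h y) + ennreal (Suc n) * ennreal (manhattan x y)" for x y
      using ennreal_leI[OF lip[of x y]] h0[of y] by (simp add: ennreal_plus ennreal_mult del: of_nat_Suc)
    have "emeasure \<mu> F \<le> emeasure \<nu> (U n)"
    proof (rule ennreal_le_epsilon)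
      fix e :: real assume e: "0 < e"
      \<comment> \<open>The cost is made small relative to the Lipschitz constant n + 1 of h, so the
        product of the two is at most e.\<close>
      then have "wdist \<mu> \<nu> < ennreal (e / Suc n)" using assms(3) by simp
      then obtain \<gamma> where \<gamma>: "\<gamma> \<in> couplings \<mu> \<nu>" "(\<integral>\<^sup>+z. ennreal (manhattan (fst z) (snd z)) \<partial>\<gamma>) < ennreal (e / Suc n)"
        unfolding wdist_def INF_less_iff by blast
      note t = tight_probD(5)[OF tight_prob_coupling[OF \<gamma>(1) \<mu> \<nu>]]
      have "emeasure \<mu> F = (\<integral>\<^sup>+x. indicator F x \<partial>\<mu>)" using F by simp
      also have "\<dots> \<le> (\<integral>\<^sup>+x. ennreal (h x) \<partial>\<mu>)"
        using F by (intro nn_integral_mono) (auto simp: h_def split: split_indicator)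
      also have "\<dots> = (\<integral>\<^sup>+z. ennreal (h (fst z)) \<partial>\<gamma>)" using couplingsD(5)[OF \<gamma>(1) m] by simp
      also have "\<dots> \<le> (\<integral>\<^sup>+z. ennreal (h (snd z)) + ennreal (Suc n) * ennreal (manhattan (fst z) (snd z)) \<partial>\<gamma>)"
        by (intro nn_integral_mono lip')
      also have "\<dots> = (\<integral>\<^sup>+z. ennreal (h (snd z)) \<partial>\<gamma>) + ennreal (Suc n) * (\<integral>\<^sup>+z. ennreal (manhattan (fst z) (snd z)) \<partial>\<gamma>)"
      proof -
        have m1: "(\<lambda>z. ennreal (manhattan (fst z) (snd z))) \<in> borel_measurable \<gamma>"
          unfolding t by (rule borel_measurable_manhattan)
        have m2: "(\<lambda>z. ennreal (h (snd z))) \<in> borel_measurable \<gamma>"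
          unfolding t using measurable_compose[OF measurable_snd_borel m] .
        show ?thesis
          using nn_integral_add[OF m2 borel_measurable_times_ennreal[OF borel_measurable_const m1]]
          by (simp add: nn_integral_cmult[OF m1] del: of_nat_Suc)
      qed
      also have "(\<integral>\<^sup>+z. ennreal (h (snd z)) \<partial>\<gamma>) = (\<integral>\<^sup>+x. ennreal (h x) \<partial>\<nu>)" by (rule couplingsD(6)[OF \<gamma>(1) m])
      also have "\<dots> \<le> (\<integral>\<^sup>+x. indicator (U n) x \<partial>\<nu>)"
        by (intro nn_integral_mono) (auto simp: h_def U_def infdist_nonneg max_def field_simps split: split_indicator)
      also have "ennreal (Suc n) * (\<integral>\<^sup>+z. ennreal (manhattan (fst z) (snd z)) \<partial>\<gamma>) \<le> ennreal (Suc n) * ennreal (e / Suc n)"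
        using \<gamma>(2) by (intro mult_left_mono) auto
      also have "ennreal (Suc n) * ennreal (e / Suc n) = ennreal e"
        using e by (subst ennreal_mult[symmetric]) auto
      finally show "emeasure \<mu> F \<le> emeasure \<nu> (U n) + ennreal e" by (simp add: add_mono)
    qed
    then show ?thesis by (simp add: M.emeasure_eq_measure N.emeasure_eq_measure)
  qed
  have "decseq U" unfolding U_def decseq_def by (auto intro: order.trans[OF _ divide_left_mono])
  then have "(\<lambda>n. measure \<nu> (U n)) \<longlonglongrightarrow> measure \<nu> (\<Inter>n. U n)"
    by (intro N.finite_Lim_measure_decseq) auto
  moreover have "(\<Inter>n. U n) = F"
  proof (intro equalityI subsetI)
    fix x assume x: "x \<in> (\<Inter>n. U n)"
    have "infdist x F \<le> 0"
    proof (rule ccontr)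
      assume "\<not> infdist x F \<le> 0"
      then obtain n where "1 / real (Suc n) < infdist x F" using nat_approx_posE[of "infdist x F"] by auto
      with x show False unfolding U_def by (auto simp: not_le[symmetric] simp del: of_nat_Suc)
    qed
    then show "x \<in> F" using in_closed_iff_infdist_zero[OF F, of x] infdist_nonneg[of x F] by simp
  qed (simp add: U_def)
  ultimately show ?thesis using FU by (intro LIMSEQ_le_const) auto
qed

lemma wdist_eq_0_imp_eq:
  assumes \<mu>: "tight_prob \<mu>" and \<nu>: "tight_prob \<nu>" and 0: "wdist \<mu> \<nu> = 0"
  shows "\<mu> = \<nu>"
proof -
  have sym: "wdist \<nu> \<mu> = 0" using 0 wdist_commute[OF \<mu> \<nu>] by simp
  interpret M: prob_space \<mu> using \<mu> by (rule tight_probD)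
  interpret N: prob_space \<nu> using \<nu> by (rule tight_probD)
  \<comment> \<open>The empty set is treated apart because its \<open>infdist\<close> is 0 by
    convention, which would make every neighbourhood the whole space.\<close>
  have eq: "emeasure \<mu> F = emeasure \<nu> F" if "closed F" for F
    using wdist_eq_0_imp_le_closed[OF \<mu> \<nu> 0 that] wdist_eq_0_imp_le_closed[OF \<nu> \<mu> sym that]
    by (cases "F = {}") (auto simp: M.emeasure_eq_measure N.emeasure_eq_measure)
  show "\<mu> = \<nu>"
  proof (rule measure_eqI_generator_eq[where E = "Collect closed" and A = "\<lambda>_. UNIV" and \<Omega> = UNIV])
    show "Int_stable (Collect closed)" by (auto simp: Int_stable_def)
    show "sets \<mu> = sigma_sets UNIV (Collect closed)" "sets \<nu> = sigma_sets UNIV (Collect closed)"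
      using tight_probD(2)[OF \<mu>] tight_probD(2)[OF \<nu>] by (simp_all add: borel_eq_closed)
  qed (use eq M.emeasure_finite in auto)
qed

text \<open>As $F$ need not be surjective, couplings of the images are pulled back by the inverse of $F$ on
  the product of two sigma-compact sets carrying the images.\<close>

lemma wdist_distr_similarity:
  fixes F :: "'a::metric_space \<times> 'a \<Rightarrow> 'a \<times> 'a"
  assumes \<mu>: "tight_prob \<mu>" and \<nu>: "tight_prob \<nu>" and F: "continuous_on UNIV F"
    and "0 < c" and sim: "\<And>z w. manhattan (F z) (F w) = c * manhattan z w"
  shows "wdist (distr \<mu> borel F) (distr \<nu> borel F) = ennreal c * wdist \<mu> \<nu>"
proof (rule antisym)
  have inv_c: "ennreal (1 / c) * (ennreal c * x) = x" "ennreal c * (ennreal (1 / c) * x) = x" for x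
    using \<open>0 < c\<close> by (simp_all flip: mult.assoc ennreal_mult)
  have "ennreal (1 / c) * wdist (distr \<mu> borel F) (distr \<nu> borel F) \<le> wdist \<mu> \<nu>"
    unfolding wdist_def[of \<mu> \<nu>]
  proof (rule INF_greatest)
    fix \<gamma> assume \<gamma>: "\<gamma> \<in> couplings \<mu> \<nu>"
    have t: "tight_prob \<gamma>" using \<gamma> \<mu> \<nu> by (rule tight_prob_coupling)
    have c: "continuous_on UNIV (\<lambda>z. F (fst z))" "continuous_on UNIV (\<lambda>z. F (snd z))"
      by (intro continuous_on_compose2[OF F] continuous_intros; simp)+
    have "distr \<mu> borel F = distr \<gamma> borel (\<lambda>z. F (fst z))" "distr \<nu> borel F = distr \<gamma> borel (\<lambda>z. F (snd z))"
      unfolding couplingsD(3,4)[OF \<gamma>, symmetric]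
      by (simp_all add: distr_distr_continuous[OF t _ F] continuous_on_fst continuous_on_snd)
    then have "wdist (distr \<mu> borel F) (distr \<nu> borel F) \<le> (\<integral>\<^sup>+z. ennreal (manhattan (F (fst z)) (F (snd z))) \<partial>\<gamma>)"
      using wdist_distr_le[OF t c] by simp
    also have "\<dots> = (\<integral>\<^sup>+z. ennreal c * ennreal (manhattan (fst z) (snd z)) \<partial>\<gamma>)"
      using \<open>0 < c\<close> by (simp add: sim ennreal_mult)
    also have "\<dots> = ennreal c * (\<integral>\<^sup>+z. ennreal (manhattan (fst z) (snd z)) \<partial>\<gamma>)"
      by (rule nn_integral_cmult) (unfold tight_probD(5)[OF t], rule borel_measurable_manhattan)
    finally show "ennreal (1 / c) * wdist (distr \<mu> borel F) (distr \<nu> borel F) \<le> (\<integral>\<^sup>+z. ennreal (manhattan (fst z) (snd z)) \<partial>\<gamma>)"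
      using inv_c(1) mult_left_mono by (metis zero_le)
  qed
  then show "wdist (distr \<mu> borel F) (distr \<nu> borel F) \<le> ennreal c * wdist \<mu> \<nu>"
    using inv_c(2) mult_left_mono by (metis zero_le)
next
  have "inj F"
  proof (rule injI)
    fix z w assume "F z = F w"
    then have "manhattan z w = 0" using sim[of z w] \<open>0 < c\<close> by (simp add: manhattan_def)
    then show "z = w" using dist_le_manhattan[of z w] by simp
  qed
  then have inv_F: "inv F (F z) = z" for z by simp
  \<comment> \<open>The inverse is Lipschitz on the range; the constant 2 / c reflects the
    comparison of the Manhattan with the product metric.\<close>
  have cont_inv: "continuous_on (range F) (inv F)"
  proof (rule continuous_onI)
    fix x e :: real and z assume "z \<in> range F" "0 < e"
    show "\<exists>d>0. \<forall>w\<in>range F. dist w z < d \<longrightarrow> dist (inv F w) (inv F z) \<le> e"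
    proof (intro exI conjI ballI impI)
      show "0 < e * c / 2" using \<open>0 < e\<close> \<open>0 < c\<close> by simp
      fix w assume "w \<in> range F" "dist w z < e * c / 2"
      then obtain w' z' where wz: "w = F w'" "z = F z'" using \<open>z \<in> range F\<close> by auto
      have "c * dist w' z' \<le> manhattan w z"
        using dist_le_manhattan[of w' z'] \<open>0 < c\<close> by (simp add: wz sim)
      also have "\<dots> \<le> 2 * dist w z" by (rule manhattan_le_2_dist)
      also have "\<dots> \<le> c * e" using \<open>dist w z < e * c / 2\<close> by (simp add: mult.commute)
      finally show "dist (inv F w) (inv F z) \<le> e" using \<open>0 < c\<close> by (simp add: wz inv_F)
    qed
  qed
  obtain S where S: "sigma_compact S" "AE x in \<mu>. x \<in> S" using \<mu> by (rule tight_probE)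
  obtain T where T: "sigma_compact T" "AE x in \<nu>. x \<in> T" using \<nu> by (rule tight_probE)
  define A where "A = F ` S"
  define B where "B = F ` T"
  have AB: "sigma_compact A" "sigma_compact B" unfolding A_def B_def by (intro sigma_compact_image S T F)+
  \<comment> \<open>On the sigma-compact set A x B the inverse is continuous, and a constant
    elsewhere makes H Borel on the whole space. Couplings of the image laws give the complement
    measure zero.\<close>
  define H where "H z = (if z \<in> A \<times> B then (inv F (fst z), inv F (snd z)) else undefined)" for z
  \<comment> \<open>The one-coordinate inverses. On A x B the coordinates of H are g A and g B, each
    depending on a single variable, so the marginals of the pulled-back coupling can be
    computed.\<close>
  define g where "g C z = (if z \<in> C then inv F z else undefined)" for C z
  have H[measurable]: "H \<in> measurable borel borel"
    unfolding H_def
    by (intro borel_measurable_continuous_on_if sigma_compact_borel sigma_compact_Times AB continuous_intros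
      continuous_on_compose2[OF cont_inv]) (auto simp: A_def B_def)
  have g[measurable]: "g A \<in> borel_measurable borel" "g B \<in> borel_measurable borel"
    unfolding g_def
    by (intro borel_measurable_continuous_on_if sigma_compact_borel AB continuous_intros
      continuous_on_subset[OF cont_inv]; auto simp: A_def B_def)+
  have mF[measurable]: "F \<in> borel_measurable borel" using F by (rule borel_measurable_continuous_onI)
  note [measurable_cong] = tight_probD(2)[OF \<mu>] tight_probD(2)[OF \<nu>]
  have tF: "tight_prob (distr \<mu> borel F)" "tight_prob (distr \<nu> borel F)"
    using \<mu> \<nu> F by (auto intro: tight_prob_distr)
  have AE_A: "AE z in distr \<mu> borel F. z \<in> A" "AE z in distr \<nu> borel F. z \<in> B"
    using S(2) T(2) sigma_compact_borel[OF AB(1)] sigma_compact_borel[OF AB(2)]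
    by (subst AE_distr_iff; auto simp: A_def B_def elim!: eventually_mono)+
  show "ennreal c * wdist \<mu> \<nu> \<le> wdist (distr \<mu> borel F) (distr \<nu> borel F)"
    unfolding wdist_def[of "distr \<mu> borel F"]
  proof (rule INF_greatest)
    fix \<gamma> assume \<gamma>: "\<gamma> \<in> couplings (distr \<mu> borel F) (distr \<nu> borel F)"
    note [measurable_cong] = couplingsD(2)[OF \<gamma>]
    have AE: "AE z in \<gamma>. z \<in> A \<times> B"
      using couplingsD(7)[OF \<gamma> AE_A(1)] couplingsD(8)[OF \<gamma> AE_A(2)] by eventually_elim (simp add: mem_Times_iff)
    have H\<gamma>: "H \<in> measurable \<gamma> borel" by measurable
    have "distr \<gamma> borel H \<in> couplings \<mu> \<nu>"
    proof (rule couplingsI[OF \<mu> \<nu>])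
      fix f :: "'a \<times> 'a \<Rightarrow> ennreal" assume f[measurable]: "f \<in> borel_measurable borel"
      have "(\<integral>\<^sup>+z. f (fst z) \<partial>distr \<gamma> borel H) = (\<integral>\<^sup>+z. f (fst (H z)) \<partial>\<gamma>)"
        by (intro nn_integral_distr_borel H\<gamma>) measurable
      also have "\<dots> = (\<integral>\<^sup>+z. f (g A (fst z)) \<partial>\<gamma>)"
        by (rule nn_integral_cong_AE, use AE in eventually_elim) (auto simp: H_def g_def)
      also have "\<dots> = (\<integral>\<^sup>+x. f (g A x) \<partial>distr \<mu> borel F)"
        by (rule couplingsD(5)[OF \<gamma>, of "\<lambda>x. f (g A x)"]) measurable
      also have "\<dots> = (\<integral>\<^sup>+x. f (g A (F x)) \<partial>\<mu>)"
        by (intro nn_integral_distr_borel) measurable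
      also have "\<dots> = (\<integral>\<^sup>+x. f x \<partial>\<mu>)"
        by (rule nn_integral_cong_AE, use S(2) in eventually_elim) (auto simp: g_def A_def inv_F)
      finally show "(\<integral>\<^sup>+z. f (fst z) \<partial>distr \<gamma> borel H) = (\<integral>\<^sup>+x. f x \<partial>\<mu>)" .
      have "(\<integral>\<^sup>+z. f (snd z) \<partial>distr \<gamma> borel H) = (\<integral>\<^sup>+z. f (snd (H z)) \<partial>\<gamma>)"
        by (intro nn_integral_distr_borel H\<gamma>) measurable
      also have "\<dots> = (\<integral>\<^sup>+z. f (g B (snd z)) \<partial>\<gamma>)"
        by (rule nn_integral_cong_AE, use AE in eventually_elim) (auto simp: H_def g_def)
      also have "\<dots> = (\<integral>\<^sup>+x. f (g B x) \<partial>distr \<nu> borel F)"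
        by (rule couplingsD(6)[OF \<gamma>, of "\<lambda>x. f (g B x)"]) measurable
      also have "\<dots> = (\<integral>\<^sup>+x. f (g B (F x)) \<partial>\<nu>)"
        by (intro nn_integral_distr_borel) measurable
      also have "\<dots> = (\<integral>\<^sup>+x. f x \<partial>\<nu>)"
        by (rule nn_integral_cong_AE, use T(2) in eventually_elim) (auto simp: g_def B_def inv_F)
      finally show "(\<integral>\<^sup>+z. f (snd z) \<partial>distr \<gamma> borel H) = (\<integral>\<^sup>+x. f x \<partial>\<nu>)" .
    qed simp
    then have "ennreal c * wdist \<mu> \<nu> \<le> ennreal c * (\<integral>\<^sup>+z. ennreal (manhattan (fst z) (snd z)) \<partial>distr \<gamma> borel H)"
      by (intro mult_left_mono wdist_le) auto
    also have "(\<integral>\<^sup>+z. ennreal (manhattan (fst z) (snd z)) \<partial>distr \<gamma> borel H) = (\<integral>\<^sup>+z. ennreal (manhattan (fst (H z)) (snd (H z))) \<partial>\<gamma>)"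
      by (rule nn_integral_distr_borel[OF H\<gamma> borel_measurable_manhattan])
    also have "ennreal c * \<dots> = (\<integral>\<^sup>+z. ennreal c * ennreal (manhattan (fst (H z)) (snd (H z))) \<partial>\<gamma>)"
      using measurable_compose[OF H\<gamma> borel_measurable_manhattan] by (rule nn_integral_cmult[symmetric])
    also have "\<dots> = (\<integral>\<^sup>+z. ennreal (manhattan (fst z) (snd z)) \<partial>\<gamma>)"
    proof (rule nn_integral_cong_AE, use AE in eventually_elim)
      case (elim z)
      then obtain u v where "z = (F u, F v)" "z \<in> A \<times> B" by (cases z) (auto simp: A_def B_def)
      then show ?case using \<open>0 < c\<close> by (simp add: H_def inv_F sim flip: ennreal_mult)
    qed
    finally show "ennreal c * wdist \<mu> \<nu> \<le> (\<integral>\<^sup>+z. ennreal (manhattan (fst z) (snd z)) \<partial>\<gamma>)" .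
  qed
qed

text \<open>Applying f to both coordinates commutes with forming the product of the marginals and
  multiplies the Manhattan metric by c, so both arguments of the transport cost are mapped
  alike.\<close>

lemma dcov_distr_similarity:
  fixes f :: "'a::metric_space \<Rightarrow> 'a"
  assumes J: "tight_prob J" and "0 < c" and sim: "\<And>x y. dist (f x) (f y) = c * dist x y" and f: "continuous_on UNIV f"
  shows "dcov (distr J borel (\<lambda>z. (f (fst z), f (snd z)))) = ennreal c * dcov J"
proof -
  let ?F = "\<lambda>z. (f (fst z), f (snd z))"
  have F: "continuous_on UNIV ?F"
    by (intro continuous_intros continuous_on_compose2[OF f]) auto
  have "indep_law (distr J borel ?F) = distr (indep_law J) borel ?F"
    unfolding indep_law_def
    by (simp add: distr_rprod[OF tight_prob_marginals[OF J] f f] distr_distr_continuous[OF J] F f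
      continuous_on_fst continuous_on_snd)
  then show ?thesis
    unfolding dcov_def using \<open>0 < c\<close>
    by (simp add: wdist_distr_similarity[OF J tight_prob_indep_law[OF J] F \<open>0 < c\<close>] manhattan_def sim distrib_left)
qed

section \<open>Correlation of random variables\<close>

lemma similarity_continuous: "similarity f \<Longrightarrow> continuous_on UNIV f"
proof -
  assume "similarity f"
  then obtain c where c: "0 < c" "\<And>x y. dist (f x) (f y) = c * dist x y" unfolding similarity_def by auto
  show "continuous_on UNIV f"
    by (rule lipschitz_on_continuous_on[where L = c], rule lipschitz_onI) (use c in auto)
qed

lemma
  assumes "admissible_pair M X Y"
  shows admissible_pair_tight: "tight_prob (joint_law M X Y)" "tight_prob (law M X)" "tight_prob (law M Y)"
    and admissible_pair_law: "law M X = distr (joint_law M X Y) borel fst" "law M Y = distr (joint_law M X Y) borel snd"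
proof -
  have *: "prob_space M" "X \<in> borel_measurable M" "Y \<in> borel_measurable M" "(\<lambda>\<omega>. (X \<omega>, Y \<omega>)) \<in> borel_measurable M"
    "radon (law M X)" "radon (law M Y)" "radon (joint_law M X Y)"
    using assms by (auto simp: admissible_pair_def)
  show "tight_prob (joint_law M X Y)" "tight_prob (law M X)" "tight_prob (law M Y)"
    using * by (auto simp: tight_prob_iff_radon law_def joint_law_def intro: prob_space.prob_space_distr)
  show "law M X = distr (joint_law M X Y) borel fst" "law M Y = distr (joint_law M X Y) borel snd"
    unfolding law_def joint_law_def using *(4) by (simp_all add: distr_distr comp_def)
qed

text \<open>The hypotheses are the marginal identities rather than \<open>admissible_pair\<close>,
  so that the formula also applies to image pairs under f without proving them admissible.\<close>

lemma eCov_eq_dcov: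
  assumes "law M X = distr (joint_law M X Y) borel fst" "law M Y = distr (joint_law M X Y) borel snd"
  shows "eCov M X Y = enn2real (dcov (joint_law M X Y))"
proof -
  have "prod_law M X Y = rprod (law M X) (law M Y)" unfolding prod_law_def rprod_def ..
  then show ?thesis
    unfolding eCov_def emd_manhattan_eq dcov_def indep_law_def assms[symmetric] by simp
qed

lemma joint_law_diagonal:
  assumes "X \<in> borel_measurable M"
  shows "joint_law M X X = distr (law M X) borel (\<lambda>x. (x, x))"
  unfolding joint_law_def law_def using assms
  by (subst distr_distr) (auto simp: comp_def intro!: borel_measurable_continuous_onI continuous_intros)

text \<open>A variance is the covariance of a pair (X, X). Its joint law is the image of the law of
  X under the continuous diagonal map and therefore Radon.\<close>

lemma admissible_pair_diagonal:
  fixes X Y :: "'b \<Rightarrow> 'a::metric_space"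
  assumes "admissible_pair M X Y"
  shows "admissible_pair M X X" "admissible_pair M Y Y"
proof -
  have pair: "(\<lambda>x :: 'a. (x, x)) \<in> borel_measurable borel" by (intro borel_measurable_continuous_onI continuous_intros)
  have "radon (joint_law M X X)" "radon (joint_law M Y Y)"
    using assms admissible_pair_tight[OF assms]
    by (auto simp: admissible_pair_def joint_law_diagonal intro!: tight_prob_imp_radon tight_prob_distr continuous_intros)
  then show "admissible_pair M X X" "admissible_pair M Y Y"
    using assms measurable_compose[OF _ pair, of X M] measurable_compose[OF _ pair, of Y M]
    by (auto simp: admissible_pair_def)
qed

text \<open>Finite first moments keep the variance from being truncated to 0, and nondegeneracy
  excludes a vanishing mean distance; together they make the denominator of the correlation
  positive.\<close>

lemma
  assumes "admissible_pair M X Y"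
  shows eVar_eq_gini: "eVar M X = enn2real (gini (law M X))" "eVar M Y = enn2real (gini (law M Y))"
    and gini_law_finite: "gini (law M X) < \<infinity>" "gini (law M Y) < \<infinity>"
    and eVar_pos: "0 < eVar M X" "0 < eVar M Y"
proof -
  have *: "eVar M X = enn2real (gini (law M X)) \<and> gini (law M X) < \<infinity> \<and> 0 < eVar M X"
    if adm: "admissible_pair M X X" for X :: "'a \<Rightarrow> 'b"
  proof -
    have X: "X \<in> borel_measurable M" using adm by (auto simp: admissible_pair_def)
    note t = admissible_pair_tight(2)[OF adm]
    have eq: "eVar M X = enn2real (gini (law M X))"
      unfolding eVar_def eCov_eq_dcov[OF admissible_pair_law[OF adm]] joint_law_diagonal[OF X] dcov_diagonal[OF t] ..
    obtain x0 where "(\<integral>\<^sup>+\<omega>. ennreal (dist (X \<omega>) x0) \<partial>M) < \<infinity>"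
      using adm by (auto simp: admissible_pair_def finite_first_moment_def)
    moreover have "(\<integral>\<^sup>+x. ennreal (dist x x0) \<partial>law M X) = (\<integral>\<^sup>+\<omega>. ennreal (dist (X \<omega>) x0) \<partial>M)"
      unfolding law_def by (intro nn_integral_distr_borel X borel_measurable_continuous_real continuous_intros)
    ultimately have fin: "gini (law M X) < \<infinity>" by (intro gini_finite[OF t, of x0]) simp
    have "gini (law M X) \<noteq> 0"
    proof
      assume "gini (law M X) = 0"
      then obtain c where "AE x in law M X. x = c" using gini_eq_0_imp_constant[OF t] by auto
      then have "AE \<omega> in M. X \<omega> = c" unfolding law_def by (rule AE_distrD[OF X])
      then show False using adm by (auto simp: admissible_pair_def nondegenerate_def)
    qed
    then have "0 < eVar M X" unfolding eq using fin by (simp add: enn2real_positive_iff zero_less_iff_neq_zero)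
    with eq fin show ?thesis by simp
  qed
  show "eVar M X = enn2real (gini (law M X))" "eVar M Y = enn2real (gini (law M Y))"
    "gini (law M X) < \<infinity>" "gini (law M Y) < \<infinity>" "0 < eVar M X" "0 < eVar M Y"
    using *[OF admissible_pair_diagonal(1)[OF assms]] *[OF admissible_pair_diagonal(2)[OF assms]] by auto
qed

text \<open>This ensures that a zero real covariance means zero transport cost and not a truncated
  infinite one.\<close>

lemma dcov_joint_law_finite:
  assumes adm: "admissible_pair M X Y"
  shows "dcov (joint_law M X Y) < \<infinity>"
  using dcov_le_fst[OF admissible_pair_tight(1)[OF adm]] gini_law_finite(1)[OF adm]
  unfolding gini_def admissible_pair_law(1)[OF adm] by (rule le_less_trans)

text \<open>Independence speaks of the product sigma-algebra, the joint law of all Borel sets. The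
  two descriptions meet on rectangles, which determine either measure.\<close>

lemma indep_var_iff_joint_law:
  assumes adm: "admissible_pair M X Y"
  shows "prob_space.indep_var M borel X borel Y \<longleftrightarrow> joint_law M X Y = indep_law (joint_law M X Y)"
proof -
  interpret prob_space M using adm by (simp add: admissible_pair_def)
  have [measurable]: "X \<in> borel_measurable M" "Y \<in> borel_measurable M" and XY: "(\<lambda>\<omega>. (X \<omega>, Y \<omega>)) \<in> borel_measurable M"
    using adm by (auto simp: admissible_pair_def)
  note t = admissible_pair_tight[OF adm]
  have ind: "indep_law (joint_law M X Y) = rprod (law M X) (law M Y)"
    unfolding indep_law_def admissible_pair_law[OF adm, symmetric] ..
  have rect: "emeasure (joint_law M X Y) (A \<times> B) = emeasure (distr M (borel \<Otimes>\<^sub>M borel) (\<lambda>\<omega>. (X \<omega>, Y \<omega>))) (A \<times> B)"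
    if "A \<in> sets borel" "B \<in> sets borel" for A B
    unfolding joint_law_def using that borel_Times[OF that] XY by (simp add: emeasure_distr)
  have "indep_var borel X borel Y \<longleftrightarrow> law M X \<Otimes>\<^sub>M law M Y = distr M (borel \<Otimes>\<^sub>M borel) (\<lambda>\<omega>. (X \<omega>, Y \<omega>))"
    unfolding indep_var_distribution_eq law_def by simp
  also have "\<dots> \<longleftrightarrow> joint_law M X Y = rprod (law M X) (law M Y)"
  proof
    assume eq: "law M X \<Otimes>\<^sub>M law M Y = distr M (borel \<Otimes>\<^sub>M borel) (\<lambda>\<omega>. (X \<omega>, Y \<omega>))"
    show "joint_law M X Y = rprod (law M X) (law M Y)"
    proof (rule rprod_unique[OF t(2,3), symmetric])
      fix A B :: "'b set" assume "A \<in> sets borel" "B \<in> sets borel"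
      then show "emeasure (joint_law M X Y) (A \<times> B) = emeasure (law M X) A * emeasure (law M Y) B"
        using sigma_finite_measure.emeasure_pair_measure_Times[OF tight_probD(7)[OF t(3)], of A "law M X" B]
        by (simp add: rect eq[symmetric] tight_probD[OF t(2)] tight_probD[OF t(3)])
    qed (simp add: joint_law_def)
  next
    assume eq: "joint_law M X Y = rprod (law M X) (law M Y)"
    show "law M X \<Otimes>\<^sub>M law M Y = distr M (borel \<Otimes>\<^sub>M borel) (\<lambda>\<omega>. (X \<omega>, Y \<omega>))"
    proof (rule pair_measure_eqI)
      fix A B assume "A \<in> sets (law M X)" "B \<in> sets (law M Y)"
      then have "A \<in> sets borel" "B \<in> sets borel" by (simp_all add: law_def)
      then show "emeasure (law M X) A * emeasure (law M Y) B = emeasure (distr M (borel \<Otimes>\<^sub>M borel) (\<lambda>\<omega>. (X \<omega>, Y \<omega>))) (A \<times> B)"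
        by (simp add: rect[symmetric] eq emeasure_rprod_Times[OF t(2,3)])
    qed (auto simp: tight_probD[OF t(2)] tight_probD[OF t(3)] cong: sets_pair_measure_cong)
  qed
  finally show ?thesis unfolding ind .
qed

lemma eCor_eq_0_iff:
  assumes adm: "admissible_pair M X Y"
  shows "eCor M X Y = 0 \<longleftrightarrow> prob_space.indep_var M borel X borel Y"
proof -
  note t = admissible_pair_tight(1)[OF adm]
  have "eCor M X Y = 0 \<longleftrightarrow> eCov M X Y = 0"
    unfolding eCor_def using eVar_pos[OF adm] by (simp add: min_def)
  also have "\<dots> \<longleftrightarrow> dcov (joint_law M X Y) = 0"
    using dcov_joint_law_finite[OF adm] unfolding eCov_eq_dcov[OF admissible_pair_law[OF adm]]
    by (auto simp: enn2real_eq_0_iff)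
  also have "\<dots> \<longleftrightarrow> joint_law M X Y = indep_law (joint_law M X Y)"
    unfolding dcov_def using wdist_eq_0_imp_eq[OF t tight_prob_indep_law[OF t]] wdist_refl[OF t] by metis
  finally show ?thesis unfolding indep_var_iff_joint_law[OF adm] .
qed

section \<open>Invariance under similarities and the value on graphs\<close>

lemma eCov_similarity:
  fixes X Y :: "'b \<Rightarrow> 'a::metric_space" and f :: "'a \<Rightarrow> 'a"
  assumes adm: "admissible_pair M X Y" and c: "0 < c" "\<And>x y. dist (f x) (f y) = c * dist x y" and f: "continuous_on UNIV f"
  shows "eCov M (f \<circ> X) (f \<circ> Y) = c * eCov M X Y"
proof -
  let ?F = "\<lambda>z. (f (fst z), f (snd z))"
  note t = admissible_pair_tight(1)[OF adm]
  have XY: "X \<in> borel_measurable M" "Y \<in> borel_measurable M" "(\<lambda>\<omega>. (X \<omega>, Y \<omega>)) \<in> borel_measurable M"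
    using adm by (auto simp: admissible_pair_def)
  have F: "continuous_on UNIV ?F"
    by (intro continuous_intros continuous_on_compose2[OF f]) auto
  have J: "joint_law M (f \<circ> X) (f \<circ> Y) = distr (joint_law M X Y) borel ?F"
    unfolding joint_law_def using XY(3) borel_measurable_continuous_onI[OF F] by (subst distr_distr) (auto simp: comp_def)
  have "law M (f \<circ> X) = distr (distr (joint_law M X Y) borel ?F) borel fst"
    "law M (f \<circ> Y) = distr (distr (joint_law M X Y) borel ?F) borel snd"
  proof -
    have "(\<lambda>\<omega>. (f (X \<omega>), f (Y \<omega>))) \<in> borel_measurable M"
      using measurable_compose[OF XY(3) borel_measurable_continuous_onI[OF F]] by simp
    then show "law M (f \<circ> X) = distr (distr (joint_law M X Y) borel ?F) borel fst"
      "law M (f \<circ> Y) = distr (distr (joint_law M X Y) borel ?F) borel snd"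
      unfolding J[symmetric] unfolding law_def joint_law_def by (simp_all add: distr_distr comp_def)
  qed
  then have "eCov M (f \<circ> X) (f \<circ> Y) = enn2real (dcov (distr (joint_law M X Y) borel ?F))"
    using eCov_eq_dcov[of M "f \<circ> X" "f \<circ> Y"] unfolding J by simp
  also have "\<dots> = enn2real (ennreal c * dcov (joint_law M X Y))"
    by (simp add: dcov_distr_similarity[OF t c f])
  also have "\<dots> = c * eCov M X Y"
    unfolding eCov_eq_dcov[OF admissible_pair_law[OF adm]] using c(1) by (simp add: enn2real_mult)
  finally show ?thesis .
qed

lemma eCor_similarity:
  assumes adm: "admissible_pair M X Y" and "similarity f"
  shows "eCor M (f \<circ> X) (f \<circ> Y) = eCor M X Y"
proof -
  obtain c where c: "0 < c" "\<And>x y. dist (f x) (f y) = c * dist x y" using assms(2) unfolding similarity_def by auto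
  note f = similarity_continuous[OF assms(2)]
  have "min (c * eVar M X) (c * eVar M Y) = c * min (eVar M X) (eVar M Y)"
    using c(1) by (simp add: min_mult_distrib_left)
  moreover have "eVar M (f \<circ> X) = c * eVar M X" "eVar M (f \<circ> Y) = c * eVar M Y"
    unfolding eVar_def
    by (rule eCov_similarity[OF admissible_pair_diagonal(1)[OF adm] c f] eCov_similarity[OF admissible_pair_diagonal(2)[OF adm] c f])+
  ultimately show ?thesis unfolding eCor_def eCov_similarity[OF adm c f] using c(1) by simp
qed

lemma eCor_graph:
  assumes adm: "admissible_pair M X Y" and "similarity f" and graph: "AE \<omega> in M. Y \<omega> = f (X \<omega>)"
  shows "eCor M X Y = 1"
proof -
  obtain c where c: "0 < c" "\<And>x y. dist (f x) (f y) = c * dist x y" using assms(2) unfolding similarity_def by auto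
  note f = similarity_continuous[OF assms(2)]
  have XY: "(\<lambda>\<omega>. (X \<omega>, Y \<omega>)) \<in> borel_measurable M" using adm by (auto simp: admissible_pair_def)
  have "{z. snd z = f (fst z)} \<in> sets borel"
    by (intro borel_closed closed_Collect_eq continuous_intros continuous_on_compose2[OF f]) auto
  then have "AE z in joint_law M X Y. snd z = f (fst z)"
    unfolding joint_law_def using graph by (subst AE_distr_iff[OF XY]) auto
  then have "dcov (joint_law M X Y) = min (gini (law M X)) (gini (law M Y))"
    unfolding admissible_pair_law[OF adm] by (rule dcov_graph[OF admissible_pair_tight(1)[OF adm] c f])
  \<comment> \<open>Truncation commutes with the minimum only for finite values; an infinite
    argument would become 0.\<close>
  moreover have "enn2real (min a b) = min (enn2real a) (enn2real b)" if "a < \<infinity>" "b < \<infinity>" for a b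
    using that by (cases a; cases b) (auto simp: min_def ennreal_le_iff)
  ultimately have "eCov M X Y = min (eVar M X) (eVar M Y)"
    unfolding eCov_eq_dcov[OF admissible_pair_law[OF adm]] using eVar_eq_gini[OF adm] gini_law_finite[OF adm] by simp
  then show ?thesis unfolding eCor_def using eVar_pos[OF adm] by (simp add: min_def)
qed

section \<open>Continuity under weak convergence\<close>

lemma eCov_tendsto:
  fixes Xs :: "nat \<Rightarrow> 'b \<Rightarrow> 'a::metric_space"
  assumes adm: "\<And>n. admissible_pair (Ms n) (Xs n) (Ys n)" and adm': "admissible_pair M X Y"
    and K: "\<And>n. (\<integral>\<^sup>+\<omega>. ennreal ((dist (Xs n \<omega>) x0)\<^sup>2 + (dist (Ys n \<omega>) y0)\<^sup>2) \<partial>Ms n) \<le> ennreal K" "0 \<le> K"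
    and conv: "conv_distr (\<lambda>n. joint_law (Ms n) (Xs n) (Ys n)) (joint_law M X Y)"
  shows "(\<lambda>n. eCov (Ms n) (Xs n) (Ys n)) \<longlonglongrightarrow> eCov M X Y"
proof (rule tendstoI)
  fix e :: real assume e: "0 < e"
  define Js where "Js n = joint_law (Ms n) (Xs n) (Ys n)" for n
  define J where "J = joint_law M X Y"
  have t: "tight_prob (Js n)" "tight_prob J" for n
    unfolding Js_def J_def using adm adm' by (auto intro: admissible_pair_tight)
  have fin: "dcov (Js n) < top" "dcov J < top" for n
    unfolding Js_def J_def using dcov_joint_law_finite[OF adm] dcov_joint_law_finite[OF adm'] by auto
  have "(\<integral>\<^sup>+z. ennreal ((dist z (x0, y0))\<^sup>2) \<partial>Js n) \<le> ennreal K" for n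
  proof -
    have "(\<lambda>\<omega>. (Xs n \<omega>, Ys n \<omega>)) \<in> borel_measurable (Ms n)" using adm by (auto simp: admissible_pair_def)
    then have "(\<integral>\<^sup>+z. ennreal ((dist z (x0, y0))\<^sup>2) \<partial>Js n) = (\<integral>\<^sup>+\<omega>. ennreal ((dist (Xs n \<omega>, Ys n \<omega>) (x0, y0))\<^sup>2) \<partial>Ms n)"
      unfolding Js_def joint_law_def
      by (intro nn_integral_distr_borel borel_measurable_continuous_real continuous_intros)
    \<comment> \<open>The squared product distance is exactly the sum of the two squared distances,
      so the hypothesis is a second moment bound for the joint law.\<close>
    then show ?thesis using K(1)[of n] by (simp add: dist_Pair_Pair)
  qed
  \<comment> \<open>The covariance is 2-Lipschitz, so e/4 yields a deviation of at most e/2,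
    strictly below e.\<close>
  from conv_distr_wdist_tendsto_0[OF t conv[folded Js_def J_def] this K(2), of "e / 4"] e
  have "\<forall>\<^sub>F n in sequentially. wdist (Js n) J \<le> ennreal (e / 4)" by simp
  then show "\<forall>\<^sub>F n in sequentially. dist (eCov (Ms n) (Xs n) (Ys n)) (eCov M X Y) < e"
  proof eventually_elim
    case (elim n)
    have two: "2 * wdist (Js n) J \<le> ennreal (e / 2)"
    proof -
      have "2 * wdist (Js n) J \<le> ennreal 2 * ennreal (e / 4)" using elim by (simp add: mult_left_mono)
      also have "\<dots> = ennreal (e / 2)" using e by (subst ennreal_mult[symmetric]) auto
      finally show ?thesis .
    qed
    obtain a where a: "0 \<le> a" "dcov (Js n) = ennreal a" using fin(1)[of n] by (cases "dcov (Js n)") auto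
    obtain b where b: "0 \<le> b" "dcov J = ennreal b" using fin(2) by (cases "dcov J") auto
    have "dcov (Js n) \<le> dcov J + ennreal (e / 2)"
      using dcov_le_add_wdist[OF t(1)[of n] t(2)] two by (meson add_left_mono order.trans)
    moreover have "dcov J \<le> dcov (Js n) + ennreal (e / 2)"
      using dcov_le_add_wdist[OF t(2) t(1)[of n]] two unfolding wdist_commute[OF t(2) t(1)]
      by (meson add_left_mono order.trans)
    ultimately have "a \<le> b + e / 2" "b \<le> a + e / 2"
      using a b e by (simp_all flip: ennreal_plus)
    then have "\<bar>enn2real (dcov (Js n)) - enn2real (dcov J)\<bar> < e" using a b e by simp
    then show ?case
      unfolding eCov_eq_dcov[OF admissible_pair_law[OF adm]] eCov_eq_dcov[OF admissible_pair_law[OF adm']]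
      by (simp add: dist_real_def Js_def J_def)
  qed
qed

text \<open>Carries weak convergence of the joint laws over to the laws of (X, X) and (Y, Y), which
  the variances depend on.\<close>

lemma conv_distr_continuous_map:
  fixes h :: "'s::metric_space \<Rightarrow> 't::metric_space"
  assumes "conv_distr \<mu>s \<mu>" and h: "continuous_on UNIV h" and sets: "\<And>n. sets (\<mu>s n) = sets borel" "sets \<mu> = sets borel"
  shows "conv_distr (\<lambda>n. distr (\<mu>s n) borel h) (distr \<mu> borel h)"
  unfolding conv_distr_def
proof (intro allI impI)
  fix f :: "'t \<Rightarrow> real" assume f: "continuous_on UNIV f \<and> bounded (range f)"
  have "continuous_on UNIV (\<lambda>x. f (h x))" using f h by (auto intro: continuous_on_compose2)
  moreover have "bounded (range (\<lambda>x. f (h x)))" using f by (auto intro: bounded_subset)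
  moreover have "h \<in> measurable \<mu> borel" "h \<in> measurable (\<mu>s n) borel" "f \<in> borel_measurable borel" for n
    using f h sets by (auto intro!: borel_measurable_continuous_onI simp: measurable_cong_sets[OF sets(1) refl] measurable_cong_sets[OF sets(2) refl])
  ultimately show "(\<lambda>n. integral\<^sup>L (distr (\<mu>s n) borel h) f) \<longlonglongrightarrow> integral\<^sup>L (distr \<mu> borel h) f"
    using assms(1) unfolding conv_distr_def by (simp add: integral_distr)
qed

text \<open>Numerator and both variances are covariances, so the same convergence result handles all
  three, and the limiting denominator is positive.\<close>

lemma eCor_tendsto:
  fixes Ms :: "nat \<Rightarrow> 'b measure" and Xs Ys :: "nat \<Rightarrow> 'b \<Rightarrow> 'a::metric_space"
    and M :: "'b measure" and X Y :: "'b \<Rightarrow> 'a"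
  assumes adm: "\<And>n. admissible_pair (Ms n) (Xs n) (Ys n)" and adm': "admissible_pair M X Y"
    and K: "\<And>n. (\<integral>\<^sup>+\<omega>. ennreal ((dist (Xs n \<omega>) x0)\<^sup>2 + (dist (Ys n \<omega>) y0)\<^sup>2) \<partial>Ms n) \<le> ennreal K" "0 \<le> K"
    and conv: "conv_distr (\<lambda>n. joint_law (Ms n) (Xs n) (Ys n)) (joint_law M X Y)"
  shows "(\<lambda>n. eCor (Ms n) (Xs n) (Ys n)) \<longlonglongrightarrow> eCor M X Y"
proof -
  have XY: "(\<lambda>\<omega>. (X \<omega>, Y \<omega>)) \<in> borel_measurable M" using adm' by (auto simp: admissible_pair_def)
  have XYs: "(\<lambda>\<omega>. (Xs n \<omega>, Ys n \<omega>)) \<in> borel_measurable (Ms n)" for n using adm by (auto simp: admissible_pair_def)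
  have c: "continuous_on UNIV (\<lambda>z :: 'a \<times> 'a. (fst z, fst z))" "continuous_on UNIV (\<lambda>z :: 'a \<times> 'a. (snd z, snd z))"
    by (intro continuous_intros)+
  have diag: "joint_law M X X = distr (joint_law M X Y) borel (\<lambda>z. (fst z, fst z))"
    "joint_law M Y Y = distr (joint_law M X Y) borel (\<lambda>z. (snd z, snd z))"
    if "(\<lambda>\<omega>. (X \<omega>, Y \<omega>)) \<in> borel_measurable M" for M :: "'b measure" and X Y :: "'b \<Rightarrow> 'a"
    unfolding joint_law_def using that c[THEN borel_measurable_continuous_onI]
    by (simp_all add: distr_distr comp_def)
  have sets: "sets (joint_law (Ms n) (Xs n) (Ys n)) = sets borel" "sets (joint_law M X Y) = sets borel" for n
    by (simp_all add: joint_law_def)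
  \<comment> \<open>Each squared distance is at most the sum bounded by K and occurs twice in the
    diagonal pair, which doubles the constant.\<close>
  have bound: "(\<integral>\<^sup>+\<omega>. ennreal ((dist (Xs n \<omega>) x0)\<^sup>2 + (dist (Xs n \<omega>) x0)\<^sup>2) \<partial>Ms n) \<le> ennreal (2 * K)"
    "(\<integral>\<^sup>+\<omega>. ennreal ((dist (Ys n \<omega>) y0)\<^sup>2 + (dist (Ys n \<omega>) y0)\<^sup>2) \<partial>Ms n) \<le> ennreal (2 * K)" for n
  proof -
    have *: "(\<integral>\<^sup>+\<omega>. ennreal (u (Z \<omega>) + u (Z \<omega>)) \<partial>Ms n) \<le> ennreal (2 * K)"
      if Z: "Z \<in> borel_measurable (Ms n)" and u: "continuous_on UNIV u" "\<And>x. 0 \<le> u x"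
        and le: "\<And>\<omega>. u (Z \<omega>) \<le> (dist (Xs n \<omega>) x0)\<^sup>2 + (dist (Ys n \<omega>) y0)\<^sup>2"
      for Z :: "'b \<Rightarrow> 'a" and u
    proof -
      have "(\<integral>\<^sup>+\<omega>. ennreal (u (Z \<omega>) + u (Z \<omega>)) \<partial>Ms n) = (\<integral>\<^sup>+\<omega>. ennreal 2 * ennreal (u (Z \<omega>)) \<partial>Ms n)"
        using u(2) by (intro nn_integral_cong) (simp flip: ennreal_mult del: ennreal_numeral)
      also have "\<dots> = ennreal 2 * (\<integral>\<^sup>+\<omega>. ennreal (u (Z \<omega>)) \<partial>Ms n)"
        using measurable_compose[OF Z borel_measurable_continuous_real[OF u(1)]] by (rule nn_integral_cmult)
      also have "\<dots> \<le> ennreal 2 * ennreal K"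
        using le by (intro mult_left_mono order.trans[OF nn_integral_mono K(1)[of n]] ennreal_leI) auto
      also have "\<dots> = ennreal (2 * K)" using K(2) by (subst ennreal_mult[symmetric]) auto
      finally show ?thesis .
    qed
    have "Xs n \<in> borel_measurable (Ms n)" "Ys n \<in> borel_measurable (Ms n)"
      using adm[of n] by (auto simp: admissible_pair_def)
    then show "(\<integral>\<^sup>+\<omega>. ennreal ((dist (Xs n \<omega>) x0)\<^sup>2 + (dist (Xs n \<omega>) x0)\<^sup>2) \<partial>Ms n) \<le> ennreal (2 * K)"
      "(\<integral>\<^sup>+\<omega>. ennreal ((dist (Ys n \<omega>) y0)\<^sup>2 + (dist (Ys n \<omega>) y0)\<^sup>2) \<partial>Ms n) \<le> ennreal (2 * K)"
      by (intro *[of _ "\<lambda>x. (dist x x0)\<^sup>2"] *[of _ "\<lambda>x. (dist x y0)\<^sup>2"] continuous_intros; simp)+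
  qed
  have "0 \<le> 2 * K" using K(2) by simp
  have X: "(\<lambda>n. eVar (Ms n) (Xs n)) \<longlonglongrightarrow> eVar M X"
    unfolding eVar_def
    using conv_distr_continuous_map[OF conv c(1) sets]
    by (intro eCov_tendsto[OF admissible_pair_diagonal(1)[OF adm] admissible_pair_diagonal(1)[OF adm'] bound(1) \<open>0 \<le> 2 * K\<close>])
      (simp add: diag(1)[OF XY] diag(1)[OF XYs])
  have Y: "(\<lambda>n. eVar (Ms n) (Ys n)) \<longlonglongrightarrow> eVar M Y"
    unfolding eVar_def
    using conv_distr_continuous_map[OF conv c(2) sets]
    by (intro eCov_tendsto[OF admissible_pair_diagonal(2)[OF adm] admissible_pair_diagonal(2)[OF adm'] bound(2) \<open>0 \<le> 2 * K\<close>])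
      (simp add: diag(2)[OF XY] diag(2)[OF XYs])
  show ?thesis
    unfolding eCor_def using eVar_pos[OF adm']
    by (intro tendsto_divide tendsto_min X Y eCov_tendsto[OF adm adm' K conv]) auto
qed

theorem theorem7:
  shows
  "(\<forall>(M::'b measure) (X::'b \<Rightarrow> 'a::metric_space) Y. admissible_pair M X Y \<longrightarrow>
      (eCor M X Y = 0 \<longleftrightarrow> prob_space.indep_var M borel X borel Y))
   \<and> (\<forall>(M::'b measure) (X::'b \<Rightarrow> 'a) Y f. admissible_pair M X Y \<and> similarity f \<longrightarrow>
      eCor M (f \<circ> X) (f \<circ> Y) = eCor M X Y)
   \<and> (\<forall>(M::'b measure) (X::'b \<Rightarrow> 'a) Y f. admissible_pair M X Y \<and> similarity f \<and>
        (AE \<omega> in M. Y \<omega> = f (X \<omega>)) \<longrightarrow> eCor M X Y = 1)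
   \<and> (\<forall>(Ms::nat \<Rightarrow> 'b measure) (Xs::nat \<Rightarrow> 'b \<Rightarrow> 'a) Ys (M::'b measure) X Y.
        (\<forall>n. admissible_pair (Ms n) (Xs n) (Ys n)) \<and> admissible_pair M X Y \<and>
        (\<exists>x0 y0 (K::real). K > 0 \<and> (\<forall>n. (\<integral>\<^sup>+ \<omega>. ennreal ((dist (Xs n \<omega>) x0)\<^sup>2 + (dist (Ys n \<omega>) y0)\<^sup>2) \<partial>(Ms n)) \<le> ennreal K)) \<and>
        conv_distr (\<lambda>n. joint_law (Ms n) (Xs n) (Ys n)) (joint_law M X Y) \<longrightarrow>
        (\<lambda>n. eCor (Ms n) (Xs n) (Ys n)) \<longlonglongrightarrow> eCor M X Y)"
proof (intro conjI allI impI)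
  fix Ms :: "nat \<Rightarrow> 'b measure" and Xs Ys :: "nat \<Rightarrow> 'b \<Rightarrow> 'a" and M :: "'b measure" and X Y
  assume "(\<forall>n. admissible_pair (Ms n) (Xs n) (Ys n)) \<and> admissible_pair M X Y \<and>
        (\<exists>x0 y0 (K::real). K > 0 \<and> (\<forall>n. (\<integral>\<^sup>+ \<omega>. ennreal ((dist (Xs n \<omega>) x0)\<^sup>2 + (dist (Ys n \<omega>) y0)\<^sup>2) \<partial>(Ms n)) \<le> ennreal K)) \<and>
        conv_distr (\<lambda>n. joint_law (Ms n) (Xs n) (Ys n)) (joint_law M X Y)"
  then show "(\<lambda>n. eCor (Ms n) (Xs n) (Ys n)) \<longlonglongrightarrow> eCor M X Y"
  proof (elim conjE exE)
    fix x0 y0 and K :: real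
    assume "\<forall>n. admissible_pair (Ms n) (Xs n) (Ys n)" "admissible_pair M X Y" "0 < K"
      "\<forall>n. (\<integral>\<^sup>+ \<omega>. ennreal ((dist (Xs n \<omega>) x0)\<^sup>2 + (dist (Ys n \<omega>) y0)\<^sup>2) \<partial>(Ms n)) \<le> ennreal K"
      "conv_distr (\<lambda>n. joint_law (Ms n) (Xs n) (Ys n)) (joint_law M X Y)"
    then show ?thesis
      by (intro eCor_tendsto[of Ms Xs Ys M X Y x0 y0 K]) (erule spec | assumption | erule less_imp_le)+
  qed
qed (auto intro: eCor_similarity eCor_graph simp: eCor_eq_0_iff)

end
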